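(* Let $(\phi_1,\dots,\phi_n)$, $n\ge2$, be a Chebyshev asymptotic scale on $[T,x_0[$ with $\phi_i\in AC^{n-1}[T,x_0[$ and $W(\phi_1,\dots,\phi_i)>0$ on $[T,x_0[$ for $1\le i\le n$, and let $f\in AC^{n-1}[T,x_0[$. (I) Fix $i\in\{2,\dots,n-1\}$. The following are equivalent: (i) there are $a_1,\dots,a_i\in\mathbb R$ with $f(x)=\sum_{j=1}^ia_j\phi_j(x)+o(\phi_i(x))$ and $M_k[f(x)]=\sum_{j=k+1}^ia_jM_k[\phi_j(x)]+o(M_k[\phi_i(x)])$ for $1\le k\le i-1$, as $x\to x_0^-$; (ii) the limits $\lim_{x\to x_0^-}M_k[f(x)]=:a_{k+1}$ exist in $\mathbb R$ for $0\le k\le i-1$ (the $a_j$ coinciding with those in (i)); (iii) the limit $\lim_{x\to x_0^-}M_{i-1}[f(x)]=:a_i$ exists in $\mathbb R$; (iv) the improper integral $\int_T^{x_0}\frac{dt_i}{q_i(t_i)}\int_T^{t_i}\frac{dt_{i+1}}{q_{i+1}(t_{i+1})}\cdots\int_T^{t_{n-1}}\frac{L[f](t)}{q_n(t)}dt$ converges; and then also the iterated improper integral $\int_T^{x_0}\frac{dt_1}{q_1}\int_{t_1}^{x_0}\frac{dt_2}{q_2}\cdots\int_{t_{i-1}}^{x_0}\frac{dt_i}{q_i}\int_T^{t_i}\frac{dt_{i+1}}{q_{i+1}}\cdots\int_T^{t_{n-1}}\frac{L[f](t)}{q_n(t)}dt$ converges. (II) For $i=1$: there is $a_1\in\mathbb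 R$ with $f(x)=a_1\phi_1(x)+o(\phi_1(x))$ as $x\to x_0^-$ if and only if the improper integral $\int_T^{x_0}\frac{dt_1}{q_1(t_1)}\int_T^{t_1}\frac{dt_2}{q_2(t_2)}\cdots\int_T^{t_{n-1}}\frac{L[f](t)}{q_n(t)}dt$ converges.
   Context: $T\in\mathbb R$, $x_0\in\mathbb R\cup\{+\infty\}$, $T<x_0$. $AC^k(I)$: functions whose $k$-th derivative is absolutely continuous on every compact subinterval of $I$. $W(\cdot)$ is the Wronskian; $g\gg h$ as $x\to x_0^-$ means $h/g\to0$. A Chebyshev asymptotic scale on $[T,x_0[$: real $\phi_i\in C^{n-1}[T,x_0[$, each nonzero on a left deleted neighbourhood of $x_0$, $\phi_1\gg\dots\gg\phi_n$ as $x\to x_0^-$, $W(\phi_1,\dots,\phi_i)\neq0$ on $[T,x_0[$. $Lu:=W(\phi_1,\dots,\phi_n,u)/W(\phi_1,\dots,\phi_n)$ (defined a.e.). With $W_i:=W(\phi_1,\dots,\phi_i)$, $W_0:=1$: $q_0:=1/|\phi_1|$, $q_i:=W_i^2/|W_{i-1}W_{i+1}|$ ($1\le i\le n-1$), $q_n:=|W_n/W_{n-1}|$; $M_0u:=q_0u$, $M_ku:=q_k(M_{k-1}u)'$. Integrals $\int^{x_0}$ are improper. *)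

theory Defs
  imports "HOL-Analysis.Analysis" "HOL-Library.Landau_Symbols" "HOL-Combinatorics.Permutations"
begin

definition ival :: "real \<Rightarrow> ereal \<Rightarrow> real set" where
  "ival T x0 = {x. T \<le> x \<and> ereal x < x0}"

definition lfilt :: "ereal \<Rightarrow> real filter" where
  "lfilt x0 = (if x0 = \<infinity> then at_top else at_left (real_of_ereal x0))"

definition dS :: "real set \<Rightarrow> (real \<Rightarrow> real) \<Rightarrow> real \<Rightarrow> real" where
  "dS S g x = vector_derivative g (at x within S)"

definition hder :: "real set \<Rightarrow> nat \<Rightarrow> (real \<Rightarrow> real) \<Rightarrow> real \<Rightarrow> real" where
  "hder S k g = ((\<lambda>h. dS S h) ^^ k) g"

definition abs_cont_on :: "real \<Rightarrow> real \<Rightarrow> (real \<Rightarrow> real) \<Rightarrow> bool" where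
  "abs_cont_on a b g \<longleftrightarrow>
     (\<forall>\<epsilon>>0. \<exists>\<delta>>0. \<forall>(m::nat) (aa::nat\<Rightarrow>real) (bb::nat\<Rightarrow>real).
        (\<forall>k<m. a \<le> aa k \<and> aa k \<le> bb k \<and> bb k \<le> b) \<and>
        (\<forall>k<m. \<forall>l<m. k \<noteq> l \<longrightarrow> bb k \<le> aa l \<or> bb l \<le> aa k) \<and>
        (\<Sum>k<m. bb k - aa k) < \<delta>
        \<longrightarrow> (\<Sum>k<m. \<bar>g (bb k) - g (aa k)\<bar>) < \<epsilon>)"

definition ACk :: "real set \<Rightarrow> nat \<Rightarrow> (real \<Rightarrow> real) \<Rightarrow> bool" where
  "ACk S k g \<longleftrightarrow>
     (\<forall>j<k. \<forall>x\<in>S. (hder S j g has_real_derivative hder S (Suc j) g x) (at x within S)) \<and>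
     (\<forall>a b. a \<le> b \<and> {a..b} \<subseteq> S \<longrightarrow> abs_cont_on a b (hder S k g))"

text \<open>Wronskian W(g_0,...,g_{m-1})(x) = det [g_j^{(r)}(x)]_{r,j}, Leibniz formula.
  For the empty list it is 1.\<close>
definition wronsk :: "real set \<Rightarrow> (real \<Rightarrow> real) list \<Rightarrow> real \<Rightarrow> real" where
  "wronsk S gs x = (\<Sum>p | p permutes {..<length gs}.
      of_int (sign p) * (\<Prod>j<length gs. hder S (p j) (gs ! j) x))"

definition Wi :: "real set \<Rightarrow> (nat \<Rightarrow> real \<Rightarrow> real) \<Rightarrow> nat \<Rightarrow> real \<Rightarrow> real" where
  "Wi S \<phi> i x = wronsk S (map \<phi> [1..<Suc i]) x"

definition Lop :: "real set \<Rightarrow> (nat \<Rightarrow> real \<Rightarrow> real) \<Rightarrow> nat \<Rightarrow> (real \<Rightarrow> real) \<Rightarrow> real \<Rightarrow> real" where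
  "Lop S \<phi> n u x = wronsk S (map \<phi> [1..<Suc n] @ [u]) x / Wi S \<phi> n x"

definition qw :: "real set \<Rightarrow> (nat \<Rightarrow> real \<Rightarrow> real) \<Rightarrow> nat \<Rightarrow> nat \<Rightarrow> real \<Rightarrow> real" where
  "qw S \<phi> n k x =
     (if k = 0 then 1 / \<bar>\<phi> 1 x\<bar>
      else if k < n then (Wi S \<phi> k x)^2 / \<bar>Wi S \<phi> (k - 1) x * Wi S \<phi> (k + 1) x\<bar>
      else \<bar>Wi S \<phi> n x / Wi S \<phi> (n - 1) x\<bar>)"

fun Mop :: "real set \<Rightarrow> (nat \<Rightarrow> real \<Rightarrow> real) \<Rightarrow> nat \<Rightarrow> nat \<Rightarrow> (real \<Rightarrow> real) \<Rightarrow> real \<Rightarrow> real" where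
  "Mop S \<phi> n 0 u x = qw S \<phi> n 0 x * u x"
| "Mop S \<phi> n (Suc k) u x = qw S \<phi> n (Suc k) x * dS S (Mop S \<phi> n k u) x"

definition impr_conv :: "real \<Rightarrow> ereal \<Rightarrow> (real \<Rightarrow> real) \<Rightarrow> real \<Rightarrow> bool" where
  "impr_conv T x0 g t \<longleftrightarrow>
     (\<forall>b. t \<le> b \<and> b \<in> ival T x0 \<longrightarrow> g integrable_on {t..b}) \<and>
     (\<exists>l. ((\<lambda>b. integral {t..b} g) \<longlongrightarrow> l) (lfilt x0))"

definition impr_int :: "ereal \<Rightarrow> (real \<Rightarrow> real) \<Rightarrow> real \<Rightarrow> real" where
  "impr_int x0 g t = Lim (lfilt x0) (\<lambda>b. integral {t..b} g)"

text \<open>Kaux m = K_{n-m}, where K_n(t) = L[f](t)/q_n(t) and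
  K_j(t) = (1/q_j(t)) * int_T^t K_{j+1}(s) ds, so that
  K_j(t_j) = (1/q_j(t_j)) int_T^{t_j} dt_{j+1}/q_{j+1}(t_{j+1}) ... int_T^{t_{n-1}} L[f](t)/q_n(t) dt.\<close>
fun Kaux :: "real \<Rightarrow> real set \<Rightarrow> (nat \<Rightarrow> real \<Rightarrow> real) \<Rightarrow> nat \<Rightarrow> (real \<Rightarrow> real) \<Rightarrow> nat \<Rightarrow> real \<Rightarrow> real" where
  "Kaux T S \<phi> n f 0 t = Lop S \<phi> n f t / qw S \<phi> n n t"
| "Kaux T S \<phi> n f (Suc m) t = integral {T..t} (Kaux T S \<phi> n f m) / qw S \<phi> n (n - Suc m) t"

definition Kf :: "real \<Rightarrow> real set \<Rightarrow> (nat \<Rightarrow> real \<Rightarrow> real) \<Rightarrow> nat \<Rightarrow> (real \<Rightarrow> real) \<Rightarrow> nat \<Rightarrow> real \<Rightarrow> real" where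
  "Kf T S \<phi> n f j = Kaux T S \<phi> n f (n - j)"

text \<open>Integrands of the iterated integral
  int_T^{x0} dt_1/q_1 int_{t_1}^{x0} dt_2/q_2 ... int_{t_{i-1}}^{x0} K_i(t_i) dt_i :
  Lev d is the integrand of level i - d; Lev 0 = K_i and
  Lev (d+1)(s) = (1/q_{i-d-1}(s)) int_s^{x0} Lev d.\<close>
fun Lev :: "real \<Rightarrow> ereal \<Rightarrow> (nat \<Rightarrow> real \<Rightarrow> real) \<Rightarrow> nat \<Rightarrow> (real \<Rightarrow> real) \<Rightarrow> nat \<Rightarrow> nat \<Rightarrow> real \<Rightarrow> real" where
  "Lev T x0 \<phi> n f i 0 t = Kf T (ival T x0) \<phi> n f i t"
| "Lev T x0 \<phi> n f i (Suc d) t = impr_int x0 (Lev T x0 \<phi> n f i d) t / qw (ival T x0) \<phi> n (i - Suc d) t"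

definition iter_conv :: "real \<Rightarrow> ereal \<Rightarrow> (nat \<Rightarrow> real \<Rightarrow> real) \<Rightarrow> nat \<Rightarrow> (real \<Rightarrow> real) \<Rightarrow> nat \<Rightarrow> bool" where
  "iter_conv T x0 \<phi> n f i \<longleftrightarrow>
     (\<forall>d < i - 1. \<forall>t \<in> ival T x0. impr_conv T x0 (Lev T x0 \<phi> n f i d) t) \<and>
     impr_conv T x0 (Lev T x0 \<phi> n f i (i - 1)) T"

definition cheb_scale :: "real \<Rightarrow> ereal \<Rightarrow> nat \<Rightarrow> (nat \<Rightarrow> real \<Rightarrow> real) \<Rightarrow> bool" where
  "cheb_scale T x0 n \<phi> \<longleftrightarrow>
     (\<forall>i\<in>{1..n}. \<forall>k<n. continuous_on (ival T x0) (hder (ival T x0) k (\<phi> i))) \<and>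
     (\<forall>i\<in>{1..n}. \<forall>j<n - 1. \<forall>x\<in>ival T x0.
        (hder (ival T x0) j (\<phi> i) has_real_derivative hder (ival T x0) (Suc j) (\<phi> i) x) (at x within ival T x0)) \<and>
     (\<forall>i\<in>{1..n}. eventually (\<lambda>x. \<phi> i x \<noteq> 0) (lfilt x0)) \<and>
     (\<forall>i\<in>{1..<n}. ((\<lambda>x. \<phi> (Suc i) x / \<phi> i x) \<longlongrightarrow> 0) (lfilt x0)) \<and>
     (\<forall>i\<in>{1..n}. \<forall>x\<in>ival T x0. Wi (ival T x0) \<phi> i x \<noteq> 0)"

end

theory Submission
  imports Defs "Jordan_Normal_Form.Determinant"
begin

text \<open>
  Put \<open>W\<^sub>k = W(\<phi>\<^sub>1, \<dots>, \<phi>\<^sub>k)\<close>. Then \<open>M\<^sub>k u = W(\<phi>\<^sub>1, \<dots>, \<phi>\<^sub>k, u) / W\<^sub>k\<^sub>+\<^sub>1\<close> for \<open>k < n\<close> and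
  \<open>(M\<^sub>n\<^sub>-\<^sub>1 u)' = L u / q\<^sub>n\<close> almost everywhere. Hence \<open>M\<^sub>k \<phi>\<^sub>k\<^sub>+\<^sub>1 = 1\<close> and \<open>M\<^sub>k \<phi>\<^sub>j = 0\<close> for \<open>j \<le> k\<close>.
  By Rolle's argument a nontrivial linear combination of the \<open>M\<^sub>k \<phi>\<^sub>j\<close> has constant sign near \<open>x\<^sub>0\<close>, so
  l'Hopital's rule can be inverted and the relations \<open>\<phi>\<^sub>j\<^sub>+\<^sub>1 = o(\<phi>\<^sub>j)\<close> pass from \<open>M\<^sub>k\<close> to \<open>M\<^sub>k\<^sub>+\<^sub>1\<close>;
  therefore \<open>M\<^sub>k \<phi>\<^sub>j \<rightarrow> 0\<close> for \<open>j > k + 1\<close>, and each \<open>1 / q\<^sub>k\<close> is integrable at \<open>x\<^sub>0\<close>. Integrating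
  \<open>L f / q\<^sub>n\<close> repeatedly from \<open>T\<close> gives \<open>M\<^sub>i\<^sub>-\<^sub>1 f\<close> up to a combination of \<open>M\<^sub>i\<^sub>-\<^sub>1 \<phi>\<^sub>i, \<dots>, M\<^sub>i\<^sub>-\<^sub>1 \<phi>\<^sub>n\<close>,
  which has a limit.
\<close>

section \<open>Absolutely continuous functions\<close>

text \<open>The obstacle is the top level. The derivative of order \<open>n - 1\<close> of
  \<open>f\<close> is merely absolutely continuous, so \<open>M_{n-1} f\<close> is differentiable
  only almost everywhere, and recovering it from \<open>L f / q_n\<close> takes the fundamental
  theorem for absolutely continuous functions. That theorem is derived from the epsilon-delta
  definition: the total variation splits such a function into monotone ones, whose Stieltjes
  measures have densities by Radon-Nikodym. Below the top, derivatives exist everywhere and the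
  asymptotic argument is abstract: it sees only positive weights and functions with
  \<open>G_k' = G_{k+1} / q_{k+1}\<close>. That (iii) implies (ii) is a domination:
  \<open>M_{k+1} \<phi>_{k+2} = 1\<close> means that \<open>1 / q_{k+1}\<close> is the derivative of
  \<open>M_k \<phi>_{k+2}\<close>, which tends to 0, so a bounded \<open>M_{k+1} f\<close> forces
  \<open>M_k f\<close> to converge. In the iterated integral, each integration from \<open>T\<close>
  subtracts a multiple of some \<open>\<phi>_l\<close>, namely its constant of integration, while
  each integration up to the endpoint changes the sign and subtracts the limit, which is again a
  multiple of one \<open>\<phi>_l\<close>. All partial results thus remain in the same class of
  functions.\<close>

definition nonoverlap :: "'i set \<Rightarrow> ('i \<Rightarrow> real) \<Rightarrow> ('i \<Rightarrow> real) \<Rightarrow> real \<Rightarrow> real \<Rightarrow> bool" where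
  "nonoverlap I l r a b \<longleftrightarrow> finite I \<and> (\<forall>k\<in>I. a \<le> l k \<and> l k \<le> r k \<and> r k \<le> b) \<and>
     (\<forall>k\<in>I. \<forall>j\<in>I. k \<noteq> j \<longrightarrow> r k \<le> l j \<or> r j \<le> l k)"

definition ac_modulus :: "real \<Rightarrow> real \<Rightarrow> (real \<Rightarrow> real) \<Rightarrow> real \<Rightarrow> real \<Rightarrow> bool" where
  "ac_modulus a b g \<epsilon> \<delta> \<longleftrightarrow> (\<forall>(m::nat) l r. nonoverlap {..<m} l r a b \<longrightarrow>
     (\<Sum>k<m. r k - l k) < \<delta> \<longrightarrow> (\<Sum>k<m. \<bar>g (r k) - g (l k)\<bar>) < \<epsilon>)"

lemma abs_cont_on_modulus:
  "abs_cont_on a b g \<longleftrightarrow> (\<forall>\<epsilon>>0. \<exists>\<delta>>0. ac_modulus a b g \<epsilon> \<delta>)"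
  unfolding abs_cont_on_def ac_modulus_def nonoverlap_def
  by (simp only: Ball_def lessThan_iff finite_lessThan simp_thms imp_conjL)

lemma abs_cont_onE:
  assumes "abs_cont_on a b g" "\<epsilon> > 0"
  obtains \<delta> where "\<delta> > 0" "ac_modulus a b g \<epsilon> \<delta>"
  using assms unfolding abs_cont_on_modulus by blast

lemma nonoverlap_reindex:
  assumes "bij_betw h J I" "nonoverlap I l r a b"
  shows "nonoverlap J (l \<circ> h) (r \<circ> h) a b"
proof -
  have h: "finite J" "\<And>k. k \<in> J \<Longrightarrow> h k \<in> I" "\<And>k j. k \<in> J \<Longrightarrow> j \<in> J \<Longrightarrow> k \<noteq> j \<Longrightarrow> h k \<noteq> h j"
    using assms bij_betw_finite[OF assms(1)] bij_betwE[OF assms(1)] bij_betw_imp_inj_on[OF assms(1)]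
    by (auto simp: nonoverlap_def inj_on_def)
  show ?thesis
    unfolding nonoverlap_def o_def using assms(2)[unfolded nonoverlap_def] h by simp
qed

text \<open>Reindexing frees the modulus from families numbered by naturals: below, intervals are
  also indexed by pairs and by the intervals themselves.\<close>

lemma ac_modulusD:
  assumes ac: "ac_modulus a b g \<epsilon> \<delta>" and no: "nonoverlap I l r a b" and sum: "(\<Sum>k\<in>I. r k - l k) < \<delta>"
  shows "(\<Sum>k\<in>I. \<bar>g (r k) - g (l k)\<bar>) < \<epsilon>"
proof -
  have "finite I" using no by (auto simp: nonoverlap_def)
  then obtain h where h: "bij_betw h {..<card I} I"
    using ex_bij_betw_nat_finite atLeast0LessThan by metis
  have "(\<Sum>k<card I. (r \<circ> h) k - (l \<circ> h) k) < \<delta>"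
    using sum sum.reindex_bij_betw[OF h, of "\<lambda>k. r k - l k"] by simp
  with ac nonoverlap_reindex[OF h no]
  have "(\<Sum>k<card I. \<bar>g ((r \<circ> h) k) - g ((l \<circ> h) k)\<bar>) < \<epsilon>"
    unfolding ac_modulus_def by blast
  then show ?thesis
    using sum.reindex_bij_betw[OF h, of "\<lambda>k. \<bar>g (r k) - g (l k)\<bar>"] by simp
qed

lemma abs_cont_on_pair:
  assumes "abs_cont_on a b g" "\<epsilon> > 0"
  obtains \<delta> where "\<delta> > 0" "\<And>x y. a \<le> x \<Longrightarrow> x \<le> y \<Longrightarrow> y \<le> b \<Longrightarrow> y - x < \<delta> \<Longrightarrow> \<bar>g y - g x\<bar> < \<epsilon>"
proof -
  obtain \<delta> where d: "\<delta> > 0" "ac_modulus a b g \<epsilon> \<delta>"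
    by (rule abs_cont_onE[OF assms]) (rule that)
  have "\<bar>g y - g x\<bar> < \<epsilon>" if "a \<le> x" "x \<le> y" "y \<le> b" "y - x < \<delta>" for x y
    using ac_modulusD[OF d(2), of "{()}" "\<lambda>_. x" "\<lambda>_. y"] that by (simp add: nonoverlap_def)
  with d show ?thesis using that by blast
qed

lemma abs_cont_on_continuous:
  assumes "abs_cont_on a b g"
  shows "continuous_on {a..b} g"
  unfolding continuous_on_iff
proof (intro ballI allI impI)
  fix x e :: real assume x: "x \<in> {a..b}" "0 < e"
  obtain \<delta> where d: "\<delta> > 0" "\<And>x y. a \<le> x \<Longrightarrow> x \<le> y \<Longrightarrow> y \<le> b \<Longrightarrow> y - x < \<delta> \<Longrightarrow> \<bar>g y - g x\<bar> < e"
    using abs_cont_on_pair[OF assms \<open>e > 0\<close>] by blast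
  have "dist (g y) (g x) < e" if "y \<in> {a..b}" "dist y x < \<delta>" for y
    using d(2)[of x y] d(2)[of y x] that x by (cases "x \<le> y") (auto simp: dist_real_def)
  then show "\<exists>d>0. \<forall>x'\<in>{a..b}. dist x' x < d \<longrightarrow> dist (g x') (g x) < e"
    using d(1) by blast
qed

text \<open>The closure properties reduce to this comparison of increments: half of
  \<open>\<epsilon>\<close> is reserved for each of \<open>g1\<close> and \<open>g2\<close>.\<close>

lemma abs_cont_on_dominated:
  assumes g1: "abs_cont_on a b g1" and g2: "abs_cont_on a b g2"
    and bd: "\<And>x y. a \<le> x \<Longrightarrow> x \<le> y \<Longrightarrow> y \<le> b \<Longrightarrow> \<bar>h y - h x\<bar> \<le> C * (\<bar>g1 y - g1 x\<bar> + \<bar>g2 y - g2 x\<bar>)"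
  shows "abs_cont_on a b h"
  unfolding abs_cont_on_modulus
proof (intro allI impI)
  fix \<epsilon> :: real assume e: "\<epsilon> > 0"
  \<comment> \<open>A positive majorant of \<open>C\<close>, so that
    \<open>\<epsilon> / (2 * K)\<close> is positive even for \<open>C \<le> 0\<close>.\<close>
  define K where "K = \<bar>C\<bar> + 1"
  have K: "K > 0" "C \<le> K" by (auto simp: K_def)
  have e': "\<epsilon> / (2 * K) > 0" using e K by simp
  obtain d1 where d1: "d1 > 0" "ac_modulus a b g1 (\<epsilon> / (2 * K)) d1"
    by (rule abs_cont_onE[OF g1 e']) (rule that)
  obtain d2 where d2: "d2 > 0" "ac_modulus a b g2 (\<epsilon> / (2 * K)) d2"
    by (rule abs_cont_onE[OF g2 e']) (rule that)
  have "ac_modulus a b h \<epsilon> (min d1 d2)"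
    unfolding ac_modulus_def
  proof (intro allI impI)
    fix m l r assume no: "nonoverlap {..<m::nat} l r a b" and s: "(\<Sum>k<m. r k - l k) < min d1 d2"
    have s1: "(\<Sum>k<m. \<bar>g1 (r k) - g1 (l k)\<bar>) < \<epsilon> / (2 * K)" using ac_modulusD[OF d1(2) no] s by simp
    have s2: "(\<Sum>k<m. \<bar>g2 (r k) - g2 (l k)\<bar>) < \<epsilon> / (2 * K)" using ac_modulusD[OF d2(2) no] s by simp
    have "(\<Sum>k<m. \<bar>h (r k) - h (l k)\<bar>) \<le> (\<Sum>k<m. K * (\<bar>g1 (r k) - g1 (l k)\<bar> + \<bar>g2 (r k) - g2 (l k)\<bar>))"
    proof (rule sum_mono)
      fix k assume "k \<in> {..<m}"
      then have "\<bar>h (r k) - h (l k)\<bar> \<le> C * (\<bar>g1 (r k) - g1 (l k)\<bar> + \<bar>g2 (r k) - g2 (l k)\<bar>)"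
        using bd no by (auto simp: nonoverlap_def)
      also have "\<dots> \<le> K * (\<bar>g1 (r k) - g1 (l k)\<bar> + \<bar>g2 (r k) - g2 (l k)\<bar>)"
        using K by (intro mult_right_mono) auto
      finally show "\<bar>h (r k) - h (l k)\<bar> \<le> K * (\<bar>g1 (r k) - g1 (l k)\<bar> + \<bar>g2 (r k) - g2 (l k)\<bar>)" .
    qed
    also have "\<dots> = K * ((\<Sum>k<m. \<bar>g1 (r k) - g1 (l k)\<bar>) + (\<Sum>k<m. \<bar>g2 (r k) - g2 (l k)\<bar>))"
      by (simp only: sum_distrib_left[symmetric] sum.distrib)
    also have "\<dots> < K * (\<epsilon> / (2 * K) + \<epsilon> / (2 * K))"
      using s1 s2 K by (intro mult_strict_left_mono) auto
    also have "\<dots> = \<epsilon>" using K by (simp add: field_simps)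
    finally show "(\<Sum>k<m. \<bar>h (r k) - h (l k)\<bar>) < \<epsilon>" .
  qed
  then show "\<exists>\<delta>>0. ac_modulus a b h \<epsilon> \<delta>" using d1 d2 by (intro exI[of _ "min d1 d2"]) auto
qed

lemma abs_cont_on_ident: "abs_cont_on a b (\<lambda>x. x)"
  unfolding abs_cont_on_modulus ac_modulus_def
proof (intro allI impI)
  fix \<epsilon> :: real assume e: "\<epsilon> > 0"
  have "(\<Sum>k<m. \<bar>r k - l k\<bar>) < \<epsilon>" if "nonoverlap {..<m} l r a b" "(\<Sum>k<m. r k - l k) < \<epsilon>" for m :: nat and l r
  proof -
    have "(\<Sum>k<m. \<bar>r k - l k\<bar>) = (\<Sum>k<m. r k - l k)"
      using that(1) by (intro sum.cong) (auto simp: nonoverlap_def)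
    with that show ?thesis by simp
  qed
  with e show "\<exists>\<delta>>0. \<forall>(m::nat) l r. nonoverlap {..<m} l r a b \<longrightarrow> (\<Sum>k<m. r k - l k) < \<delta> \<longrightarrow> (\<Sum>k<m. \<bar>r k - l k\<bar>) < \<epsilon>"
    by blast
qed

lemma abs_cont_on_const: "abs_cont_on a b (\<lambda>x. c)"
  by (rule abs_cont_on_dominated[OF abs_cont_on_ident abs_cont_on_ident, where C = 0]) auto

lemma abs_cont_on_add:
  assumes "abs_cont_on a b g1" "abs_cont_on a b g2"
  shows "abs_cont_on a b (\<lambda>x. g1 x + g2 x)"
proof (rule abs_cont_on_dominated[OF assms, where C = 1])
  fix x y
  show "\<bar>g1 y + g2 y - (g1 x + g2 x)\<bar> \<le> 1 * (\<bar>g1 y - g1 x\<bar> + \<bar>g2 y - g2 x\<bar>)"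
    using abs_triangle_ineq[of "g1 y - g1 x" "g2 y - g2 x"] by (simp add: algebra_simps)
qed

lemma abs_cont_on_diff:
  assumes "abs_cont_on a b g1" "abs_cont_on a b g2"
  shows "abs_cont_on a b (\<lambda>x. g1 x - g2 x)"
proof (rule abs_cont_on_dominated[OF assms, where C = 1])
  fix x y
  show "\<bar>g1 y - g2 y - (g1 x - g2 x)\<bar> \<le> 1 * (\<bar>g1 y - g1 x\<bar> + \<bar>g2 y - g2 x\<bar>)"
    using abs_triangle_ineq4[of "g1 y - g1 x" "g2 y - g2 x"] by (simp add: algebra_simps)
qed

lemma abs_cont_on_bounded:
  assumes "abs_cont_on a b g"
  obtains B where "B > 0" "\<And>x. x \<in> {a..b} \<Longrightarrow> \<bar>g x\<bar> \<le> B"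
proof -
  have "bounded (g ` {a..b})"
    by (intro compact_imp_bounded compact_continuous_image abs_cont_on_continuous assms) simp
  then show ?thesis using that bounded_pos by (metis imageI real_norm_def)
qed

lemma abs_cont_on_mult:
  assumes "abs_cont_on a b g1" "abs_cont_on a b g2"
  shows "abs_cont_on a b (\<lambda>x. g1 x * g2 x)"
proof -
  obtain B1 where B1: "B1 > 0" "\<And>x. x \<in> {a..b} \<Longrightarrow> \<bar>g1 x\<bar> \<le> B1" using abs_cont_on_bounded[OF assms(1)] by blast
  obtain B2 where B2: "B2 > 0" "\<And>x. x \<in> {a..b} \<Longrightarrow> \<bar>g2 x\<bar> \<le> B2" using abs_cont_on_bounded[OF assms(2)] by blast
  show ?thesis
  proof (rule abs_cont_on_dominated[OF assms, where C = "B1 + B2"])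
    fix x y assume xy: "a \<le> x" "x \<le> y" "y \<le> b"
    have "g1 y * g2 y - g1 x * g2 x = (g1 y - g1 x) * g2 y + g1 x * (g2 y - g2 x)"
      by (simp add: algebra_simps)
    also have "\<bar>\<dots>\<bar> \<le> \<bar>g1 y - g1 x\<bar> * \<bar>g2 y\<bar> + \<bar>g1 x\<bar> * \<bar>g2 y - g2 x\<bar>"
      by (metis abs_mult abs_triangle_ineq)
    also have "\<dots> \<le> \<bar>g1 y - g1 x\<bar> * (B1 + B2) + (B1 + B2) * \<bar>g2 y - g2 x\<bar>"
      using B1(2)[of x] B2(2)[of y] xy B1(1) B2(1) by (intro add_mono mult_mono) auto
    finally show "\<bar>g1 y * g2 y - g1 x * g2 x\<bar> \<le> (B1 + B2) * (\<bar>g1 y - g1 x\<bar> + \<bar>g2 y - g2 x\<bar>)"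
      by (simp add: algebra_simps)
  qed
qed

lemma abs_cont_on_inverse:
  assumes g: "abs_cont_on a b g" and pos: "\<And>x. x \<in> {a..b} \<Longrightarrow> g x > 0"
  shows "abs_cont_on a b (\<lambda>x. inverse (g x))"
proof -
  have "continuous_on {a..b} (\<lambda>x. inverse (g x))"
    by (intro continuous_on_inverse abs_cont_on_continuous[OF g] ballI) (use pos in force)
  then have "bounded ((\<lambda>x. inverse (g x)) ` {a..b})"
    by (intro compact_imp_bounded compact_continuous_image) auto
  then obtain B where B: "B > 0" "\<And>x. x \<in> {a..b} \<Longrightarrow> \<bar>inverse (g x)\<bar> \<le> B"
    using bounded_pos by (metis imageI real_norm_def)
  show ?thesis
  proof (rule abs_cont_on_dominated[OF g g, where C = "B * B"])
    fix x y assume xy: "a \<le> x" "x \<le> y" "y \<le> b"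
    then have p: "g x > 0" "g y > 0" using pos by auto
    then have "inverse (g y) - inverse (g x) = (inverse (g y) * inverse (g x)) * (g x - g y)"
      by (simp add: field_simps)
    then have "\<bar>inverse (g y) - inverse (g x)\<bar> = (\<bar>inverse (g y)\<bar> * \<bar>inverse (g x)\<bar>) * \<bar>g y - g x\<bar>"
      by (metis abs_minus_commute abs_mult)
    also have "\<dots> \<le> (B * B) * \<bar>g y - g x\<bar>"
      using B xy by (intro mult_right_mono mult_mono) auto
    also have "\<dots> \<le> B * B * (\<bar>g y - g x\<bar> + \<bar>g y - g x\<bar>)"
      using B by (intro mult_left_mono) auto
    finally show "\<bar>inverse (g y) - inverse (g x)\<bar> \<le> B * B * (\<bar>g y - g x\<bar> + \<bar>g y - g x\<bar>)" .
  qed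
qed

text \<open>The bound on \<open>g'\<close> makes \<open>g\<close> Lipschitz. This serves the
  derivatives below the top order, whose absolute continuity is not part of
  \<open>ACk\<close>.\<close>

lemma abs_cont_on_C1:
  assumes der: "\<And>x. x \<in> {a..b} \<Longrightarrow> (g has_real_derivative g' x) (at x within {a..b})"
    and cont: "continuous_on {a..b} g'"
  shows "abs_cont_on a b g"
proof -
  have "bounded (g' ` {a..b})"
    by (intro compact_imp_bounded compact_continuous_image cont) simp
  then obtain B where B: "B > 0" "\<And>x. x \<in> {a..b} \<Longrightarrow> \<bar>g' x\<bar> \<le> B"
    using bounded_pos by (metis imageI real_norm_def)
  show ?thesis
  proof (rule abs_cont_on_dominated[OF abs_cont_on_ident abs_cont_on_ident, where C = B])
    fix x y assume xy: "a \<le> x" "x \<le> y" "y \<le> b"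
    have "norm (g y - g x) \<le> B * norm (y - x)"
    proof (rule field_differentiable_bound[of "{a..b}"])
      show "\<And>z. z \<in> {a..b} \<Longrightarrow> (g has_real_derivative g' z) (at z within {a..b})" by (rule der)
    qed (use B xy in auto)
    also have "\<dots> \<le> B * (\<bar>y - x\<bar> + \<bar>y - x\<bar>)"
      using B by (intro mult_left_mono) auto
    finally show "\<bar>g y - g x\<bar> \<le> B * (\<bar>y - x\<bar> + \<bar>y - x\<bar>)" by simp
  qed
qed

section \<open>Total variation\<close>

definition variation_sums :: "(real \<Rightarrow> real) \<Rightarrow> real \<Rightarrow> real \<Rightarrow> real set" where
  "variation_sums g a b = {(\<Sum>k<m. \<bar>g (r k) - g (l k)\<bar>) | (m::nat) l r. nonoverlap {..<m} l r a b}"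

definition total_variation :: "(real \<Rightarrow> real) \<Rightarrow> real \<Rightarrow> real \<Rightarrow> real" where
  "total_variation g a b = Sup (variation_sums g a b)"

lemma variation_sums_nonempty: "variation_sums g a b \<noteq> {}"
  unfolding variation_sums_def nonoverlap_def by (auto intro!: exI[of _ "0::nat"])

lemma variation_sumsI:
  assumes "nonoverlap I l r a b"
  shows "(\<Sum>k\<in>I. \<bar>g (r k) - g (l k)\<bar>) \<in> variation_sums g a b"
proof -
  have "finite I" using assms by (auto simp: nonoverlap_def)
  then obtain h where h: "bij_betw h {..<card I} I"
    using ex_bij_betw_nat_finite atLeast0LessThan by metis
  have "(\<Sum>k\<in>I. \<bar>g (r k) - g (l k)\<bar>) = (\<Sum>k<card I. \<bar>g ((r \<circ> h) k) - g ((l \<circ> h) k)\<bar>)"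
    using sum.reindex_bij_betw[OF h, of "\<lambda>k. \<bar>g (r k) - g (l k)\<bar>"] by simp
  then show ?thesis
    using nonoverlap_reindex[OF h assms] unfolding variation_sums_def by blast
qed

lemma nonoverlap_mono_image:
  assumes "nonoverlap I l r a b" "mono h"
  shows "nonoverlap I (\<lambda>k. h (l k)) (\<lambda>k. h (r k)) (h a) (h b)"
  using assms(1) monoD[OF assms(2)] unfolding nonoverlap_def by meson

lemma nonoverlap_widen:
  assumes "nonoverlap I l r c d" "a \<le> c" "d \<le> b"
  shows "nonoverlap I l r a b"
  using assms unfolding nonoverlap_def by force

text \<open>Cutting at \<open>c\<close> is done by clamping with \<open>min c\<close> and
  \<open>max c\<close>: both maps are monotone, and an interval on one side of \<open>c\<close>
  becomes degenerate on the other, so the index set stays the same.\<close>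

lemma variation_sums_split:
  fixes g :: "real \<Rightarrow> real"
  assumes "nonoverlap I l r a b" "a \<le> c" "c \<le> b"
  shows "nonoverlap I (\<lambda>k. min c (l k)) (\<lambda>k. min c (r k)) a c"
    and "nonoverlap I (\<lambda>k. max c (l k)) (\<lambda>k. max c (r k)) c b"
    and "(\<Sum>k\<in>I. \<bar>g (r k) - g (l k)\<bar>) \<le> (\<Sum>k\<in>I. \<bar>g (min c (r k)) - g (min c (l k))\<bar>) +
           (\<Sum>k\<in>I. \<bar>g (max c (r k)) - g (max c (l k))\<bar>)"
proof -
  show "nonoverlap I (\<lambda>k. min c (l k)) (\<lambda>k. min c (r k)) a c"
    "nonoverlap I (\<lambda>k. max c (l k)) (\<lambda>k. max c (r k)) c b"
    using nonoverlap_mono_image[OF assms(1), of "min c"] nonoverlap_mono_image[OF assms(1), of "max c"] assms(2,3)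
    by (simp_all add: mono_def min_absorb2 max_absorb2 min_absorb1 max_absorb1 min.coboundedI2 max.coboundedI2)
  have "\<bar>g (r k) - g (l k)\<bar> \<le> \<bar>g (min c (r k)) - g (min c (l k))\<bar> + \<bar>g (max c (r k)) - g (max c (l k))\<bar>" for k
    by (cases "c \<le> r k"; cases "c \<le> l k") (auto simp: min_def max_def)
  then show "(\<Sum>k\<in>I. \<bar>g (r k) - g (l k)\<bar>) \<le> (\<Sum>k\<in>I. \<bar>g (min c (r k)) - g (min c (l k))\<bar>) +
           (\<Sum>k\<in>I. \<bar>g (max c (r k)) - g (max c (l k))\<bar>)"
    by (simp add: sum.distrib[symmetric] sum_mono)
qed

text \<open>Comparing Lebesgue measures avoids sorting the intervals; open intervals are taken
  because touching closed ones share endpoints.\<close>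

lemma nonoverlap_length:
  assumes no: "nonoverlap I l r a b" and "a \<le> b"
  shows "(\<Sum>k\<in>I. r k - l k) \<le> b - a"
proof -
  have fin: "finite I" using no by (auto simp: nonoverlap_def)
  have "(\<Sum>k\<in>I. r k - l k) = (\<Sum>k\<in>I. measure lborel {l k<..<r k})"
    using no by (intro sum.cong) (auto simp: nonoverlap_def)
  also have "\<dots> = measure lborel (\<Union>k\<in>I. {l k<..<r k})"
  proof (rule measure_finite_Union[symmetric])
    show "disjoint_family_on (\<lambda>k. {l k<..<r k}) I"
    proof (unfold disjoint_family_on_def, intro ballI impI)
      fix k j assume "k \<in> I" "j \<in> I" "k \<noteq> j"
      then have "r k \<le> l j \<or> r j \<le> l k" using no by (simp add: nonoverlap_def)
      then show "{l k<..<r k} \<inter> {l j<..<r j} = {}" by auto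
    qed
  qed (use fin no in \<open>auto simp: nonoverlap_def emeasure_lborel_Ioo\<close>)
  also have "\<dots> \<le> measure lborel {a..b}"
  proof (rule measure_mono_fmeasurable)
    show "(\<Union>k\<in>I. {l k<..<r k}) \<subseteq> {a..b}"
    proof (rule UN_least)
      fix k assume "k \<in> I"
      then have "a \<le> l k" "r k \<le> b" using no by (auto simp: nonoverlap_def)
      then show "{l k<..<r k} \<subseteq> {a..b}" by auto
    qed
    show "(\<Union>k\<in>I. {l k<..<r k}) \<in> sets lborel" using fin by (intro sets.finite_UN) auto
    show "{a..b} \<in> fmeasurable lborel" by (simp add: fmeasurable_def emeasure_lborel_Icc_eq)
  qed
  also have "\<dots> = b - a" using \<open>a \<le> b\<close> by simp
  finally show ?thesis .
qed

text \<open>Bisection: bounded variation passes from two adjacent intervals to their union, and an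
  interval shorter than the \<open>\<delta>\<close> belonging to \<open>\<epsilon> = 1\<close> has
  variation at most 1.\<close>

lemma abs_cont_on_bdd_variation:
  assumes g: "abs_cont_on a b g" and "a \<le> b"
  shows "bdd_above (variation_sums g a b)"
proof -
  have "a \<le> a \<longrightarrow> b \<le> b \<longrightarrow> bdd_above (variation_sums g a b)"
  proof (rule Bolzano[OF \<open>a \<le> b\<close>, where P = "\<lambda>x y. a \<le> x \<longrightarrow> y \<le> b \<longrightarrow> bdd_above (variation_sums g x y)"])
    fix x c y assume P: "a \<le> x \<longrightarrow> c \<le> b \<longrightarrow> bdd_above (variation_sums g x c)"
      "a \<le> c \<longrightarrow> y \<le> b \<longrightarrow> bdd_above (variation_sums g c y)" and xcy: "x \<le> c" "c \<le> y"
    show "a \<le> x \<longrightarrow> y \<le> b \<longrightarrow> bdd_above (variation_sums g x y)"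
    proof (intro impI)
      assume "a \<le> x" "y \<le> b"
      then obtain B1 B2 where B: "\<And>s. s \<in> variation_sums g x c \<Longrightarrow> s \<le> B1"
        "\<And>s. s \<in> variation_sums g c y \<Longrightarrow> s \<le> B2"
        using P xcy by (force simp: bdd_above_def)
      have "s \<le> B1 + B2" if s: "s \<in> variation_sums g x y" for s
      proof -
        obtain m l r where no: "nonoverlap {..<m::nat} l r x y" and s: "s = (\<Sum>k<m. \<bar>g (r k) - g (l k)\<bar>)"
          using s by (auto simp: variation_sums_def)
        note sp = variation_sums_split[OF no xcy]
        show ?thesis
          unfolding s using sp(3)[of g] B(1)[OF variation_sumsI[OF sp(1)]] B(2)[OF variation_sumsI[OF sp(2)]]
          by linarith
      qed
      then show "bdd_above (variation_sums g x y)" by (auto simp: bdd_above_def)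
    qed
  next
    fix x assume "a \<le> x" "x \<le> b"
    obtain \<delta> where d: "\<delta> > 0" "ac_modulus a b g 1 \<delta>"
      by (rule abs_cont_onE[OF g, of 1]) (simp, rule that)
    have "bdd_above (variation_sums g u v)" if uv: "a \<le> u" "v \<le> b" "u \<le> v" "v - u < \<delta>" for u v
    proof -
      have "s \<le> 1" if s: "s \<in> variation_sums g u v" for s
      proof -
        obtain m l r where no: "nonoverlap {..<m::nat} l r u v" and s: "s = (\<Sum>k<m. \<bar>g (r k) - g (l k)\<bar>)"
          using s by (auto simp: variation_sums_def)
        have no': "nonoverlap {..<m} l r a b"
          by (rule nonoverlap_widen[OF no uv(1,2)])
        have "(\<Sum>k<m. r k - l k) \<le> v - u"
          by (rule nonoverlap_length[OF no \<open>u \<le> v\<close>])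
        then show ?thesis using ac_modulusD[OF d(2) no'] uv s by simp
      qed
      then show ?thesis by (auto simp: bdd_above_def)
    qed
    then have "\<forall>u v. u \<le> x \<and> x \<le> v \<and> v - u < \<delta> \<longrightarrow> a \<le> u \<longrightarrow> v \<le> b \<longrightarrow> bdd_above (variation_sums g u v)"
      by (intro allI impI) auto
    with d(1) show "\<exists>d>0. \<forall>u v. u \<le> x \<and> x \<le> v \<and> v - u < d \<longrightarrow> a \<le> u \<longrightarrow> v \<le> b \<longrightarrow> bdd_above (variation_sums g u v)"
      by blast
  qed
  then show ?thesis by simp
qed

lemma abs_cont_on_subset:
  assumes "abs_cont_on a b g" "a \<le> c" "d \<le> b"
  shows "abs_cont_on c d g"
proof -
  have "ac_modulus c d g \<epsilon> \<delta>" if "ac_modulus a b g \<epsilon> \<delta>" for \<epsilon> \<delta>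
    unfolding ac_modulus_def
  proof (intro allI impI)
    fix m l r assume no: "nonoverlap {..<m::nat} l r c d" and "(\<Sum>k<m. r k - l k) < \<delta>"
    moreover have "nonoverlap {..<m} l r a b"
      by (rule nonoverlap_widen[OF no assms(2,3)])
    ultimately show "(\<Sum>k<m. \<bar>g (r k) - g (l k)\<bar>) < \<epsilon>" using ac_modulusD[OF that] by blast
  qed
  with assms(1) show ?thesis unfolding abs_cont_on_modulus by blast
qed

lemma total_variation_upper:
  assumes "abs_cont_on a b g" "a \<le> b" "s \<in> variation_sums g a b"
  shows "s \<le> total_variation g a b"
  unfolding total_variation_def using abs_cont_on_bdd_variation[OF assms(1,2)] assms(3) by (rule cSup_upper[rotated])

lemma total_variation_increment_ge:
  assumes g: "abs_cont_on a b g" and "a \<le> c" "c \<le> d" "d \<le> b"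
  shows "total_variation g a c + \<bar>g d - g c\<bar> \<le> total_variation g a d"
proof -
  have "s \<le> total_variation g a d - \<bar>g d - g c\<bar>" if sv: "s \<in> variation_sums g a c" for s
  proof -
    obtain m l r where no: "nonoverlap {..<m::nat} l r a c" and s: "s = (\<Sum>k<m. \<bar>g (r k) - g (l k)\<bar>)"
      using sv by (auto simp: variation_sums_def)
    have le: "a \<le> l k \<and> l k \<le> r k \<and> r k \<le> c" if "k < m" for k
      using no that by (auto simp: nonoverlap_def)
    have ov: "r k \<le> l j \<or> r j \<le> l k" if "k < m" "j < m" "k \<noteq> j" for k j
      using no that by (auto simp: nonoverlap_def)
    \<comment> \<open>The interval from \<open>c\<close> to \<open>d\<close> is appended to the
      family at index \<open>m\<close>.\<close>
    define l' r' where "l' = l(m := c)" and "r' = r(m := d)"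
    have "nonoverlap {..<Suc m} l' r' a d"
      unfolding nonoverlap_def
    proof (intro conjI ballI impI)
      fix k assume k: "k \<in> {..<Suc m}"
      show "a \<le> l' k" "l' k \<le> r' k" "r' k \<le> d"
        using k le[of k] assms by (auto simp: l'_def r'_def less_Suc_eq)
      fix j assume j: "j \<in> {..<Suc m}" "k \<noteq> j"
      show "r' k \<le> l' j \<or> r' j \<le> l' k"
        using k j le[of k] le[of j] ov[of k j] by (auto simp: l'_def r'_def less_Suc_eq)
    qed simp
    from variation_sumsI[OF this, of g]
    have "(\<Sum>k<Suc m. \<bar>g (r' k) - g (l' k)\<bar>) \<le> total_variation g a d"
      using total_variation_upper[OF abs_cont_on_subset[OF g order_refl \<open>d \<le> b\<close>]] assms by simp
    then show ?thesis by (simp add: s l'_def r'_def)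
  qed
  then have "Sup (variation_sums g a c) \<le> total_variation g a d - \<bar>g d - g c\<bar>"
    by (intro cSup_least variation_sums_nonempty)
  then show ?thesis by (simp add: total_variation_def)
qed

lemma total_variation_subadditive:
  assumes g: "abs_cont_on a b g" and "a \<le> c" "c \<le> d" "d \<le> b"
  shows "total_variation g a d \<le> total_variation g a c + total_variation g c d"
  unfolding total_variation_def[of g a d]
proof (rule cSup_least[OF variation_sums_nonempty])
  fix s assume "s \<in> variation_sums g a d"
  then obtain m l r where no: "nonoverlap {..<m::nat} l r a d" and s: "s = (\<Sum>k<m. \<bar>g (r k) - g (l k)\<bar>)"
    by (auto simp: variation_sums_def)
  note sp = variation_sums_split[OF no \<open>a \<le> c\<close> \<open>c \<le> d\<close>]
  have "abs_cont_on a c g" "abs_cont_on c d g"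
    using abs_cont_on_subset[OF g] assms by auto
  then show "s \<le> total_variation g a c + total_variation g c d"
    unfolding s using sp(3)[of g] total_variation_upper[OF _ _ variation_sumsI[OF sp(1)], of g]
      total_variation_upper[OF _ _ variation_sumsI[OF sp(2)], of g] assms by linarith
qed

lemma nonoverlap_Sigma:
  assumes no: "nonoverlap I l r a b" and inner: "\<And>k. k \<in> I \<Longrightarrow> nonoverlap (J k) (L k) (R k) (l k) (r k)"
  shows "nonoverlap (Sigma I J) (\<lambda>(k, j). L k j) (\<lambda>(k, j). R k j) a b"
proof -
  have o: "finite I" "\<And>k. k \<in> I \<Longrightarrow> a \<le> l k" "\<And>k. k \<in> I \<Longrightarrow> r k \<le> b"
    "\<And>k j. k \<in> I \<Longrightarrow> j \<in> I \<Longrightarrow> k \<noteq> j \<Longrightarrow> r k \<le> l j \<or> r j \<le> l k"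
    using no by (simp_all add: nonoverlap_def)
  have i: "finite (J k)" "\<And>j. j \<in> J k \<Longrightarrow> l k \<le> L k j \<and> L k j \<le> R k j \<and> R k j \<le> r k"
    "\<And>i j. i \<in> J k \<Longrightarrow> j \<in> J k \<Longrightarrow> i \<noteq> j \<Longrightarrow> R k i \<le> L k j \<or> R k j \<le> L k i" if "k \<in> I" for k
    using inner[OF that] by (simp_all add: nonoverlap_def)
  have bd: "a \<le> L k j \<and> L k j \<le> R k j \<and> R k j \<le> b" if "k \<in> I" "j \<in> J k" for k j
    using o(2,3)[of k] i(2)[of k j] that by auto
  have ov: "R k j \<le> L k' j' \<or> R k' j' \<le> L k j" if "k \<in> I" "j \<in> J k" "k' \<in> I" "j' \<in> J k'" "(k, j) \<noteq> (k', j')" for k j k' j'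
  proof (cases "k = k'")
    case True
    then show ?thesis using i(3)[of k j j'] that by auto
  next
    case False
    then show ?thesis using o(4)[of k k'] i(2)[of k j] i(2)[of k' j'] that by fastforce
  qed
  show ?thesis
    unfolding nonoverlap_def using o(1) i(1) bd ov by (auto intro!: finite_SigmaI)
qed

text \<open>Near-optimal families inside the given intervals merge into one family of no greater
  total length, to which the modulus of \<open>g\<close> applies. Subadditivity bounds each
  increment of the variation function by the variation over that interval.\<close>

lemma total_variation_abs_cont:
  assumes g: "abs_cont_on a b g"
  shows "abs_cont_on a b (total_variation g a)"
  unfolding abs_cont_on_modulus
proof (intro allI impI)
  fix \<epsilon> :: real assume e: "\<epsilon> > 0"
  obtain \<delta> where d: "\<delta> > 0" "ac_modulus a b g (\<epsilon> / 2) \<delta>"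
    by (rule abs_cont_onE[OF g half_gt_zero[OF e]]) (rule that)
  have "ac_modulus a b (total_variation g a) \<epsilon> \<delta>"
    unfolding ac_modulus_def
  proof (intro allI impI)
    fix m l r assume no: "nonoverlap {..<m::nat} l r a b" and len: "(\<Sum>k<m. r k - l k) < \<delta>"
    have k: "a \<le> l k" "l k \<le> r k" "r k \<le> b" if "k < m" for k
      using no that by (auto simp: nonoverlap_def)
    \<comment> \<open>Sized so that the \<open>m\<close> shortfalls add up to at most
      \<open>\<epsilon> / 2\<close>; \<open>m + 1\<close> covers the empty family.\<close>
    define \<eta> where "\<eta> = \<epsilon> / (2 * real (m + 1))"
    have eta: "\<eta> > 0" using e by (simp add: \<eta>_def)
    have "\<exists>M L R. nonoverlap {..<M::nat} L R (l k) (r k) \<and>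
        total_variation g (l k) (r k) - \<eta> < (\<Sum>j<M. \<bar>g (R j) - g (L j)\<bar>)" if "k < m" for k
    proof -
      have "total_variation g (l k) (r k) - \<eta> < Sup (variation_sums g (l k) (r k))"
        using eta by (simp add: total_variation_def)
      then obtain s where "s \<in> variation_sums g (l k) (r k)" "total_variation g (l k) (r k) - \<eta> < s"
        using less_cSupE[OF _ variation_sums_nonempty] by metis
      then show ?thesis by (auto simp: variation_sums_def)
    qed
    then obtain M :: "nat \<Rightarrow> nat" and L R where
      M: "\<And>k. k < m \<Longrightarrow> nonoverlap {..<M k} (L k) (R k) (l k) (r k)"
        "\<And>k. k < m \<Longrightarrow> total_variation g (l k) (r k) - \<eta> < (\<Sum>j<M k. \<bar>g (R k j) - g (L k j)\<bar>)"
      by metis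
    let ?I = "Sigma {..<m} (\<lambda>k. {..<M k})"
    have noI: "nonoverlap ?I (\<lambda>(k, j). L k j) (\<lambda>(k, j). R k j) a b"
      by (rule nonoverlap_Sigma[OF no]) (use M(1) in simp)
    have "(\<Sum>p\<in>?I. (\<lambda>(k, j). R k j) p - (\<lambda>(k, j). L k j) p) = (\<Sum>k<m. \<Sum>j<M k. R k j - L k j)"
      by (simp add: sum.Sigma split_def)
    also have "\<dots> \<le> (\<Sum>k<m. r k - l k)"
    proof (rule sum_mono)
      fix j assume "j \<in> {..<m}"
      then show "(\<Sum>i<M j. R j i - L j i) \<le> r j - l j"
        using nonoverlap_length[OF M(1)[of j]] k[of j] by auto
    qed
    finally have "(\<Sum>p\<in>?I. \<bar>g ((\<lambda>(k, j). R k j) p) - g ((\<lambda>(k, j). L k j) p)\<bar>) < \<epsilon> / 2"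
      using ac_modulusD[OF d(2) noI] len by simp
    then have small: "(\<Sum>k<m. \<Sum>j<M k. \<bar>g (R k j) - g (L k j)\<bar>) < \<epsilon> / 2"
      by (simp add: sum.Sigma split_def)
    have "(\<Sum>k<m. \<bar>total_variation g a (r k) - total_variation g a (l k)\<bar>) \<le> (\<Sum>k<m. (\<Sum>j<M k. \<bar>g (R k j) - g (L k j)\<bar>) + \<eta>)"
    proof (rule sum_mono)
      fix j assume "j \<in> {..<m}"
      then show "\<bar>total_variation g a (r j) - total_variation g a (l j)\<bar> \<le> (\<Sum>i<M j. \<bar>g (R j i) - g (L j i)\<bar>) + \<eta>"
        using M(2)[of j] k[of j] total_variation_increment_ge[OF g, of "l j" "r j"]
          total_variation_subadditive[OF g, of "l j" "r j"] by auto
    qed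
    also have "\<dots> < \<epsilon> / 2 + real m * \<eta>"
      using small by (simp add: sum.distrib)
    also have "\<dots> \<le> \<epsilon> / 2 + \<epsilon> / 2"
      using e by (simp add: \<eta>_def field_simps)
    finally show "(\<Sum>k<m. \<bar>total_variation g a (r k) - total_variation g a (l k)\<bar>) < \<epsilon>" by simp
  qed
  then show "\<exists>\<delta>>0. ac_modulus a b (total_variation g a) \<epsilon> \<delta>" using d by blast
qed

section \<open>Densities via Stieltjes measures\<close>

lemma continuous_on_clamp:
  fixes F :: "real \<Rightarrow> real"
  assumes "continuous_on {a..b} F" "a \<le> b"
  shows "continuous_on UNIV (\<lambda>x. F (max a (min b x)))"
proof -
  have "continuous_on UNIV (\<lambda>x. max a (min b x))" by (intro continuous_intros)
  then show ?thesis
    by (rule continuous_on_compose2[OF assms(1)]) (use assms(2) in auto)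
qed

text \<open>The clamped \<open>G\<close> is monotone and continuous on the whole line, so it has a
  Stieltjes measure, which charges only \<open>{a..b}\<close>. For a cover of the null set by
  nonoverlapping intervals of total length below \<open>\<delta>\<close>, absolute continuity bounds
  the measure of every finite subfamily by \<open>e\<close>, and continuity from below extends the
  bound to the whole cover.\<close>

lemma mono_abs_cont_null:
  fixes F :: "real \<Rightarrow> real" and a b :: real
  defines "G \<equiv> \<lambda>x. F (max a (min b x))"
  assumes F: "abs_cont_on a b F" and "a < b"
    and mono: "\<And>x y. a \<le> x \<Longrightarrow> x \<le> y \<Longrightarrow> y \<le> b \<Longrightarrow> F x \<le> F y"
    and N: "N \<in> null_sets lborel"
  shows "N \<in> null_sets (interval_measure G)"
proof -
  let ?\<mu> = "interval_measure G"
  have monoG: "G x \<le> G y" if "x \<le> y" for x y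
    unfolding G_def using that \<open>a < b\<close> by (intro mono) auto
  have contG: "continuous_on UNIV G"
    unfolding G_def using continuous_on_clamp[OF abs_cont_on_continuous[OF F]] \<open>a < b\<close> by simp
  have Icc: "emeasure ?\<mu> {x..y} = G y - G x" if "x \<le> y" for x y
    using emeasure_interval_measure_Icc[OF that monoG contG] .
  \<comment> \<open>\<open>G\<close> is constant to the left of \<open>a\<close> and to the right of
    \<open>b\<close>, so each of these intervals has measure zero; their unions exhaust the two
    half-lines.\<close>
  have left: "(\<Union>n::nat. {a - real n..a}) \<in> null_sets ?\<mu>"
    by (intro null_sets_UN null_setsI) (use Icc \<open>a < b\<close> in \<open>auto simp: G_def\<close>)
  have right: "(\<Union>n::nat. {b..b + real n}) \<in> null_sets ?\<mu>"
    by (intro null_sets_UN null_setsI) (use Icc \<open>a < b\<close> in \<open>auto simp: G_def\<close>)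
  have mid: "N \<inter> {a..b} \<in> null_sets ?\<mu>"
  proof (rule null_setsI)
    show sN: "N \<inter> {a..b} \<in> sets ?\<mu>" using N by auto
    have "emeasure ?\<mu> (N \<inter> {a..b}) \<le> ennreal e" if "e > 0" for e :: real
    proof -
      obtain \<delta> where d: "\<delta> > 0" "ac_modulus a b F e \<delta>"
        by (rule abs_cont_onE[OF F \<open>e > 0\<close>]) (rule that)
      have N0: "N \<inter> {a..b} \<in> null_sets lborel" using N by (simp add: null_set_Int2)
      then have N1: "N \<inter> {a..b} \<in> null_sets lebesgue" by (rule null_sets_completionI)
      then have N2: "N \<inter> {a..b} \<in> lmeasurable" "measure lebesgue (N \<inter> {a..b}) = 0"
        by (auto simp: fmeasurable_def null_sets_def measure_def)
      obtain \<D> where D: "countable \<D>"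
        "\<And>K. K \<in> \<D> \<Longrightarrow> K \<subseteq> cbox a b \<and> K \<noteq> {} \<and> (\<exists>c d. K = cbox c d)"
        "pairwise (\<lambda>A B. interior A \<inter> interior B = {}) \<D>"
        "\<And>K. \<lbrakk>K \<in> \<D>; box a b \<noteq> {}\<rbrakk> \<Longrightarrow> interior K \<noteq> {}"
        "N \<inter> {a..b} \<subseteq> \<Union>\<D>" "\<Union>\<D> \<in> lmeasurable"
        "measure lebesgue (\<Union>\<D>) \<le> measure lebesgue (N \<inter> {a..b}) + \<delta> / 2"
      proof (rule measurable_outer_intervals_bounded[OF N2(1) _ half_gt_zero[OF d(1)], of a b])
        show "N \<inter> {a..b} \<subseteq> cbox a b" by auto
      qed (rule that)
      define l r where "l = (\<lambda>K::real set. Inf K)" and "r = (\<lambda>K::real set. Sup K)"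
      have K: "K = {l K..r K}" "a \<le> l K" "l K \<le> r K" "r K \<le> b" if KD: "K \<in> \<D>" for K
      proof -
        obtain c d where "K = cbox c d" "K \<noteq> {}" "K \<subseteq> cbox a b" using D(2)[OF KD] by blast
        then have "K = {c..d}" "c \<le> d" "a \<le> c" "d \<le> b" by (auto simp: cbox_interval)
        then show "K = {l K..r K}" "a \<le> l K" "l K \<le> r K" "r K \<le> b" by (auto simp: l_def r_def)
      qed
      \<comment> \<open>Nondegeneracy is what lets disjoint interiors place one interval to the left
        of the other: a single point has empty interior and could lie inside another
        interval.\<close>
      have lr: "l K < r K" if "K \<in> \<D>" for K
      proof -
        have "interior {l K..r K} \<noteq> {}" using D(4)[OF that] K(1)[OF that] \<open>a < b\<close> by simp
        then show ?thesis by simp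
      qed
      have fin: "emeasure ?\<mu> (\<Union>P) \<le> ennreal e" if P: "finite P" "P \<subseteq> \<D>" for P
      proof -
        have no: "nonoverlap P l r a b"
          unfolding nonoverlap_def
        proof (intro conjI ballI impI)
          fix A assume A: "A \<in> P"
          show "a \<le> l A" "l A \<le> r A" "r A \<le> b" using A P K by auto
          fix B assume B: "B \<in> P" "A \<noteq> B"
          have "interior {l A..r A} \<inter> interior {l B..r B} = {}"
            using D(3) A B P K(1) unfolding pairwise_def by (metis subsetD)
          then have "min (r A) (r B) \<le> max (l A) (l B)" by simp
          moreover have "l A < r A" "l B < r B" using lr A B(1) P by auto
          ultimately show "r A \<le> l B \<or> r B \<le> l A" by linarith
        qed (use P in auto)
        have "(\<Sum>A\<in>P. r A - l A) = (\<Sum>A\<in>P. measure lebesgue A)"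
        proof (rule sum.cong)
          fix A assume "A \<in> P"
          then have "measure lebesgue {l A..r A} = r A - l A" "A = {l A..r A}" using K[of A] P by auto
          then show "r A - l A = measure lebesgue A" by simp
        qed simp
        also have "\<dots> = measure lebesgue (\<Union>P)"
        proof (rule measure_negligible_finite_Union[symmetric])
          show "finite P" by fact
          show "A \<in> lmeasurable" if "A \<in> P" for A
            using that P D(2) by (metis lmeasurable_cbox subsetD)
          show "pairwise (\<lambda>A B. negligible (A \<inter> B)) P"
            unfolding pairwise_def
          proof (intro ballI impI)
            fix A B assume AB: "A \<in> P" "B \<in> P" "A \<noteq> B"
            then have "r A \<le> l B \<or> r B \<le> l A" using no by (auto simp: nonoverlap_def)
            then have "{l A..r A} \<inter> {l B..r B} \<subseteq> {l A, l B}" by auto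
            moreover have "A = {l A..r A}" "B = {l B..r B}" using K(1) AB P by auto
            ultimately have "A \<inter> B \<subseteq> {l A, l B}" by simp
            then show "negligible (A \<inter> B)" by (meson finite.emptyI finite.insertI negligible_finite negligible_subset)
          qed
        qed
        also have "\<dots> \<le> measure lebesgue (\<Union>\<D>)"
        proof (rule measure_mono_fmeasurable)
          have "\<Union>P \<in> lmeasurable"
            using P D(2) by (intro fmeasurable.finite_Union) (metis lmeasurable_cbox subsetD subsetI)+
          then show "\<Union>P \<in> sets lebesgue" by blast
        qed (use P D(6) in auto)
        also have "\<dots> < \<delta>" using D(7) N2(2) d(1) by simp
        finally have small: "(\<Sum>A\<in>P. \<bar>F (r A) - F (l A)\<bar>) < e"
          using ac_modulusD[OF d(2) no] by blast
        have "emeasure ?\<mu> (\<Union>P) \<le> (\<Sum>A\<in>P. emeasure ?\<mu> A)"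
          using emeasure_subadditive_finite[OF \<open>finite P\<close>, of "\<lambda>A. A" ?\<mu>] K(1) P(2)
          by (metis image_ident image_subsetI sets_interval_measure borel_closed closed_atLeastAtMost subsetD)
        also have "\<dots> = (\<Sum>A\<in>P. ennreal \<bar>F (r A) - F (l A)\<bar>)"
        proof (rule sum.cong)
          fix A assume "A \<in> P"
          then have A: "A = {l A..r A}" "a \<le> l A" "l A \<le> r A" "r A \<le> b" using K[of A] P by auto
          have "emeasure ?\<mu> {l A..r A} = ennreal (F (r A) - F (l A))"
            using Icc[OF A(3)] A(2-4) by (simp add: G_def)
          moreover have "F (l A) \<le> F (r A)" using mono A(2-4) by blast
          ultimately show "emeasure ?\<mu> A = ennreal \<bar>F (r A) - F (l A)\<bar>" using A(1) by simp
        qed simp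
        also have "\<dots> = ennreal (\<Sum>A\<in>P. \<bar>F (r A) - F (l A)\<bar>)" by (simp add: sum_ennreal)
        also have "\<dots> \<le> ennreal e" using small by (intro ennreal_leI) simp
        finally show ?thesis .
      qed
      show ?thesis
      proof (cases "\<D> = {}")
        case True
        then show ?thesis using D(5) by (simp add: subset_empty)
      next
        case False
        \<comment> \<open>The enumeration may repeat members, which is harmless since only unions of
          finite images of it are measured.\<close>
        define E where "E = from_nat_into \<D>"
        have E: "range E = \<D>" unfolding E_def using False D(1) by (rule range_from_nat_into)
        have inc: "incseq (\<lambda>n. \<Union>(E ` {..n}))" by (rule incseq_SucI) (auto simp: atMost_Suc)
        have Es: "E n \<in> sets ?\<mu>" for n using K(1)[of "E n"] E by (metis borel_closed closed_atLeastAtMost rangeI sets_interval_measure)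
        have "emeasure ?\<mu> (\<Union>\<D>) = (SUP n. emeasure ?\<mu> (\<Union>(E ` {..n})))"
        proof (subst SUP_emeasure_incseq[OF _ inc])
          show "range (\<lambda>n. \<Union>(E ` {..n})) \<subseteq> sets ?\<mu>" using Es by (intro image_subsetI sets.finite_UN) auto
          have "\<Union>\<D> = (\<Union>n. \<Union>(E ` {..n}))" unfolding E[symmetric] by auto
          then show "emeasure ?\<mu> (\<Union>\<D>) = emeasure ?\<mu> (\<Union>n. \<Union>(E ` {..n}))" by simp
        qed
        also have "\<dots> \<le> ennreal e"
          using E by (intro SUP_least fin) auto
        finally have "emeasure ?\<mu> (\<Union>\<D>) \<le> ennreal e" .
        moreover have "emeasure ?\<mu> (N \<inter> {a..b}) \<le> emeasure ?\<mu> (\<Union>\<D>)"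
        proof (rule emeasure_mono[OF D(5)])
          have "\<Union>(range E) \<in> sets ?\<mu>" using Es by (intro sets.countable_UN) auto
          then show "\<Union>\<D> \<in> sets ?\<mu>" by (simp only: E)
        qed
        ultimately show ?thesis by simp
      qed
    qed
    then show "emeasure ?\<mu> (N \<inter> {a..b}) = 0"
      by (metis ennreal_le_epsilon add_0 le_zero_eq zero_le)
  qed
  have "N \<subseteq> N \<inter> {a..b} \<union> (\<Union>n::nat. {a - real n..a}) \<union> (\<Union>n::nat. {b..b + real n})"
  proof
    fix x assume "x \<in> N"
    show "x \<in> N \<inter> {a..b} \<union> (\<Union>n::nat. {a - real n..a}) \<union> (\<Union>n::nat. {b..b + real n})"
    proof (cases "x < a \<or> b < x")
      case True
      obtain n :: nat where "\<bar>x\<bar> + \<bar>a\<bar> + \<bar>b\<bar> \<le> real n" using real_arch_simple by blast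
      with True have "x \<in> {a - real n..a} \<or> x \<in> {b..b + real n}" by auto
      then show ?thesis by blast
    qed (use \<open>x \<in> N\<close> in auto)
  qed
  moreover have "N \<in> sets ?\<mu>" using N by auto
  ultimately show ?thesis
    using null_sets_subset mid left right by (metis null_sets.Un)
qed

text \<open>The density is the Radon-Nikodym derivative of the Stieltjes measure of \<open>F\<close>
  with respect to Lebesgue measure.\<close>

lemma mono_abs_cont_density:
  fixes F :: "real \<Rightarrow> real"
  assumes F: "abs_cont_on a b F" and "a < b"
    and mono: "\<And>x y. a \<le> x \<Longrightarrow> x \<le> y \<Longrightarrow> y \<le> b \<Longrightarrow> F x \<le> F y"
  obtains h where "\<And>x. x \<in> {a..b} \<Longrightarrow> (h has_integral F x - F a) {a..x}"
proof -
  define G where "G = (\<lambda>x. F (max a (min b x)))"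
  let ?\<mu> = "interval_measure G"
  have monoG: "G x \<le> G y" if "x \<le> y" for x y
    unfolding G_def using that \<open>a < b\<close> by (intro mono) auto
  have contG: "continuous_on UNIV G"
    unfolding G_def using continuous_on_clamp[OF abs_cont_on_continuous[OF F]] \<open>a < b\<close> by simp
  have Icc: "emeasure ?\<mu> {a..x} = ennreal (F x - F a)" if "x \<in> {a..b}" for x
    using emeasure_interval_measure_Icc[OF _ monoG contG, of a x] that by (simp add: G_def)
  have "absolutely_continuous lborel ?\<mu>"
    unfolding absolutely_continuous_def G_def using mono_abs_cont_null[OF F \<open>a < b\<close> mono] by blast
  then obtain f where f: "f \<in> borel_measurable lborel" "density lborel f = ?\<mu>"
    using sigma_finite_measure.Radon_Nikodym[OF sigma_finite_lborel] by (metis sets_interval_measure sets_lborel)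
  have fm: "f \<in> borel_measurable borel" using f(1) by simp
  have em: "(\<integral>\<^sup>+y. f y * indicator {a..x} y \<partial>lborel) = ennreal (F x - F a)" if "x \<in> {a..b}" for x
    using emeasure_density[OF f(1), of "{a..x}"] Icc[OF that] f(2) by simp
  have "(\<lambda>y. f y * indicator {a..b} y) \<in> borel_measurable lborel" using fm by measurable
  then have "AE y in lborel. f y * indicator {a..b} y \<noteq> \<infinity>"
    by (rule nn_integral_PInf_AE) (use em[of b] \<open>a < b\<close> in simp)
  then have fin: "AE y in lborel. y \<in> {a..b} \<longrightarrow> f y \<noteq> \<infinity>" by eventually_elim auto
  have "((\<lambda>y. enn2real (f y)) has_integral F x - F a) {a..x}" if x: "x \<in> {a..b}" for x
  proof -
    let ?h = "\<lambda>y. enn2real (f y) * indicator {a..x} y"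
    have "(\<integral>\<^sup>+y. ennreal (?h y) \<partial>lborel) = (\<integral>\<^sup>+y. f y * indicator {a..x} y \<partial>lborel)"
    proof (rule nn_integral_cong_AE)
      show "AE y in lborel. ennreal (?h y) = f y * indicator {a..x} y"
        using fin
      proof eventually_elim
        case (elim y)
        then show ?case using x by (cases "y \<in> {a..x}") (auto simp: less_top)
      qed
    qed
    then have "(\<integral>\<^sup>+y. ennreal (?h y) \<partial>lborel) = ennreal (F x - F a)" using em[OF x] by simp
    moreover have "?h \<in> borel_measurable borel" using fm by measurable
    moreover have "0 \<le> F x - F a" using mono[of a x] x by simp
    ultimately have "(?h has_integral F x - F a) UNIV"
      by (intro nn_integral_has_integral) auto
    moreover have "?h = (\<lambda>y. if y \<in> {a..x} then enn2real (f y) else 0)" by (auto simp: fun_eq_iff)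
    ultimately show ?thesis by (simp only: has_integral_restrict_UNIV)
  qed
  then show ?thesis using that by blast
qed

text \<open>With \<open>V\<close> the variation from \<open>a\<close>, both \<open>V + g\<close> and
  \<open>V - g\<close> are increasing, and \<open>g\<close> is half their difference.\<close>

lemma abs_cont_density:
  fixes g :: "real \<Rightarrow> real"
  assumes g: "abs_cont_on a b g" and "a < b"
  obtains h where "\<And>x. x \<in> {a..b} \<Longrightarrow> (h has_integral g x - g a) {a..x}"
proof -
  let ?V = "total_variation g a"
  note V = total_variation_abs_cont[OF g]
  have inc: "\<bar>g y - g x\<bar> \<le> ?V y - ?V x" if "a \<le> x" "x \<le> y" "y \<le> b" for x y
    using total_variation_increment_ge[OF g that] by simp
  have m1: "?V x + g x \<le> ?V y + g y" and m2: "?V x - g x \<le> ?V y - g y" if "a \<le> x" "x \<le> y" "y \<le> b" for x y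
    using inc[OF that] by linarith+
  obtain h1 where h1: "\<And>x. x \<in> {a..b} \<Longrightarrow> (h1 has_integral (?V x + g x) - (?V a + g a)) {a..x}"
    using mono_abs_cont_density[OF abs_cont_on_add[OF V g] \<open>a < b\<close> m1] by blast
  obtain h2 where h2: "\<And>x. x \<in> {a..b} \<Longrightarrow> (h2 has_integral (?V x - g x) - (?V a - g a)) {a..x}"
    using mono_abs_cont_density[OF abs_cont_on_diff[OF V g] \<open>a < b\<close> m2] by blast
  have "((\<lambda>y. (h1 y - h2 y) * (1/2)) has_integral g x - g a) {a..x}" if "x \<in> {a..b}" for x
  proof -
    have eq: "((?V x + g x - (?V a + g a)) - (?V x - g x - (?V a - g a))) * (1/2) = g x - g a"
      by (simp add: field_simps)
    show ?thesis
      using has_integral_mult_left[OF has_integral_diff[OF h1[OF that] h2[OF that]], of "1/2"] unfolding eq .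
  qed
  then show ?thesis using that by blast
qed

section \<open>Almost everywhere differentiability of indefinite integrals\<close>

lemma ae_right_derivative:
  fixes h :: "real \<Rightarrow> real"
  assumes "\<And>a b. h integrable_on {a..b}"
  obtains N where "negligible N"
    "\<And>x e. x \<notin> N \<Longrightarrow> 0 < e \<Longrightarrow> \<exists>d>0. \<forall>t. 0 < t \<and> t < d \<longrightarrow> \<bar>integral {x..x + t} h - h x * t\<bar> < e * t"
proof -
  have "\<And>a b. h integrable_on cbox a b" using assms by simp
  then obtain N where N: "negligible N" "\<And>x e. \<lbrakk>x \<notin> N; 0 < e\<rbrakk> \<Longrightarrow> \<exists>d>0. \<forall>t. 0 < t \<and> t < d \<longrightarrow>
      norm (integral (cbox x (x + t *\<^sub>R One)) h /\<^sub>R t ^ DIM(real) - h x) < e"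
  proof (rule integrable_ccontinuous_explicit)
  qed (rule that)
  have "\<exists>d>0. \<forall>t. 0 < t \<and> t < d \<longrightarrow> \<bar>integral {x..x + t} h - h x * t\<bar> < e * t" if xe: "x \<notin> N" "0 < e" for x e
  proof -
    obtain d where d: "d > 0" "\<And>t. 0 < t \<Longrightarrow> t < d \<Longrightarrow> \<bar>integral {x..x + t} h / t - h x\<bar> < e"
      using N(2)[OF xe] by (auto simp: divide_inverse_commute)
    have "\<bar>integral {x..x + t} h - h x * t\<bar> < e * t" if "0 < t" "t < d" for t
    proof -
      have "\<bar>integral {x..x + t} h - h x * t\<bar> = \<bar>(integral {x..x + t} h / t - h x) * t\<bar>"
        using that by (simp add: left_diff_distrib)
      also have "\<dots> = \<bar>integral {x..x + t} h / t - h x\<bar> * t" using that by (simp add: abs_mult)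
      also have "\<dots> < e * t" using d(2)[OF that] that by (intro mult_strict_right_mono)
      finally show ?thesis .
    qed
    with d(1) show ?thesis by blast
  qed
  with N(1) show ?thesis using that by blast
qed

text \<open>The left-hand estimate comes from the right-hand one for the reflected function
  \<open>h (- x)\<close>, whose exceptional set is reflected back.\<close>

lemma ae_two_sided_derivative:
  fixes h :: "real \<Rightarrow> real"
  assumes int: "\<And>a b. h integrable_on {a..b}"
  obtains N where "negligible N"
    "\<And>x e. x \<notin> N \<Longrightarrow> 0 < e \<Longrightarrow> \<exists>d>0. \<forall>t. 0 < t \<and> t < d \<longrightarrow>
       \<bar>integral {x..x + t} h - h x * t\<bar> < e * t \<and> \<bar>integral {x - t..x} h - h x * t\<bar> < e * t"
proof -
  obtain N1 where N1: "negligible N1"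
    "\<And>x e. x \<notin> N1 \<Longrightarrow> 0 < e \<Longrightarrow> \<exists>d>0. \<forall>t. 0 < t \<and> t < d \<longrightarrow> \<bar>integral {x..x + t} h - h x * t\<bar> < e * t"
    using ae_right_derivative[OF int] by blast
  have int': "(\<lambda>x. h (- x)) integrable_on {a..b}" for a b
    using int[of "-b" "-a"] has_integral_reflect_real[where f = h and a = "-b" and b = "-a"]
    by (auto simp: integrable_on_def)
  obtain N2 where N2: "negligible N2"
    "\<And>x e. x \<notin> N2 \<Longrightarrow> 0 < e \<Longrightarrow> \<exists>d>0. \<forall>t. 0 < t \<and> t < d \<longrightarrow> \<bar>integral {x..x + t} (\<lambda>x. h (- x)) - h (- x) * t\<bar> < e * t"
    using ae_right_derivative[OF int'] by blast
  have refl: "integral {- x..- x + t} (\<lambda>x. h (- x)) = integral {x - t..x} h" for x t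
    using Henstock_Kurzweil_Integration.integral_reflect_real[where f = h and a = "x - t" and b = x] by (simp add: add.commute)
  have "negligible (uminus ` N2)"
    by (rule negligible_differentiable_image_negligible[OF order_refl N2(1)])
      (intro differentiable_on_minus differentiable_on_ident)
  then have "negligible (N1 \<union> uminus ` N2)" using N1(1) by (rule negligible_Un[rotated])
  moreover have "\<exists>d>0. \<forall>t. 0 < t \<and> t < d \<longrightarrow>
       \<bar>integral {x..x + t} h - h x * t\<bar> < e * t \<and> \<bar>integral {x - t..x} h - h x * t\<bar> < e * t"
    if x: "x \<notin> N1 \<union> uminus ` N2" "0 < e" for x e
  proof -
    have x2: "- x \<notin> N2" using x by force
    obtain d1 where d1: "d1 > 0" "\<And>t. 0 < t \<Longrightarrow> t < d1 \<Longrightarrow> \<bar>integral {x..x + t} h - h x * t\<bar> < e * t"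
      using N1(2)[of x e] x by blast
    obtain d2 where d2: "d2 > 0" "\<And>t. 0 < t \<Longrightarrow> t < d2 \<Longrightarrow> \<bar>integral {x - t..x} h - h x * t\<bar> < e * t"
      using N2(2)[OF x2 \<open>0 < e\<close>] refl by auto
    show ?thesis using d1 d2 by (intro exI[of _ "min d1 d2"]) auto
  qed
  ultimately show ?thesis using that by blast
qed

lemma ae_derivative_indefinite_integral:
  fixes h F :: "real \<Rightarrow> real"
  assumes hF: "\<And>x. x \<in> {a..b} \<Longrightarrow> (h has_integral F x - F a) {a..x}"
  obtains N where "negligible N" "\<And>x. x \<in> {a<..<b} - N \<Longrightarrow> (F has_real_derivative h x) (at x)"
proof -
  \<comment> \<open>Extension by zero, since the differentiation lemma asks for integrability on
    every interval.\<close>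
  define H where "H = (\<lambda>x. if x \<in> {a..b} then h x else 0)"
  have "H integrable_on {u..v}" for u v
  proof -
    have "h integrable_on {a..b}"
      using hF[of b] by (cases "a \<le> b") (auto simp: integrable_on_def)
    then have "H integrable_on UNIV" unfolding H_def by (simp only: integrable_restrict_UNIV)
    then show ?thesis by (rule integrable_on_subinterval) simp
  qed
  then obtain N where N: "negligible N"
    "\<And>x e. x \<notin> N \<Longrightarrow> 0 < e \<Longrightarrow> \<exists>d>0. \<forall>t. 0 < t \<and> t < d \<longrightarrow>
       \<bar>integral {x..x + t} H - H x * t\<bar> < e * t \<and> \<bar>integral {x - t..x} H - H x * t\<bar> < e * t"
    using ae_two_sided_derivative by blast
  have FH: "integral {x..y} H = F y - F x" if "a \<le> x" "x \<le> y" "y \<le> b" for x y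
  proof -
    have "integral {a..x} h + integral {x..y} h = integral {a..y} h"
      using hF[of y] that by (intro Henstock_Kurzweil_Integration.integral_combine) (auto simp: integrable_on_def)
    moreover have "integral {a..x} h = F x - F a" "integral {a..y} h = F y - F a"
      using hF[of x] hF[of y] that by (auto intro: integral_unique)
    moreover have "integral {x..y} H = integral {x..y} h"
      using that by (intro integral_cong) (auto simp: H_def)
    ultimately show ?thesis by linarith
  qed
  have "(F has_real_derivative h x) (at x)" if x: "x \<in> {a<..<b} - N" for x
    unfolding has_field_derivative_iff LIM_def
  proof (intro allI impI)
    fix e :: real assume "0 < e"
    obtain d where d: "d > 0" "\<And>t. 0 < t \<Longrightarrow> t < d \<Longrightarrow>
        \<bar>integral {x..x + t} H - H x * t\<bar> < e * t \<and> \<bar>integral {x - t..x} H - H x * t\<bar> < e * t"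
      using N(2)[of x e] x \<open>0 < e\<close> by blast
    have "dist ((F y - F x) / (y - x)) (h x) < e" if y: "y \<noteq> x" "dist y x < min d (min (x - a) (b - x))" for y
    proof -
      have "\<bar>F y - F x - h x * (y - x)\<bar> < e * \<bar>y - x\<bar>"
      proof (cases "x < y")
        case True
        then show ?thesis using d(2)[of "y - x"] FH[of x y] x y by (auto simp: H_def dist_real_def)
      next
        case False
        then have "\<bar>integral {y..x} H - H x * (x - y)\<bar> < e * (x - y)"
          using d(2)[of "x - y"] y by (auto simp: dist_real_def)
        moreover have "integral {y..x} H = F x - F y" using FH[of y x] x y False by (auto simp: dist_real_def)
        moreover have "\<bar>F x - F y - h x * (x - y)\<bar> = \<bar>F y - F x - h x * (y - x)\<bar>"
          by (subst abs_minus_cancel[symmetric]) (simp add: algebra_simps)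
        ultimately show ?thesis using False x by (simp add: H_def)
      qed
      then have "\<bar>F y - F x - h x * (y - x)\<bar> / \<bar>y - x\<bar> < e"
        using y by (simp add: divide_less_eq)
      moreover have "(F y - F x) / (y - x) - h x = (F y - F x - h x * (y - x)) / (y - x)"
        using y by (simp add: field_simps)
      ultimately show ?thesis by (simp add: dist_real_def abs_divide)
    qed
    then show "\<exists>s>0. \<forall>y. y \<noteq> x \<and> dist y x < s \<longrightarrow> dist ((F y - F x) / (y - x)) (h x) < e"
      using d(1) x by (intro exI[of _ "min d (min (x - a) (b - x))"]) auto
  qed
  with N(1) show ?thesis using that by blast
qed

lemma abs_cont_on_ae_differentiable:
  assumes "abs_cont_on a b g"
  obtains N where "negligible N" "\<And>x. x \<in> {a<..<b} - N \<Longrightarrow> \<exists>D. (g has_real_derivative D) (at x)"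
proof (cases "a < b")
  case True
  then show ?thesis
    using abs_cont_density[OF assms] ae_derivative_indefinite_integral that by metis
next
  case False
  then show ?thesis using that[of "{}"] by auto
qed

text \<open>Almost everywhere \<open>g'\<close> agrees with the density of \<open>g\<close>, since
  both are derivatives of \<open>g\<close> there. Absolute continuity is essential: the Cantor
  function has derivative 0 almost everywhere without being constant.\<close>

lemma abs_cont_on_has_integral_derivative:
  assumes g: "abs_cont_on a b g" and "a \<le> b" and N: "negligible N"
    and der: "\<And>x. x \<in> {a<..<b} - N \<Longrightarrow> (g has_real_derivative g' x) (at x)"
  shows "(g' has_integral g b - g a) {a..b}"
proof (cases "a = b")
  case False
  then have "a < b" using \<open>a \<le> b\<close> by simp
  obtain h where h: "\<And>x. x \<in> {a..b} \<Longrightarrow> (h has_integral g x - g a) {a..x}"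
    using abs_cont_density[OF g \<open>a < b\<close>] by blast
  obtain M where M: "negligible M" "\<And>x. x \<in> {a<..<b} - M \<Longrightarrow> (g has_real_derivative h x) (at x)"
    using ae_derivative_indefinite_integral[OF h] by blast
  show ?thesis
  proof (rule has_integral_spike)
    show "negligible (N \<union> M \<union> {a, b})" using N M(1) by simp
    show "g' x = h x" if "x \<in> {a..b} - (N \<union> M \<union> {a, b})" for x
      using that by (intro DERIV_unique[OF der M(2)]) auto
    show "(h has_integral g b - g a) {a..b}" using h[of b] \<open>a \<le> b\<close> by simp
  qed
qed (simp add: has_integral_refl)

section \<open>Wronskians\<close>

text \<open>Functions index the rows and orders of differentiation the columns, so the two Leibniz
  sums agree term by term and Laplace expansion becomes available.\<close>

lemma wronsk_det:
  "wronsk S gs x = det (mat (length gs) (length gs) (\<lambda>(j, r). hder S r (gs ! j) x))"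
proof -
  let ?A = "mat (length gs) (length gs) (\<lambda>(j, r). hder S r (gs ! j) x)"
  have "(\<Prod>j = 0..<length gs. ?A $$ (j, p j)) = (\<Prod>j<length gs. hder S (p j) (gs ! j) x)"
    if "p permutes {0..<length gs}" for p
  proof (rule prod.cong)
    fix j assume "j \<in> {..<length gs}"
    moreover from this have "p j \<in> {0..<length gs}" using permutes_in_image[OF that, of j] by auto
    ultimately show "?A $$ (j, p j) = hder S (p j) (gs ! j) x" by simp
  qed auto
  then show ?thesis
    unfolding wronsk_def det_def by (simp add: atLeast0LessThan)
qed

text \<open>A determinant is a polynomial in its entries. The property \<open>P\<close> will be
  differentiability at a point and absolute continuity on a compact interval.\<close>

lemma det_closed:
  fixes P :: "('b \<Rightarrow> real) \<Rightarrow> bool"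
  assumes const: "\<And>c. P (\<lambda>_. c)" and add: "\<And>f g. P f \<Longrightarrow> P g \<Longrightarrow> P (\<lambda>y. f y + g y)"
    and mult: "\<And>f g. P f \<Longrightarrow> P g \<Longrightarrow> P (\<lambda>y. f y * g y)"
    and entries: "\<And>i j. i < m \<Longrightarrow> j < m \<Longrightarrow> P (a i j)"
  shows "P (\<lambda>y. det (mat m m (\<lambda>(i, j). a i j y)))"
proof -
  have sum: "P (\<lambda>y. \<Sum>i\<in>I. f i y)" if "finite I" "\<And>i. i \<in> I \<Longrightarrow> P (f i)" for I :: "'c set" and f
    using that by (induction I rule: finite_induct) (auto intro: const add)
  have prod: "P (\<lambda>y. \<Prod>i\<in>I. f i y)" if "finite I" "\<And>i. i \<in> I \<Longrightarrow> P (f i)" for I :: "nat set" and f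
    using that by (induction I rule: finite_induct) (auto intro: const mult)
  have "P (\<lambda>y. \<Sum>p\<in>{p. p permutes {0..<m}}. signof p * (\<Prod>i = 0..<m. a i (p i) y))"
  proof (rule sum)
    fix p assume "p \<in> {p. p permutes {0..<m}}"
    then have "p i < m" if "i < m" for i using that permutes_in_image[of p "{0..<m}" i] by auto
    then show "P (\<lambda>y. signof p * (\<Prod>i = 0..<m. a i (p i) y))"
      by (intro mult const prod entries) auto
  qed (simp add: finite_permutations)
  moreover have "det (mat m m (\<lambda>(i, j). a i j y)) = (\<Sum>p\<in>{p. p permutes {0..<m}}. signof p * (\<Prod>i = 0..<m. a i (p i) y))" for y
    unfolding det_def by (auto intro!: sum.cong prod.cong arg_cong2[where f = times] simp: permutes_in_image)
  ultimately show ?thesis by simp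
qed

text \<open>The cofactor of column \<open>r\<close> in the last row of a matrix of size
  \<open>k + 1\<close>; deleting that column shifts the later ones, hence \<open>Suc s\<close>. It
  involves only the rows \<open>v\<close> above, which exhibits a Wronskian as linear in the jet of
  its last function.\<close>

definition last_row_cofactor :: "(nat \<Rightarrow> nat \<Rightarrow> real) \<Rightarrow> nat \<Rightarrow> nat \<Rightarrow> real" where
  "last_row_cofactor v k r = (-1) ^ (k + r) * det (mat k k (\<lambda>(j, s). v j (if s < r then s else Suc s)))"

lemma last_row_cofactor_last: "last_row_cofactor v k k = det (mat k k (\<lambda>(j, s). v j s))"
proof -
  have "mat k k (\<lambda>(j, s). v j (if s < k then s else Suc s)) = mat k k (\<lambda>(j, s). v j s)"
    by (rule eq_matI) auto
  then show ?thesis by (simp add: last_row_cofactor_def)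
qed

lemma det_last_row_expansion:
  "det (mat (Suc k) (Suc k) (\<lambda>(j, r). if j < k then v j r else w r)) = (\<Sum>r\<le>k. w r * last_row_cofactor v k r)"
proof -
  let ?A = "mat (Suc k) (Suc k) (\<lambda>(j, r). if j < k then v j r else w r)"
  have "det ?A = (\<Sum>r<Suc k. ?A $$ (k, r) * cofactor ?A k r)"
    by (rule laplace_expansion_row) auto
  also have "\<dots> = (\<Sum>r\<le>k. w r * last_row_cofactor v k r)"
  proof (rule sum.cong)
    fix r assume "r \<in> {..k}"
    moreover have "mat_delete ?A k r = mat k k (\<lambda>(j, s). v j (if s < r then s else Suc s))"
      unfolding mat_delete_def by (rule eq_matI) auto
    ultimately show "?A $$ (k, r) * cofactor ?A k r = w r * last_row_cofactor v k r"
      by (simp add: cofactor_def last_row_cofactor_def)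
  qed auto
  finally show ?thesis .
qed

lemma det_nonzero_kernel:
  fixes v :: "nat \<Rightarrow> nat \<Rightarrow> real"
  assumes det: "det (mat m m (\<lambda>(j, r). v j r)) \<noteq> 0" and z: "\<And>j. j < m \<Longrightarrow> (\<Sum>r<m. v j r * c r) = 0"
    and "r < m"
  shows "c r = 0"
proof (rule ccontr)
  assume "c r \<noteq> 0"
  let ?A = "mat m m (\<lambda>(j, r). v j r)"
  have "vec m c \<noteq> 0\<^sub>v m" using \<open>c r \<noteq> 0\<close> \<open>r < m\<close> by (metis index_vec index_zero_vec(1))
  moreover have "?A *\<^sub>v vec m c = 0\<^sub>v m"
    by (rule eq_vecI) (use z in \<open>auto simp: scalar_prod_def atLeast0LessThan\<close>)
  ultimately have "det ?A = 0"
    by (subst det_0_iff_vec_prod_zero[of _ m]) (auto intro: exI[of _ "vec m c"])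
  with det show False by simp
qed

lemma Wi_det: "Wi S \<phi> k x = det (mat k k (\<lambda>(j, r). hder S r (\<phi> (Suc j)) x))"
proof -
  have "mat k k (\<lambda>(j, r). hder S r (map \<phi> [1..<Suc k] ! j) x) = mat k k (\<lambda>(j, r). hder S r (\<phi> (Suc j)) x)"
    by (rule eq_matI) (auto simp del: upt_Suc)
  then show ?thesis by (simp add: Wi_def wronsk_det del: upt_Suc)
qed

lemma wronsk_snoc:
  "wronsk S (map \<phi> [1..<Suc k] @ [u]) x =
     (\<Sum>r\<le>k. hder S r u x * last_row_cofactor (\<lambda>j s. hder S s (\<phi> (Suc j)) x) k r)"
proof -
  have "mat (Suc k) (Suc k) (\<lambda>(j, r). hder S r ((map \<phi> [1..<Suc k] @ [u]) ! j) x) =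
      mat (Suc k) (Suc k) (\<lambda>(j, r). if j < k then hder S r (\<phi> (Suc j)) x else hder S r u x)"
    by (rule eq_matI) (auto simp: nth_append simp del: upt_Suc)
  then show ?thesis by (simp add: wronsk_det det_last_row_expansion[symmetric] del: upt_Suc)
qed

lemma wronsk_snoc_repeated:
  assumes "1 \<le> i" "i \<le> k"
  shows "wronsk S (map \<phi> [1..<Suc k] @ [\<phi> i]) x = 0"
  unfolding wronsk_det
proof (rule det_identical_rows[where i = "i - 1" and j = k and n = "Suc k"])
  show "row (mat (length (map \<phi> [1..<Suc k] @ [\<phi> i])) (length (map \<phi> [1..<Suc k] @ [\<phi> i]))
      (\<lambda>(j, r). hder S r ((map \<phi> [1..<Suc k] @ [\<phi> i]) ! j) x)) (i - 1) =
    row (mat (length (map \<phi> [1..<Suc k] @ [\<phi> i])) (length (map \<phi> [1..<Suc k] @ [\<phi> i]))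
      (\<lambda>(j, r). hder S r ((map \<phi> [1..<Suc k] @ [\<phi> i]) ! j) x)) k"
    using assms by (intro eq_vecI) (auto simp: nth_append simp del: upt_Suc)
qed (use assms in \<open>auto simp del: upt_Suc\<close>)

lemma wronsk_snoc_next: "wronsk S (map \<phi> [1..<Suc k] @ [\<phi> (Suc k)]) x = Wi S \<phi> (Suc k) x"
  by (simp add: Wi_def)

text \<open>Both sides are linear in the jet of \<open>u\<close> of order \<open>k + 1\<close> with the same leading coefficient, and they
  agree for \<open>u = \<phi>\<^sub>1, \<dots>, \<phi>\<^sub>k\<^sub>+\<^sub>1\<close>, whose jets of order \<open>k\<close> are independent. Only differentiability at
  the point \<open>x\<close> is used, so that for \<open>k = n - 1\<close> the formula applies almost everywhere.\<close>
lemma wronsk_quotient_derivative: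
  assumes "x \<in> S" and nb: "at x within S \<noteq> bot"
    and d\<phi>: "\<And>j r. j \<in> {1..Suc k} \<Longrightarrow> r \<le> k \<Longrightarrow>
      (hder S r (\<phi> j) has_real_derivative hder S (Suc r) (\<phi> j) x) (at x within S)"
    and du: "\<And>r. r \<le> k \<Longrightarrow> (hder S r u has_real_derivative hder S (Suc r) u x) (at x within S)"
    and W: "\<And>y. y \<in> S \<Longrightarrow> Wi S \<phi> (Suc k) y \<noteq> 0"
  shows "((\<lambda>y. wronsk S (map \<phi> [1..<Suc k] @ [u]) y / Wi S \<phi> (Suc k) y) has_real_derivative
    Wi S \<phi> k x * wronsk S (map \<phi> [1..<Suc (Suc k)] @ [u]) x / (Wi S \<phi> (Suc k) x)\<^sup>2) (at x within S)"
proof -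
  define V where "V = (\<lambda>y j s. hder S s (\<phi> (Suc j)) y)"
  define C where "C = (\<lambda>r y. last_row_cofactor (V y) k r / Wi S \<phi> (Suc k) y)"
  define Q where "Q = (\<lambda>v y. wronsk S (map \<phi> [1..<Suc k] @ [v]) y / Wi S \<phi> (Suc k) y)"
  let ?P = "\<lambda>f :: real \<Rightarrow> real. f field_differentiable (at x within S)"
  have entry: "?P (\<lambda>y. V y j s)" if "j \<le> k" "s \<le> k" for j s
    unfolding V_def field_differentiable_def using d\<phi>[of "Suc j" s] that by auto
  note cl = det_closed[where P = ?P, OF field_differentiable_const field_differentiable_add field_differentiable_mult]
  have "?P (\<lambda>y. last_row_cofactor (V y) k r)" if "r \<le> k" for r
    unfolding last_row_cofactor_def
    by (intro field_differentiable_mult field_differentiable_const cl entry) auto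
  moreover have "?P (\<lambda>y. Wi S \<phi> (Suc k) y)"
    unfolding Wi_det using entry by (intro cl) (auto simp: V_def)
  ultimately have "?P (C r)" if "r \<le> k" for r
    unfolding C_def using that W[OF \<open>x \<in> S\<close>] by (intro field_differentiable_divide)
  then obtain C' where C': "\<And>r. r \<le> k \<Longrightarrow> (C r has_real_derivative C' r) (at x within S)"
    unfolding field_differentiable_def by metis
  \<comment> \<open>Coefficients of the derivative of the quotient as a linear form in the jet of
    order \<open>k + 1\<close>: \<open>C' r\<close> comes from differentiating the coefficient
    \<open>C r\<close>, and \<open>C (r - 1)\<close> from differentiating the derivative of order
    \<open>r - 1\<close>.\<close>
  define e where "e = (\<lambda>r. (if r \<le> k then C' r else 0) + (if r = 0 then 0 else C (r - 1) x))"
  have Qsum: "Q v = (\<lambda>y. \<Sum>r\<le>k. hder S r v y * C r y)" for v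
    unfolding Q_def C_def wronsk_snoc V_def by (simp add: sum_divide_distrib)
  have QD: "(Q v has_real_derivative (\<Sum>r\<le>Suc k. e r * hder S r v x)) (at x within S)"
    if "\<And>r. r \<le> k \<Longrightarrow> (hder S r v has_real_derivative hder S (Suc r) v x) (at x within S)" for v
  proof -
    have "(Q v has_real_derivative (\<Sum>r\<le>k. hder S (Suc r) v x * C r x + C' r * hder S r v x)) (at x within S)"
      unfolding Qsum by (intro DERIV_sum DERIV_mult C' that) auto
    moreover have "(\<Sum>r\<le>Suc k. e r * hder S r v x) = (\<Sum>r\<le>k. hder S (Suc r) v x * C r x + C' r * hder S r v x)"
    proof -
      have "(\<Sum>r\<le>Suc k. e r * hder S r v x) =
          (\<Sum>r\<le>Suc k. (if r \<le> k then C' r else 0) * hder S r v x) + (\<Sum>r\<le>Suc k. (if r = 0 then 0 else C (r - 1) x) * hder S r v x)"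
        unfolding e_def by (simp only: distrib_right sum.distrib)
      moreover have "(\<Sum>r\<le>Suc k. (if r \<le> k then C' r else 0) * hder S r v x) = (\<Sum>r\<le>k. C' r * hder S r v x)"
        by simp
      moreover have "(\<Sum>r\<le>Suc k. (if r = 0 then 0 else C (r - 1) x) * hder S r v x) = (\<Sum>r\<le>k. C r x * hder S (Suc r) v x)"
        by (subst sum.atMost_Suc_shift) simp
      ultimately show ?thesis by (simp add: sum.distrib mult.commute)
    qed
    ultimately show ?thesis by simp
  qed
  \<comment> \<open>The ratio of the leading coefficients, \<open>W_k / W_{k+1}\<close> for the
    derivative of the quotient and \<open>W_{k+1}\<close> for the larger Wronskian. Hence
    \<open>c\<close> has no term of order \<open>k + 1\<close>.\<close>
  define \<beta> where "\<beta> = Wi S \<phi> k x / (Wi S \<phi> (Suc k) x)\<^sup>2"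
  define c where "c = (\<lambda>r. e r - \<beta> * last_row_cofactor (V x) (Suc k) r)"
  have csum: "(\<Sum>r\<le>Suc k. c r * hder S r v x) =
      (\<Sum>r\<le>Suc k. e r * hder S r v x) - \<beta> * wronsk S (map \<phi> [1..<Suc (Suc k)] @ [v]) x" for v
    unfolding c_def wronsk_snoc V_def by (simp only: left_diff_distrib sum_subtractf sum_distrib_left) (simp only: mult_ac)
  have cSuc: "c (Suc k) = 0"
  proof -
    have "e (Suc k) = Wi S \<phi> k x / Wi S \<phi> (Suc k) x"
      by (simp add: e_def C_def last_row_cofactor_last Wi_det V_def)
    moreover have "last_row_cofactor (V x) (Suc k) (Suc k) = Wi S \<phi> (Suc k) x"
      by (simp add: last_row_cofactor_last Wi_det V_def)
    ultimately show ?thesis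
      using W[OF \<open>x \<in> S\<close>] by (simp add: c_def \<beta>_def power2_eq_square)
  qed
  \<comment> \<open>For these functions the quotient is constantly 0 or 1, so its derivative
    vanishes.\<close>
  have Q\<phi>: "(\<Sum>r\<le>Suc k. e r * hder S r (\<phi> i) x) = 0" if i: "i \<in> {1..Suc k}" for i
  proof -
    have "Q (\<phi> i) y = (if i = Suc k then 1 else 0)" if "y \<in> S" for y
    proof (cases "i = Suc k")
      case True
      then show ?thesis unfolding Q_def using W[OF that] by (simp add: wronsk_snoc_next del: upt_Suc One_nat_def)
    next
      case False
      then show ?thesis unfolding Q_def using i wronsk_snoc_repeated[of i k S \<phi> y] by (simp del: upt_Suc One_nat_def)
    qed
    then have "(Q (\<phi> i) has_vector_derivative 0) (at x within S)"
      using has_vector_derivative_transform[OF \<open>x \<in> S\<close> _ has_vector_derivative_const[of "if i = Suc k then 1 else 0 :: real"]] by metis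
    moreover have "(Q (\<phi> i) has_vector_derivative (\<Sum>r\<le>Suc k. e r * hder S r (\<phi> i) x)) (at x within S)"
      using QD[of "\<phi> i"] d\<phi>[OF i] has_real_derivative_iff_has_vector_derivative by blast
    ultimately show ?thesis using vector_derivative_unique_within[OF nb] by metis
  qed
  have "c r = 0" if "r < Suc k" for r
  proof (rule det_nonzero_kernel[OF _ _ that])
    show "det (mat (Suc k) (Suc k) (\<lambda>(j, r). V x j r)) \<noteq> 0"
      using W[OF \<open>x \<in> S\<close>] by (simp add: Wi_det V_def)
    fix j assume j: "j < Suc k"
    have "(\<Sum>r\<le>Suc k. c r * hder S r (\<phi> (Suc j)) x) = 0"
      using csum[of "\<phi> (Suc j)"] Q\<phi>[of "Suc j"] wronsk_snoc_repeated[of "Suc j" "Suc k" S \<phi> x] j by (simp del: upt_Suc One_nat_def)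
    then show "(\<Sum>r<Suc k. V x j r * c r) = 0"
      using cSuc by (simp add: V_def mult.commute lessThan_Suc_atMost)
  qed
  then have "(\<Sum>r\<le>Suc k. c r * hder S r u x) = 0"
    using cSuc by (intro sum.neutral) (auto simp: le_Suc_eq less_Suc_eq_le)
  then have "(\<Sum>r\<le>Suc k. e r * hder S r u x) = Wi S \<phi> k x * wronsk S (map \<phi> [1..<Suc (Suc k)] @ [u]) x / (Wi S \<phi> (Suc k) x)\<^sup>2"
    using csum[of u] by (simp add: \<beta>_def del: upt_Suc One_nat_def)
  then show ?thesis using QD[OF du] unfolding Q_def by simp
qed

section \<open>Monotonicity and l'Hopital's rule near the endpoint\<close>

lemma ival_downward: "x \<in> ival T x0 \<Longrightarrow> T \<le> y \<Longrightarrow> y \<le> x \<Longrightarrow> y \<in> ival T x0"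
  unfolding ival_def by (auto intro: le_less_trans[of "ereal y" "ereal x"])

lemma ival_Icc: "x \<in> ival T x0 \<Longrightarrow> T \<le> y \<Longrightarrow> {y..x} \<subseteq> ival T x0"
  using ival_downward by (metis atLeastAtMost_iff order_trans subsetI)

lemma ival_no_max: "x \<in> ival T x0 \<Longrightarrow> \<exists>y\<in>ival T x0. x < y"
proof -
  assume x: "x \<in> ival T x0"
  then obtain z where "ereal x < ereal z" "ereal z < x0" using ereal_dense2[of "ereal x" x0] by (auto simp: ival_def)
  then show ?thesis using x by (intro bexI[of _ z]) (auto simp: ival_def)
qed

text \<open>Treats finite and infinite endpoints alike, so that later arguments can work with points
  of the interval.\<close>

lemma eventually_lfilt:
  assumes "ereal T < x0"
  shows "eventually P (lfilt x0) \<longleftrightarrow> (\<exists>b\<in>ival T x0. \<forall>x\<in>ival T x0. b \<le> x \<longrightarrow> P x)"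
proof (cases x0)
  case PInf
  show ?thesis
  proof
    assume "eventually P (lfilt x0)"
    then obtain N where "\<forall>x\<ge>N. P x" by (auto simp: lfilt_def PInf eventually_at_top_linorder)
    then show "\<exists>b\<in>ival T x0. \<forall>x\<in>ival T x0. b \<le> x \<longrightarrow> P x"
      by (intro bexI[of _ "max T N"]) (auto simp: ival_def PInf)
  next
    assume "\<exists>b\<in>ival T x0. \<forall>x\<in>ival T x0. b \<le> x \<longrightarrow> P x"
    then show "eventually P (lfilt x0)"
      by (auto simp: lfilt_def PInf eventually_at_top_linorder ival_def intro: order_trans)
  qed
next
  case (real c)
  then have "T < c" using assms by simp
  show ?thesis
  proof
    assume "eventually P (lfilt x0)"
    then obtain b where b: "b < c" "\<forall>y>b. y < c \<longrightarrow> P y"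
      using eventually_at_left[OF \<open>T < c\<close>] by (auto simp: lfilt_def real)
    then show "\<exists>b\<in>ival T x0. \<forall>x\<in>ival T x0. b \<le> x \<longrightarrow> P x"
      using \<open>T < c\<close> by (intro bexI[of _ "max T ((b + c) / 2)"]) (auto simp: ival_def real)
  next
    assume "\<exists>b\<in>ival T x0. \<forall>x\<in>ival T x0. b \<le> x \<longrightarrow> P x"
    then obtain b where "T \<le> b" "b < c" "\<forall>x. T \<le> x \<and> x < c \<longrightarrow> b \<le> x \<longrightarrow> P x"
      by (auto simp: ival_def real)
    then have "\<exists>b<c. \<forall>y>b. y < c \<longrightarrow> P y" by (intro exI[of _ b]) auto
    then show "eventually P (lfilt x0)"
      using eventually_at_left[OF \<open>T < c\<close>] by (simp add: lfilt_def real)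
  qed
next
  case MInf
  then show ?thesis using assms by simp
qed

lemma eventually_lfiltE:
  assumes "ereal T < x0" "eventually P (lfilt x0)"
  obtains b where "b \<in> ival T x0" "\<And>x. x \<in> ival T x0 \<Longrightarrow> b \<le> x \<Longrightarrow> P x"
  using assms(2) unfolding eventually_lfilt[OF assms(1)] by blast

lemma ival_start: "ereal T < x0 \<Longrightarrow> T \<in> ival T x0"
  by (simp add: ival_def)

lemma lfilt_neq_bot: "ereal T < x0 \<Longrightarrow> lfilt x0 \<noteq> bot"
  by (cases x0) (auto simp: lfilt_def trivial_limit_at_left_real)

lemma eventually_lfilt_mem: "ereal T < x0 \<Longrightarrow> eventually (\<lambda>x. x \<in> ival T x0) (lfilt x0)"
  using ival_start by (subst eventually_lfilt) auto

lemma eventually_lfilt_ge: "ereal T < x0 \<Longrightarrow> b \<in> ival T x0 \<Longrightarrow> eventually (\<lambda>x. x \<in> ival T x0 \<and> b \<le> x) (lfilt x0)"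
  by (subst eventually_lfilt) auto

lemma tendsto_lfilt_cong:
  assumes "ereal T < x0" "\<And>x. x \<in> ival T x0 \<Longrightarrow> g x = h x"
  shows "(g \<longlongrightarrow> l) (lfilt x0) \<longleftrightarrow> (h \<longlongrightarrow> l) (lfilt x0)"
  using eventually_lfilt_mem[OF assms(1)] by (intro tendsto_cong) (auto elim!: eventually_mono simp: assms(2))

lemma ival_MVT:
  assumes "\<And>z. z \<in> ival T x0 \<Longrightarrow> (g has_real_derivative g' z) (at z within ival T x0)"
    and "x \<in> ival T x0" "y \<in> ival T x0" "x < y"
  obtains z where "z \<in> ival T x0" "x < z" "z < y" "g y - g x = g' z * (y - x)"
proof -
  have sub: "{x..y} \<subseteq> ival T x0" using assms(2,3) ival_Icc by (auto simp: ival_def)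
  have "\<exists>z\<in>{x<..<y}. g y - g x = (\<lambda>v. v * g' z) (y - x)"
  proof (rule mvt_simple[OF \<open>x < y\<close>])
    fix z assume "x \<le> z" "z \<le> y"
    then have "(g has_real_derivative g' z) (at z within {x..y})"
      using assms(1) sub by (meson DERIV_subset atLeastAtMost_iff subsetD)
    then show "(g has_derivative (\<lambda>v. v * g' z)) (at z within {x..y})"
      by (simp add: has_field_derivative_def mult_commute_abs)
  qed
  then obtain z where "x < z" "z < y" "g y - g x = (y - x) * g' z" by auto
  moreover from this have "z \<in> ival T x0" using sub by auto
  ultimately show ?thesis using that[of z] by (simp add: mult.commute)
qed

lemma ival_eventually_mono:
  assumes "ereal T < x0" "\<And>z. z \<in> ival T x0 \<Longrightarrow> (g has_real_derivative g' z) (at z within ival T x0)"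
    and ev: "eventually (\<lambda>x. g' x \<ge> 0) (lfilt x0)"
  obtains b where "b \<in> ival T x0" "\<And>x y. x \<in> ival T x0 \<Longrightarrow> y \<in> ival T x0 \<Longrightarrow> b \<le> x \<Longrightarrow> x \<le> y \<Longrightarrow> g x \<le> g y"
proof -
  obtain b where b: "b \<in> ival T x0" "\<And>x. x \<in> ival T x0 \<Longrightarrow> b \<le> x \<Longrightarrow> g' x \<ge> 0"
    by (rule eventually_lfiltE[OF assms(1) ev]) (rule that)
  have "g x \<le> g y" if xy: "x \<in> ival T x0" "y \<in> ival T x0" "b \<le> x" "x \<le> y" for x y
  proof (cases "x = y")
    case False
    with xy(4) have "x < y" by simp
    obtain z where "z \<in> ival T x0" "x < z" "z < y" "g y - g x = g' z * (y - x)"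
      by (rule ival_MVT[OF assms(2) xy(1,2) \<open>x < y\<close>]) (assumption, rule that)
    moreover from this have "g' z * (y - x) \<ge> 0" using b(2)[of z] xy by auto
    ultimately show ?thesis by simp
  qed simp
  with b(1) show ?thesis using that by blast
qed

lemma ival_eventually_strict_mono:
  assumes "ereal T < x0" "\<And>z. z \<in> ival T x0 \<Longrightarrow> (g has_real_derivative g' z) (at z within ival T x0)"
    and ev: "eventually (\<lambda>x. g' x > 0) (lfilt x0)"
  obtains b where "b \<in> ival T x0" "\<And>x y. x \<in> ival T x0 \<Longrightarrow> y \<in> ival T x0 \<Longrightarrow> b \<le> x \<Longrightarrow> x < y \<Longrightarrow> g x < g y"
proof -
  obtain b where b: "b \<in> ival T x0" "\<And>x. x \<in> ival T x0 \<Longrightarrow> b \<le> x \<Longrightarrow> g' x > 0"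
    by (rule eventually_lfiltE[OF assms(1) ev]) (rule that)
  have "g x < g y" if xy: "x \<in> ival T x0" "y \<in> ival T x0" "b \<le> x" "x < y" for x y
  proof -
    obtain z where "z \<in> ival T x0" "x < z" "z < y" "g y - g x = g' z * (y - x)"
      by (rule ival_MVT[OF assms(2) xy(1,2)]) (assumption, rule xy(4), rule that)
    moreover from this have "g' z * (y - x) > 0" using b(2)[of z] xy by auto
    ultimately show ?thesis by simp
  qed
  with b(1) show ?thesis using that by blast
qed

lemma increasing_to_zero_nonpos:
  assumes "ereal T < x0" "\<And>z. z \<in> ival T x0 \<Longrightarrow> (g has_real_derivative g' z) (at z within ival T x0)"
    and "eventually (\<lambda>x. g' x \<ge> 0) (lfilt x0)" and lim: "(g \<longlongrightarrow> 0) (lfilt x0)"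
  shows "eventually (\<lambda>x. g x \<le> 0) (lfilt x0)"
proof -
  obtain b where b: "b \<in> ival T x0" "\<And>x y. x \<in> ival T x0 \<Longrightarrow> y \<in> ival T x0 \<Longrightarrow> b \<le> x \<Longrightarrow> x \<le> y \<Longrightarrow> g x \<le> g y"
    using ival_eventually_mono[OF assms(1-3)] by blast
  have "g x \<le> 0" if "x \<in> ival T x0" "b \<le> x" for x
  proof (rule tendsto_lowerbound[OF lim _ lfilt_neq_bot[OF assms(1)]])
    show "eventually (\<lambda>y. g x \<le> g y) (lfilt x0)"
      using eventually_lfilt_ge[OF assms(1) that(1)] by (rule eventually_mono) (use b that in auto)
  qed
  then show ?thesis using b(1) by (subst eventually_lfilt[OF assms(1)]) auto
qed

text \<open>Strictness survives the limit because beyond any \<open>x\<close> there is a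
  \<open>y\<close> with \<open>g x < g y\<close> and \<open>g y \<le> 0\<close>.\<close>

lemma increasing_to_zero_neg:
  assumes "ereal T < x0" "\<And>z. z \<in> ival T x0 \<Longrightarrow> (g has_real_derivative g' z) (at z within ival T x0)"
    and ev: "eventually (\<lambda>x. g' x > 0) (lfilt x0)" and lim: "(g \<longlongrightarrow> 0) (lfilt x0)"
  shows "eventually (\<lambda>x. g x < 0) (lfilt x0)"
proof -
  obtain b where b: "b \<in> ival T x0" "\<And>x y. x \<in> ival T x0 \<Longrightarrow> y \<in> ival T x0 \<Longrightarrow> b \<le> x \<Longrightarrow> x < y \<Longrightarrow> g x < g y"
    using ival_eventually_strict_mono[OF assms(1-3)] by blast
  have ev0: "eventually (\<lambda>x. g' x \<ge> 0) (lfilt x0)" using ev by (rule eventually_mono) simp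
  obtain c where c: "c \<in> ival T x0" "\<And>x. x \<in> ival T x0 \<Longrightarrow> c \<le> x \<Longrightarrow> g x \<le> 0"
    by (rule eventually_lfiltE[OF assms(1) increasing_to_zero_nonpos[OF assms(1,2) ev0 lim]]) (assumption, rule that)
  have "g x < 0" if x: "x \<in> ival T x0" "max b c \<le> x" for x
  proof -
    obtain y where "y \<in> ival T x0" "x < y" using ival_no_max[OF x(1)] by blast
    then show ?thesis using b(2)[of x y] c(2)[of y] x by simp
  qed
  moreover have "max b c \<in> ival T x0" using b(1) c(1) by (simp add: max_def)
  ultimately show ?thesis unfolding eventually_lfilt[OF assms(1)] by blast
qed

section \<open>Functions of eventually constant sign\<close>

definition eventually_signed :: "real filter \<Rightarrow> (real \<Rightarrow> real) \<Rightarrow> bool" where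
  "eventually_signed F g \<longleftrightarrow> eventually (\<lambda>x. g x > 0) F \<or> eventually (\<lambda>x. g x < 0) F"

lemma eventually_signed_uminus: "eventually_signed F (\<lambda>x. - g x) \<longleftrightarrow> eventually_signed F g"
  by (auto simp: eventually_signed_def)

lemma eventually_signed_nonzero: "eventually_signed F g \<Longrightarrow> eventually (\<lambda>x. g x \<noteq> 0) F"
  unfolding eventually_signed_def by (auto elim: eventually_mono)

text \<open>A strictly increasing function is positive after any point where it is nonnegative; if
  there is no such point, it is negative. This is the form in which Rolle's argument is
  used.\<close>

lemma eventually_signed_antiderivative_aux:
  assumes "ereal T < x0" "\<And>z. z \<in> ival T x0 \<Longrightarrow> (g has_real_derivative g' z) (at z within ival T x0)"
    and ev: "eventually (\<lambda>x. g' x > 0) (lfilt x0)"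
  shows "eventually_signed (lfilt x0) g"
proof -
  obtain b where b: "b \<in> ival T x0" "\<And>x y. x \<in> ival T x0 \<Longrightarrow> y \<in> ival T x0 \<Longrightarrow> b \<le> x \<Longrightarrow> x < y \<Longrightarrow> g x < g y"
    using ival_eventually_strict_mono[OF assms(1-3)] by blast
  show ?thesis
  proof (cases "\<exists>c\<in>ival T x0. b \<le> c \<and> g c \<ge> 0")
    case True
    then obtain c where c: "c \<in> ival T x0" "b \<le> c" "g c \<ge> 0" by blast
    obtain d where d: "d \<in> ival T x0" "c < d" using ival_no_max[OF c(1)] by blast
    have "g x > 0" if "x \<in> ival T x0" "d \<le> x" for x
      using b(2)[of c x] c d that by auto
    then show ?thesis using d(1) unfolding eventually_signed_def eventually_lfilt[OF assms(1)] by blast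
  next
    case False
    then show ?thesis using b(1) unfolding eventually_signed_def eventually_lfilt[OF assms(1)] by force
  qed
qed

lemma eventually_signed_antiderivative:
  assumes "ereal T < x0" "\<And>z. z \<in> ival T x0 \<Longrightarrow> (g has_real_derivative g' z) (at z within ival T x0)"
    and ev: "eventually_signed (lfilt x0) g'"
  shows "eventually_signed (lfilt x0) g"
proof (cases "eventually (\<lambda>x. g' x > 0) (lfilt x0)")
  case True
  then show ?thesis using eventually_signed_antiderivative_aux[OF assms(1,2)] by blast
next
  case False
  then have "eventually (\<lambda>x. - g' x > 0) (lfilt x0)" using ev by (simp add: eventually_signed_def)
  then have "eventually_signed (lfilt x0) (\<lambda>x. - g x)"
    by (rule eventually_signed_antiderivative_aux[OF assms(1), rotated]) (intro DERIV_minus assms(2))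
  then show ?thesis by (simp add: eventually_signed_uminus)
qed

section \<open>Quotients of functions and of their derivatives\<close>

lemma tendsto_zero_quotientI:
  fixes g h :: "real \<Rightarrow> real"
  assumes "\<And>c. c > 0 \<Longrightarrow> eventually (\<lambda>x. \<bar>g x\<bar> \<le> c * \<bar>h x\<bar>) F" and "eventually (\<lambda>x. h x \<noteq> 0) F"
  shows "((\<lambda>x. g x / h x) \<longlongrightarrow> 0) F"
proof (rule tendstoI)
  fix e :: real assume "e > 0"
  then have "eventually (\<lambda>x. \<bar>g x\<bar> \<le> e / 2 * \<bar>h x\<bar>) F" by (intro assms(1)) simp
  then show "eventually (\<lambda>x. dist (g x / h x) 0 < e) F"
    using assms(2)
  proof eventually_elim
    case (elim x)
    then have "\<bar>g x / h x\<bar> \<le> e / 2"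
      using pos_divide_le_eq[of "\<bar>h x\<bar>" "\<bar>g x\<bar>" "e / 2"] by (simp add: abs_divide)
    then have "\<bar>g x / h x\<bar> < e" using \<open>e > 0\<close> by linarith
    then show ?case by (simp only: dist_real_def diff_zero)
  qed
qed

lemma tendsto_zero_quotientD:
  fixes g h :: "real \<Rightarrow> real"
  assumes "((\<lambda>x. g x / h x) \<longlongrightarrow> 0) F" "eventually (\<lambda>x. h x \<noteq> 0) F" "c > 0"
  shows "eventually (\<lambda>x. \<bar>g x\<bar> \<le> c * \<bar>h x\<bar>) F"
  using tendstoD[OF assms(1,3)] assms(2)
proof eventually_elim
  case (elim x)
  then have "\<bar>g x\<bar> / \<bar>h x\<bar> < c" by (simp add: dist_real_def abs_divide)
  then show ?case using elim by (simp add: divide_less_eq)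
qed

text \<open>A converse of l'Hopital's rule: the quotient of the derivatives inherits the limit because
  no combination \<open>\<eta>' - c \<psi>'\<close> oscillates in sign.\<close>
lemma quotient_of_derivatives_tendsto_zero_aux:
  assumes T: "ereal T < x0"
    and d\<psi>: "\<And>z. z \<in> ival T x0 \<Longrightarrow> (\<psi> has_real_derivative \<psi>' z) (at z within ival T x0)"
    and d\<eta>: "\<And>z. z \<in> ival T x0 \<Longrightarrow> (\<eta> has_real_derivative \<eta>' z) (at z within ival T x0)"
    and \<psi>: "(\<psi> \<longlongrightarrow> 0) (lfilt x0)" and \<eta>: "(\<eta> \<longlongrightarrow> 0) (lfilt x0)"
    and pos: "eventually (\<lambda>x. \<psi>' x > 0) (lfilt x0)"
    and sg: "\<And>c. eventually_signed (lfilt x0) (\<lambda>x. \<eta>' x - c * \<psi>' x)"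
    and q: "((\<lambda>x. \<eta> x / \<psi> x) \<longlongrightarrow> 0) (lfilt x0)"
  shows "((\<lambda>x. \<eta>' x / \<psi>' x) \<longlongrightarrow> 0) (lfilt x0)"
proof (rule tendsto_zero_quotientI)
  show "eventually (\<lambda>x. \<psi>' x \<noteq> 0) (lfilt x0)" using pos by (rule eventually_mono) simp
  have \<psi>neg: "eventually (\<lambda>x. \<psi> x < 0) (lfilt x0)"
    using increasing_to_zero_neg[OF T d\<psi> pos \<psi>] .
  have small: "eventually (\<lambda>x. \<bar>\<eta> x\<bar> \<le> c * \<bar>\<psi> x\<bar>) (lfilt x0)" if "c > 0" for c
    by (rule tendsto_zero_quotientD[OF q _ that]) (use \<psi>neg in \<open>rule eventually_mono, simp\<close>)
  fix c :: real assume c: "c > 0"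
  \<comment> \<open>Otherwise \<open>\<eta> - c * \<psi>\<close> increases to 0 and is negative, so
    \<open>\<eta> < c * \<psi> < c / 2 * \<psi>\<close> because \<open>\<psi> < 0\<close>. This
    contradicts \<open>\<bar>\<eta>\<bar> \<le> c / 2 * \<bar>\<psi>\<bar>\<close>.\<close>
  have 1: "eventually (\<lambda>x. \<eta>' x - c * \<psi>' x < 0) (lfilt x0)"
  proof (rule ccontr)
    assume "\<not> ?thesis"
    then have "eventually (\<lambda>x. \<eta>' x - c * \<psi>' x > 0) (lfilt x0)"
      using sg[of c] by (simp add: eventually_signed_def)
    then have "eventually (\<lambda>x. \<eta> x - c * \<psi> x < 0) (lfilt x0)"
      by (rule increasing_to_zero_neg[OF T, rotated])
        (use tendsto_diff[OF \<eta> tendsto_mult_right_zero[OF \<psi>, of c]] in simp, intro DERIV_diff DERIV_add DERIV_minus DERIV_cmult d\<psi> d\<eta>)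
    then have "eventually (\<lambda>x. False) (lfilt x0)" using small[OF half_gt_zero[OF c]] \<psi>neg
    proof eventually_elim
      case (elim x)
      then have "\<eta> x \<ge> c / 2 * \<psi> x" by (simp add: abs_le_iff)
      moreover have "c * \<psi> x < c / 2 * \<psi> x" using c elim by (simp add: mult_less_0_iff)
      ultimately show ?case using elim by linarith
    qed
    then show False using lfilt_neq_bot[OF T] by simp
  qed
  \<comment> \<open>The same argument applied to \<open>- \<eta>\<close>.\<close>
  have 2: "eventually (\<lambda>x. \<eta>' x - (- c) * \<psi>' x > 0) (lfilt x0)"
  proof (rule ccontr)
    assume "\<not> ?thesis"
    then have "eventually (\<lambda>x. - \<eta>' x - c * \<psi>' x > 0) (lfilt x0)"
      using sg[of "- c"] by (auto simp: eventually_signed_def elim: eventually_mono)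
    then have "eventually (\<lambda>x. - \<eta> x - c * \<psi> x < 0) (lfilt x0)"
      by (rule increasing_to_zero_neg[OF T, rotated])
        (use tendsto_diff[OF tendsto_minus[OF \<eta>] tendsto_mult_right_zero[OF \<psi>, of c]] in simp, intro DERIV_diff DERIV_add DERIV_minus DERIV_cmult d\<psi> d\<eta>)
    then have "eventually (\<lambda>x. False) (lfilt x0)" using small[OF half_gt_zero[OF c]] \<psi>neg
    proof eventually_elim
      case (elim x)
      then have "- \<eta> x \<ge> c / 2 * \<psi> x" by (simp add: abs_le_iff)
      moreover have "c * \<psi> x < c / 2 * \<psi> x" using c elim by (simp add: mult_less_0_iff)
      ultimately show ?case using elim by linarith
    qed
    then show False using lfilt_neq_bot[OF T] by simp
  qed
  show "eventually (\<lambda>x. \<bar>\<eta>' x\<bar> \<le> c * \<bar>\<psi>' x\<bar>) (lfilt x0)"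
    using 1 2 pos by eventually_elim auto
qed

lemma quotient_of_derivatives_tendsto_zero:
  assumes T: "ereal T < x0"
    and d\<psi>: "\<And>z. z \<in> ival T x0 \<Longrightarrow> (\<psi> has_real_derivative \<psi>' z) (at z within ival T x0)"
    and d\<eta>: "\<And>z. z \<in> ival T x0 \<Longrightarrow> (\<eta> has_real_derivative \<eta>' z) (at z within ival T x0)"
    and \<psi>: "(\<psi> \<longlongrightarrow> 0) (lfilt x0)" and \<eta>: "(\<eta> \<longlongrightarrow> 0) (lfilt x0)"
    and s\<psi>: "eventually_signed (lfilt x0) \<psi>'"
    and sg: "\<And>c. eventually_signed (lfilt x0) (\<lambda>x. \<eta>' x - c * \<psi>' x)"
    and q: "((\<lambda>x. \<eta> x / \<psi> x) \<longlongrightarrow> 0) (lfilt x0)"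
  shows "((\<lambda>x. \<eta>' x / \<psi>' x) \<longlongrightarrow> 0) (lfilt x0)"
proof (cases "eventually (\<lambda>x. \<psi>' x > 0) (lfilt x0)")
  case True
  show ?thesis
    by (rule quotient_of_derivatives_tendsto_zero_aux[where \<psi> = \<psi> and \<psi>' = \<psi>' and \<eta> = \<eta> and \<eta>' = \<eta>'])
      (fact T d\<psi> d\<eta> \<psi> \<eta> True sg q)+
next
  case False
  then have neg: "eventually (\<lambda>x. - \<psi>' x > 0) (lfilt x0)" using s\<psi> by (simp add: eventually_signed_def)
  have "((\<lambda>x. \<eta>' x / (- \<psi>' x)) \<longlongrightarrow> 0) (lfilt x0)"
  proof (rule quotient_of_derivatives_tendsto_zero_aux[where \<psi> = "\<lambda>x. - \<psi> x" and \<psi>' = "\<lambda>x. - \<psi>' x" and \<eta> = \<eta> and \<eta>' = \<eta>', OF T _ d\<eta> _ \<eta> neg])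
    show "((\<lambda>x. - \<psi> x) has_real_derivative - \<psi>' z) (at z within ival T x0)" if "z \<in> ival T x0" for z
      by (intro DERIV_minus d\<psi> that)
    show "((\<lambda>x. - \<psi> x) \<longlongrightarrow> 0) (lfilt x0)" using tendsto_minus[OF \<psi>] by simp
    show "eventually_signed (lfilt x0) (\<lambda>x. \<eta>' x - c * (- \<psi>' x))" for c using sg[of "- c"] by simp
    show "((\<lambda>x. \<eta> x / (- \<psi> x)) \<longlongrightarrow> 0) (lfilt x0)" using tendsto_minus[OF q] by simp
  qed
  from tendsto_minus[OF this] show ?thesis by simp
qed

text \<open>Eventually \<open>\<bar>h'\<bar> \<le> c * \<psi>'\<close>, so
  \<open>c * \<psi> + h\<close> and \<open>c * \<psi> - h\<close> increase to 0 and are nonpositive,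
  which says \<open>\<bar>h\<bar> \<le> c * \<bar>\<psi>\<bar>\<close>. Monotonicity replaces
  Cauchy's mean value theorem.\<close>

lemma lhopital_tendsto_zero_aux:
  assumes T: "ereal T < x0"
    and d\<psi>: "\<And>z. z \<in> ival T x0 \<Longrightarrow> (\<psi> has_real_derivative \<psi>' z) (at z within ival T x0)"
    and dh: "\<And>z. z \<in> ival T x0 \<Longrightarrow> (h has_real_derivative h' z) (at z within ival T x0)"
    and \<psi>: "(\<psi> \<longlongrightarrow> 0) (lfilt x0)" and h: "(h \<longlongrightarrow> 0) (lfilt x0)"
    and pos: "eventually (\<lambda>x. \<psi>' x > 0) (lfilt x0)"
    and q: "((\<lambda>x. h' x / \<psi>' x) \<longlongrightarrow> 0) (lfilt x0)"
  shows "((\<lambda>x. h x / \<psi> x) \<longlongrightarrow> 0) (lfilt x0)"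
proof (rule tendsto_zero_quotientI)
  have \<psi>neg: "eventually (\<lambda>x. \<psi> x < 0) (lfilt x0)"
    using increasing_to_zero_neg[OF T d\<psi> pos \<psi>] .
  then show "eventually (\<lambda>x. \<psi> x \<noteq> 0) (lfilt x0)" by (rule eventually_mono) simp
  fix c :: real assume c: "c > 0"
  have "eventually (\<lambda>x. \<psi>' x \<noteq> 0) (lfilt x0)" using pos by (rule eventually_mono) simp
  from tendsto_zero_quotientD[OF q this c] pos
  have b: "eventually (\<lambda>x. \<bar>h' x\<bar> \<le> c * \<psi>' x) (lfilt x0)" by eventually_elim simp
  have "eventually (\<lambda>x. c * \<psi>' x - h' x \<ge> 0) (lfilt x0)" using b by (rule eventually_mono) (simp add: abs_le_iff)
  then have 1: "eventually (\<lambda>x. c * \<psi> x - h x \<le> 0) (lfilt x0)"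
    by (rule increasing_to_zero_nonpos[OF T, rotated])
        (use tendsto_diff[OF tendsto_mult_right_zero[OF \<psi>, of c] h] in simp, intro DERIV_diff DERIV_add DERIV_minus DERIV_cmult d\<psi> dh)
  have "eventually (\<lambda>x. c * \<psi>' x + h' x \<ge> 0) (lfilt x0)" using b by (rule eventually_mono) (simp add: abs_le_iff)
  then have 2: "eventually (\<lambda>x. c * \<psi> x + h x \<le> 0) (lfilt x0)"
    by (rule increasing_to_zero_nonpos[OF T, rotated])
        (use tendsto_add[OF tendsto_mult_right_zero[OF \<psi>, of c] h] in simp, intro DERIV_diff DERIV_add DERIV_minus DERIV_cmult d\<psi> dh)
  show "eventually (\<lambda>x. \<bar>h x\<bar> \<le> c * \<bar>\<psi> x\<bar>) (lfilt x0)"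
    using 1 2 \<psi>neg by eventually_elim (auto simp: abs_le_iff)
qed

lemma lhopital_tendsto_zero:
  assumes T: "ereal T < x0"
    and d\<psi>: "\<And>z. z \<in> ival T x0 \<Longrightarrow> (\<psi> has_real_derivative \<psi>' z) (at z within ival T x0)"
    and dh: "\<And>z. z \<in> ival T x0 \<Longrightarrow> (h has_real_derivative h' z) (at z within ival T x0)"
    and \<psi>: "(\<psi> \<longlongrightarrow> 0) (lfilt x0)" and h: "(h \<longlongrightarrow> 0) (lfilt x0)"
    and s\<psi>: "eventually_signed (lfilt x0) \<psi>'"
    and q: "((\<lambda>x. h' x / \<psi>' x) \<longlongrightarrow> 0) (lfilt x0)"
  shows "((\<lambda>x. h x / \<psi> x) \<longlongrightarrow> 0) (lfilt x0)"
proof (cases "eventually (\<lambda>x. \<psi>' x > 0) (lfilt x0)")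
  case True
  show ?thesis
    by (rule lhopital_tendsto_zero_aux[where \<psi> = \<psi> and \<psi>' = \<psi>' and h = h and h' = h'])
      (fact T d\<psi> dh \<psi> h True q)+
next
  case False
  then have neg: "eventually (\<lambda>x. - \<psi>' x > 0) (lfilt x0)" using s\<psi> by (simp add: eventually_signed_def)
  have "((\<lambda>x. h x / (- \<psi> x)) \<longlongrightarrow> 0) (lfilt x0)"
  proof (rule lhopital_tendsto_zero_aux[where \<psi> = "\<lambda>x. - \<psi> x" and \<psi>' = "\<lambda>x. - \<psi>' x" and h = h and h' = h', OF T _ dh _ h neg])
    show "((\<lambda>x. - \<psi> x) has_real_derivative - \<psi>' z) (at z within ival T x0)" if "z \<in> ival T x0" for z
      by (intro DERIV_minus d\<psi> that)
    show "((\<lambda>x. - \<psi> x) \<longlongrightarrow> 0) (lfilt x0)" using tendsto_minus[OF \<psi>] by simp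
    show "((\<lambda>x. h' x / (- \<psi>' x)) \<longlongrightarrow> 0) (lfilt x0)" using tendsto_minus[OF q] by simp
  qed
  from tendsto_minus[OF this] show ?thesis by simp
qed

text \<open>Both \<open>C * \<psi> + g\<close> and \<open>C * \<psi> - g\<close> are eventually
  increasing. The second fact bounds \<open>g\<close> above, so the first function is bounded and
  converges by monotonicity; the convergent \<open>C * \<psi>\<close> is then subtracted.\<close>

lemma convergent_of_dominated_derivative:
  assumes T: "ereal T < x0"
    and d\<psi>: "\<And>z. z \<in> ival T x0 \<Longrightarrow> (\<psi> has_real_derivative \<psi>' z) (at z within ival T x0)"
    and dg: "\<And>z. z \<in> ival T x0 \<Longrightarrow> (g has_real_derivative g' z) (at z within ival T x0)"
    and \<psi>: "(\<psi> \<longlongrightarrow> l) (lfilt x0)"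
    and bd: "eventually (\<lambda>x. \<bar>g' x\<bar> \<le> C * \<psi>' x) (lfilt x0)"
  shows "\<exists>L. (g \<longlongrightarrow> L) (lfilt x0)"
proof -
  let ?S = "ival T x0"
  have ev1: "eventually (\<lambda>x. C * \<psi>' x + g' x \<ge> 0) (lfilt x0)" using bd by (rule eventually_mono) (simp add: abs_le_iff)
  have d1: "((\<lambda>x. C * \<psi> x + g x) has_real_derivative C * \<psi>' z + g' z) (at z within ?S)" if "z \<in> ?S" for z
    using that by (intro DERIV_diff DERIV_add DERIV_cmult d\<psi> dg)
  obtain b1 where b1: "b1 \<in> ?S"
    "\<And>x y. x \<in> ?S \<Longrightarrow> y \<in> ?S \<Longrightarrow> b1 \<le> x \<Longrightarrow> x \<le> y \<Longrightarrow> C * \<psi> x + g x \<le> C * \<psi> y + g y"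
    using ival_eventually_mono[OF T d1 ev1] by blast
  have ev2: "eventually (\<lambda>x. C * \<psi>' x - g' x \<ge> 0) (lfilt x0)" using bd by (rule eventually_mono) (simp add: abs_le_iff)
  have d2: "((\<lambda>x. C * \<psi> x - g x) has_real_derivative C * \<psi>' z - g' z) (at z within ?S)" if "z \<in> ?S" for z
    using that by (intro DERIV_diff DERIV_add DERIV_cmult d\<psi> dg)
  obtain b2 where b2: "b2 \<in> ?S"
    "\<And>x y. x \<in> ?S \<Longrightarrow> y \<in> ?S \<Longrightarrow> b2 \<le> x \<Longrightarrow> x \<le> y \<Longrightarrow> C * \<psi> x - g x \<le> C * \<psi> y - g y"
    using ival_eventually_mono[OF T d2 ev2] by blast
  have C\<psi>: "((\<lambda>x. 2 * (C * \<psi> x)) \<longlongrightarrow> 2 * (C * l)) (lfilt x0)" by (intro tendsto_intros \<psi>)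
  then have "eventually (\<lambda>x. 2 * (C * \<psi> x) < 2 * (C * l) + 1) (lfilt x0)"
    by (rule order_tendstoD) simp
  then obtain b3 where b3: "b3 \<in> ?S" "\<And>x. x \<in> ?S \<Longrightarrow> b3 \<le> x \<Longrightarrow> 2 * (C * \<psi> x) < 2 * (C * l) + 1"
    by (rule eventually_lfiltE[OF T]) (rule that)
  define b where "b = max b1 (max b2 b3)"
  have b: "b \<in> ?S" using b1(1) b2(1) b3(1) by (auto simp: b_def max_def)
  let ?u = "\<lambda>x. C * \<psi> x + g x"
  let ?A = "?u ` {x\<in>?S. b \<le> x}"
  \<comment> \<open>\<open>?u\<close> is \<open>2 * (C * \<psi>)\<close> minus
    \<open>C * \<psi> - g\<close>: the former is eventually bounded, the latter increasing.\<close>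
  have ub: "?u x \<le> 2 * (C * l) + 1 - (C * \<psi> b - g b)" if "x \<in> ?S" "b \<le> x" for x
  proof -
    have "C * \<psi> b - g b \<le> C * \<psi> x - g x" using b2(2)[of b x] that b by (simp add: b_def)
    moreover have "2 * (C * \<psi> x) < 2 * (C * l) + 1" using b3(2)[of x] that by (simp add: b_def)
    ultimately show ?thesis by linarith
  qed
  then have bdd: "bdd_above ?A" unfolding bdd_above_def by blast
  have "(?u \<longlongrightarrow> Sup ?A) (lfilt x0)"
  proof (rule increasing_tendsto)
    show "eventually (\<lambda>x. ?u x \<le> Sup ?A) (lfilt x0)"
      using eventually_lfilt_ge[OF T b] by (rule eventually_mono) (auto intro!: cSup_upper bdd)
    fix y assume "y < Sup ?A"
    moreover have "?A \<noteq> {}" using b by blast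
    ultimately obtain w where "w \<in> ?A" "y < w" by (rule less_cSupE)
    then obtain x where x: "x \<in> ?S" "b \<le> x" "y < ?u x" by blast
    show "eventually (\<lambda>x. y < ?u x) (lfilt x0)"
      using eventually_lfilt_ge[OF T x(1)]
    proof (rule eventually_mono)
      fix z assume z: "z \<in> ?S \<and> x \<le> z"
      show "y < ?u z" using b1(2)[of x z] x z by (auto simp: b_def)
    qed
  qed
  then have "((\<lambda>x. ?u x - C * \<psi> x) \<longlongrightarrow> Sup ?A - C * l) (lfilt x0)"
    by (intro tendsto_intros \<psi>)
  then show ?thesis by auto
qed

section \<open>Chains of weighted derivatives\<close>

text \<open>An abstract form of \<open>M_0 u, ..., M_m u\<close>. The condition is linear in
  \<open>G\<close>, and for \<open>m = n - 1\<close> it stops just below the level at which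
  derivatives exist only almost everywhere.\<close>

definition derivative_chain :: "real set \<Rightarrow> (nat \<Rightarrow> real \<Rightarrow> real) \<Rightarrow> nat \<Rightarrow> (nat \<Rightarrow> real \<Rightarrow> real) \<Rightarrow> bool" where
  "derivative_chain S q m G \<longleftrightarrow>
     (\<forall>k<m. \<forall>x\<in>S. (G k has_real_derivative G (Suc k) x / q (Suc k) x) (at x within S))"

lemma derivative_chainD:
  "derivative_chain S q m G \<Longrightarrow> k < m \<Longrightarrow> x \<in> S \<Longrightarrow>
    (G k has_real_derivative G (Suc k) x / q (Suc k) x) (at x within S)"
  by (simp add: derivative_chain_def)

lemma derivative_chain_diff_sum:
  assumes G: "derivative_chain S q m G" and P: "\<And>j. j \<in> I \<Longrightarrow> derivative_chain S q m (\<lambda>k. P k j)"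
  shows "derivative_chain S q m (\<lambda>k x. G k x - (\<Sum>j\<in>I. a j * P k j x))"
  unfolding derivative_chain_def
proof (intro allI impI ballI)
  fix k x assume k: "k < m" and x: "x \<in> S"
  have "((\<lambda>x. G k x - (\<Sum>j\<in>I. a j * P k j x)) has_real_derivative
      G (Suc k) x / q (Suc k) x - (\<Sum>j\<in>I. a j * (P (Suc k) j x / q (Suc k) x))) (at x within S)"
    by (intro DERIV_diff DERIV_sum DERIV_cmult derivative_chainD[OF G k x] derivative_chainD[OF P k x])
  then show "((\<lambda>x. G k x - (\<Sum>j\<in>I. a j * P k j x)) has_real_derivative
      (G (Suc k) x - (\<Sum>j\<in>I. a j * P (Suc k) j x)) / q (Suc k) x) (at x within S)"
    by (simp add: diff_divide_distrib sum_divide_distrib)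
qed

lemma derivative_chain_FTC:
  assumes G: "derivative_chain (ival T x0) q m G" and "k < m" "T \<le> s" "s \<le> b" "b \<in> ival T x0"
  shows "((\<lambda>t. G (Suc k) t / q (Suc k) t) has_integral G k b - G k s) {s..b}"
proof (rule fundamental_theorem_of_calculus[OF \<open>s \<le> b\<close>])
  fix x assume "x \<in> {s..b}"
  moreover have sub: "{s..b} \<subseteq> ival T x0" using ival_Icc assms by blast
  ultimately have "(G k has_real_derivative G (Suc k) x / q (Suc k) x) (at x within {s..b})"
    using derivative_chainD[OF G \<open>k < m\<close>] by (meson DERIV_subset subsetD)
  then show "(G k has_vector_derivative G (Suc k) x / q (Suc k) x) (at x within {s..b})"
    by (simp add: has_real_derivative_iff_has_vector_derivative)
qed

lemma eventually_signed_divide: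
  assumes "eventually_signed F g" "eventually (\<lambda>x. q x > 0) F"
  shows "eventually_signed F (\<lambda>x. g x / q x)"
  using assms(1) unfolding eventually_signed_def
proof
  assume "eventually (\<lambda>x. g x > 0) F"
  then have "eventually (\<lambda>x. g x / q x > 0) F" using assms(2) by eventually_elim simp
  then show "eventually (\<lambda>x. g x / q x > 0) F \<or> eventually (\<lambda>x. g x / q x < 0) F" ..
next
  assume "eventually (\<lambda>x. g x < 0) F"
  then have "eventually (\<lambda>x. g x / q x < 0) F" using assms(2) by eventually_elim (simp add: divide_less_0_iff)
  then show "eventually (\<lambda>x. g x / q x > 0) F \<or> eventually (\<lambda>x. g x / q x < 0) F" ..
qed

text \<open>\<open>P k j\<close> stands for \<open>M_k \<phi>_j\<close>, a triangular table with
  unit entries at \<open>j = k + 1\<close>. The asymptotic relations are assumed at level 0 only;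
  carrying them to the other levels is the task of this locale.\<close>

locale factorized_scale =
  fixes T :: real and x0 :: ereal and n :: nat and q :: "nat \<Rightarrow> real \<Rightarrow> real" and P :: "nat \<Rightarrow> nat \<Rightarrow> real \<Rightarrow> real"
  assumes T: "ereal T < x0"
    and q_pos: "\<And>k x. 1 \<le> k \<Longrightarrow> k < n \<Longrightarrow> x \<in> ival T x0 \<Longrightarrow> q k x > 0"
    and P_chain: "\<And>j. 1 \<le> j \<Longrightarrow> j \<le> n \<Longrightarrow> derivative_chain (ival T x0) q (n - 1) (\<lambda>k. P k j)"
    and P_diag: "\<And>k x. k < n \<Longrightarrow> x \<in> ival T x0 \<Longrightarrow> P k (Suc k) x = 1"
    and P_low: "\<And>k j x. k < n \<Longrightarrow> 1 \<le> j \<Longrightarrow> j \<le> k \<Longrightarrow> x \<in> ival T x0 \<Longrightarrow> P k j x = 0"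
    and P_ratio0: "\<And>j. 1 \<le> j \<Longrightarrow> j < n \<Longrightarrow> ((\<lambda>x. P 0 (Suc j) x / P 0 j x) \<longlongrightarrow> 0) (lfilt x0)"
begin

abbreviation "S \<equiv> ival T x0"
abbreviation "F \<equiv> lfilt x0"

lemma eventually_q_pos: "1 \<le> k \<Longrightarrow> k < n \<Longrightarrow> eventually (\<lambda>x. q k x > 0) F"
  using eventually_lfilt_mem[OF T] by (rule eventually_mono) (rule q_pos)

text \<open>Division by a positive weight and passage to an antiderivative both preserve an
  eventually constant sign: Rolle's argument, iterated.\<close>

lemma eventually_signed_descend:
  assumes G: "derivative_chain S q (n - 1) G" and i: "i < n" "k \<le> i" and s: "eventually_signed F (G i)"
  shows "eventually_signed F (G k)"
  using \<open>k \<le> i\<close>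
proof (induction rule: inc_induct)
  case base
  show ?case by (rule s)
next
  case (step m)
  have m: "m < n - 1" using step i by simp
  have sg: "eventually_signed F (\<lambda>x. G (Suc m) x / q (Suc m) x)"
    by (rule eventually_signed_divide[OF step.IH eventually_q_pos]) (use m in auto)
  show ?case
    by (rule eventually_signed_antiderivative[OF T _ sg]) (rule derivative_chainD[OF G m])
qed

lemma eventually_signed_const: "(\<And>x. x \<in> S \<Longrightarrow> g x = 1) \<Longrightarrow> eventually_signed F g"
  unfolding eventually_signed_def by (intro disjI1 eventually_mono[OF eventually_lfilt_mem[OF T]]) simp

lemma P_signed:
  assumes "k < j" "j \<le> n"
  shows "eventually_signed F (P k j)"
proof (rule eventually_signed_descend[OF P_chain, where i = "j - 1"])
  show "eventually_signed F (P (j - 1) j)"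
    using P_diag[of "j - 1"] assms by (intro eventually_signed_const) simp
qed (use assms in auto)

text \<open>At level \<open>j\<close> the combination becomes 1, since \<open>M_j\<close>
  annihilates \<open>\<phi>_j\<close> and sends \<open>\<phi>_{j+1}\<close> to 1.\<close>

lemma P_combination_signed:
  assumes "k \<le> j" "1 \<le> j" "j < n"
  shows "eventually_signed F (\<lambda>x. P k (Suc j) x - c * P k j x)"
proof -
  have "derivative_chain S q (n - 1) (\<lambda>k x. P k (Suc j) x - (\<Sum>i\<in>{j}. c * P k i x))"
    by (rule derivative_chain_diff_sum) (use assms P_chain in auto)
  then have ch: "derivative_chain S q (n - 1) (\<lambda>k x. P k (Suc j) x - c * P k j x)" by simp
  have "eventually_signed F (\<lambda>x. P j (Suc j) x - c * P j j x)"
    using P_diag[of j] P_low[of j j] assms by (intro eventually_signed_const) simp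
  then show ?thesis
    using eventually_signed_descend[OF ch \<open>j < n\<close> \<open>k \<le> j\<close>] by blast
qed

text \<open>At level \<open>k\<close> the function with index \<open>k + 1\<close> is 1, so the
  first ratio is the next function itself; the later ones follow by multiplying ratios.\<close>

lemma P_tendsto_zero_of_ratios:
  assumes ratio: "\<And>j. k < j \<Longrightarrow> j < n \<Longrightarrow> ((\<lambda>x. P k (Suc j) x / P k j x) \<longlongrightarrow> 0) F"
    and "Suc k < j" "j \<le> n"
  shows "(P k j \<longlongrightarrow> 0) F"
proof -
  have "Suc (Suc k) \<le> j" using assms by simp
  then show ?thesis using \<open>j \<le> n\<close>
  proof (induction j rule: dec_induct)
    case base
    have "((\<lambda>x. P k (Suc (Suc k)) x / P k (Suc k) x) \<longlongrightarrow> 0) F" using base by (intro ratio) auto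
    then show ?case
      by (subst (asm) tendsto_lfilt_cong[OF T, where h = "P k (Suc (Suc k))"]) (use P_diag[of k] base in auto)
  next
    case (step j)
    have "((\<lambda>x. P k (Suc j) x / P k j x * P k j x) \<longlongrightarrow> 0) F"
      using step by (intro tendsto_mult_zero ratio) auto
    moreover have "eventually (\<lambda>x. P k (Suc j) x / P k j x * P k j x = P k (Suc j) x) F"
      by (rule eventually_mono[OF eventually_signed_nonzero[OF P_signed[of k j]]]) (use step in auto)
    ultimately show ?case by (rule Lim_transform_eventually)
  qed
qed

text \<open>The ratios at level \<open>k\<close> force numerator and denominator to tend to 0 there,
  which is the situation the converse of l'Hopital's rule requires. The weight is common to both
  derivatives and cancels.\<close>

lemma P_ratio:
  assumes "k < j" "j < n"
  shows "((\<lambda>x. P k (Suc j) x / P k j x) \<longlongrightarrow> 0) F"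
  using assms
proof (induction k arbitrary: j)
  case 0
  then show ?case using P_ratio0[of j] by simp
next
  case (Suc k)
  have k: "k < n - 1" using Suc.prems by simp
  have lim: "(P k i \<longlongrightarrow> 0) F" if "Suc k < i" "i \<le> n" for i
    using P_tendsto_zero_of_ratios[OF Suc.IH that] by simp
  have qk: "eventually (\<lambda>x. q (Suc k) x > 0) F" using k by (intro eventually_q_pos) auto
  have "((\<lambda>x. (P (Suc k) (Suc j) x / q (Suc k) x) / (P (Suc k) j x / q (Suc k) x)) \<longlongrightarrow> 0) F"
  proof (rule quotient_of_derivatives_tendsto_zero[OF T, where \<psi> = "P k j" and \<eta> = "P k (Suc j)"
        and \<psi>' = "\<lambda>x. P (Suc k) j x / q (Suc k) x" and \<eta>' = "\<lambda>x. P (Suc k) (Suc j) x / q (Suc k) x"])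
    show "(P k j has_real_derivative P (Suc k) j z / q (Suc k) z) (at z within S)" if "z \<in> S" for z
      using derivative_chainD[OF P_chain[of j] k that] Suc.prems by simp
    show "(P k (Suc j) has_real_derivative P (Suc k) (Suc j) z / q (Suc k) z) (at z within S)" if "z \<in> S" for z
      using derivative_chainD[OF P_chain[of "Suc j"] k that] Suc.prems by simp
    show "(P k j \<longlongrightarrow> 0) F" "(P k (Suc j) \<longlongrightarrow> 0) F" using Suc.prems lim by auto
    show "eventually_signed F (\<lambda>x. P (Suc k) j x / q (Suc k) x)"
      using Suc.prems by (intro eventually_signed_divide P_signed qk) auto
    show "eventually_signed F (\<lambda>x. P (Suc k) (Suc j) x / q (Suc k) x - c * (P (Suc k) j x / q (Suc k) x))" for c
    proof -
      have "eventually_signed F (\<lambda>x. (P (Suc k) (Suc j) x - c * P (Suc k) j x) / q (Suc k) x)"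
        using Suc.prems by (intro eventually_signed_divide P_combination_signed qk) auto
      then show ?thesis by (simp add: diff_divide_distrib)
    qed
    show "((\<lambda>x. P k (Suc j) x / P k j x) \<longlongrightarrow> 0) F"
      using Suc.prems by (intro Suc.IH) auto
  qed
  moreover have "eventually (\<lambda>x. (P (Suc k) (Suc j) x / q (Suc k) x) / (P (Suc k) j x / q (Suc k) x) = P (Suc k) (Suc j) x / P (Suc k) j x) F"
    using qk by eventually_elim simp
  ultimately show ?case by (rule Lim_transform_eventually)
qed

lemma P_tendsto:
  assumes "k < n" "1 \<le> j" "j \<le> n"
  shows "(P k j \<longlongrightarrow> (if j = Suc k then 1 else 0)) F"
proof -
  consider "j \<le> k" | "j = Suc k" | "Suc k < j" by linarith
  then show ?thesis
  proof cases
    case 1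
    then show ?thesis
      by (subst tendsto_lfilt_cong[OF T, where h = "\<lambda>_. 0"]) (use P_low assms in auto)
  next
    case 2
    then show ?thesis
      by (subst tendsto_lfilt_cong[OF T, where h = "\<lambda>_. 1"]) (use P_diag assms in auto)
  next
    case 3
    then show ?thesis using P_tendsto_zero_of_ratios[OF P_ratio, of k j] assms by simp
  qed
qed

lemma P_sum_tendsto:
  assumes "k < n" "I \<subseteq> {1..n}"
  shows "((\<lambda>x. \<Sum>j\<in>I. a j * P k j x) \<longlongrightarrow> (if Suc k \<in> I then a (Suc k) else 0)) F"
proof -
  have fin: "finite I" using assms(2) finite_subset by blast
  have "((\<lambda>x. \<Sum>j\<in>I. a j * P k j x) \<longlongrightarrow> (\<Sum>j\<in>I. a j * (if j = Suc k then 1 else 0))) F"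
    using assms by (intro tendsto_sum tendsto_mult tendsto_const P_tendsto) auto
  moreover have "(\<Sum>j\<in>I. a j * (if j = Suc k then 1 else 0)) = (if Suc k \<in> I then a (Suc k) else 0)"
    using fin by (simp add: if_distrib cong: if_cong)
  ultimately show ?thesis by simp
qed

text \<open>The derivative of \<open>P m (Suc (Suc m))\<close> is exactly
  \<open>1 / q (Suc m)\<close>, and this function converges. A bound on \<open>G (Suc m)\<close>
  therefore dominates the derivative of \<open>G m\<close> by that of a convergent function.\<close>

lemma chain_limits_descend:
  assumes G: "derivative_chain S q (n - 1) G" and "i < n" "k \<le> i" and l: "(G i \<longlongrightarrow> l) F"
  shows "\<exists>L. (G k \<longlongrightarrow> L) F"
  using \<open>k \<le> i\<close>
proof (induction rule: inc_induct)
  case base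
  show ?case using l by blast
next
  case (step m)
  have m: "m < n - 1" using step \<open>i < n\<close> by simp
  obtain L where L: "(G (Suc m) \<longlongrightarrow> L) F" using step.IH by blast
  have "eventually (\<lambda>x. \<bar>G (Suc m) x\<bar> < \<bar>L\<bar> + 1) F"
    using tendsto_rabs[OF L] by (rule order_tendstoD) simp
  then have bd: "eventually (\<lambda>x. \<bar>G (Suc m) x / q (Suc m) x\<bar> \<le> (\<bar>L\<bar> + 1) * (P (Suc m) (Suc (Suc m)) x / q (Suc m) x)) F"
    using eventually_lfilt_mem[OF T]
  proof eventually_elim
    case (elim x)
    have "q (Suc m) x > 0" using q_pos[of "Suc m" x] m elim by simp
    moreover have "P (Suc m) (Suc (Suc m)) x = 1" using P_diag[of "Suc m" x] m elim by simp
    ultimately show ?case using elim by (simp add: abs_divide divide_right_mono)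
  qed
  show ?case
  proof (rule convergent_of_dominated_derivative[OF T _ _ _ bd])
    show "(G m has_real_derivative G (Suc m) z / q (Suc m) z) (at z within S)" if "z \<in> S" for z
      by (rule derivative_chainD[OF G m that])
    show "(P m (Suc (Suc m)) has_real_derivative P (Suc m) (Suc (Suc m)) z / q (Suc m) z) (at z within S)" if "z \<in> S" for z
      using derivative_chainD[OF P_chain[of "Suc (Suc m)"] m that] m by simp
    show "(P m (Suc (Suc m)) \<longlongrightarrow> 0) F" using P_tendsto[of m "Suc (Suc m)"] m by simp
  qed
qed

text \<open>L'Hopital's rule, applied downwards from level \<open>i - 1\<close>, where the
  denominator is 1.\<close>

lemma chain_small:
  assumes H: "derivative_chain S q (n - 1) H" and i: "i \<le> n" "k < i" and lim: "\<And>k. k < i \<Longrightarrow> (H k \<longlongrightarrow> 0) F"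
  shows "((\<lambda>x. H k x / P k i x) \<longlongrightarrow> 0) F"
proof -
  have "k \<le> i - 1" using i by simp
  then show ?thesis
  proof (induction rule: inc_induct)
    case base
    have "(H (i - 1) \<longlongrightarrow> 0) F" using i by (intro lim) auto
    then show ?case
      by (subst tendsto_lfilt_cong[OF T, where h = "H (i - 1)"]) (use P_diag[of "i - 1"] i in auto)
  next
    case (step m)
    have m: "m < n - 1" "Suc m < i" using step i by auto
    have qk: "eventually (\<lambda>x. q (Suc m) x > 0) F" using m by (intro eventually_q_pos) auto
    have "eventually (\<lambda>x. H (Suc m) x / P (Suc m) i x = (H (Suc m) x / q (Suc m) x) / (P (Suc m) i x / q (Suc m) x)) F"
      using qk by eventually_elim simp
    with step.IH have quot: "((\<lambda>x. (H (Suc m) x / q (Suc m) x) / (P (Suc m) i x / q (Suc m) x)) \<longlongrightarrow> 0) F"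
      by (rule Lim_transform_eventually)
    show ?case
    proof (rule lhopital_tendsto_zero[OF T, where \<psi> = "P m i" and h = "H m"
          and \<psi>' = "\<lambda>x. P (Suc m) i x / q (Suc m) x" and h' = "\<lambda>x. H (Suc m) x / q (Suc m) x"])
      show "(H m has_real_derivative H (Suc m) z / q (Suc m) z) (at z within S)" if "z \<in> S" for z
        by (rule derivative_chainD[OF H m(1) that])
      show "(H m \<longlongrightarrow> 0) F" using m by (intro lim) simp
      show "(P m i has_real_derivative P (Suc m) i z / q (Suc m) z) (at z within S)" if "z \<in> S" for z
        using derivative_chainD[OF P_chain[of i] m(1) that] m i by simp
      show "(P m i \<longlongrightarrow> 0) F" using P_tendsto[of m i] m i by simp
      show "eventually_signed F (\<lambda>x. P (Suc m) i x / q (Suc m) x)"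
        using m i by (intro eventually_signed_divide P_signed qk) auto
      show "((\<lambda>x. (H (Suc m) x / q (Suc m) x) / (P (Suc m) i x / q (Suc m) x)) \<longlongrightarrow> 0) F"
        by (rule quot)
    qed
  qed
qed

lemma chain_limits_iff_expansion:
  assumes G: "derivative_chain S q (n - 1) G" and i: "1 \<le> i" "i \<le> n"
  shows "(\<forall>k<i. ((\<lambda>x. (G k x - (\<Sum>j=Suc k..i. a j * P k j x)) / P k i x) \<longlongrightarrow> 0) F) \<longleftrightarrow>
    (\<forall>k<i. (G k \<longlongrightarrow> a (Suc k)) F)" (is "?L \<longleftrightarrow> ?R")
proof -
  \<comment> \<open>The sum runs from 1 at every level, so that \<open>?H\<close> is a single chain;
    the terms with \<open>j \<le> k\<close> vanish at level \<open>k\<close>.\<close>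
  let ?H = "\<lambda>k x. G k x - (\<Sum>j=1..i. a j * P k j x)"
  have H: "derivative_chain S q (n - 1) ?H"
    using P_chain i by (intro derivative_chain_diff_sum G) auto
  have sums: "(\<Sum>j=1..i. a j * P k j x) = (\<Sum>j=Suc k..i. a j * P k j x)" if "k < i" "x \<in> S" for k x
    using that i P_low[of k _ x] by (intro sum.mono_neutral_right) auto
  have lims: "((\<lambda>x. \<Sum>j=1..i. a j * P k j x) \<longlongrightarrow> a (Suc k)) F" if "k < i" for k
    using P_sum_tendsto[of k "{1..i}" a] that i by simp
  have cong: "((\<lambda>x. (G k x - (\<Sum>j=Suc k..i. a j * P k j x)) / P k i x) \<longlongrightarrow> 0) F \<longleftrightarrow>
      ((\<lambda>x. ?H k x / P k i x) \<longlongrightarrow> 0) F" if "k < i" for k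
    by (rule tendsto_lfilt_cong[OF T]) (simp only: sums[OF that])
  show ?thesis
  proof
    assume L: ?L
    show ?R
    proof (intro allI impI)
      fix k assume k: "k < i"
      have "((\<lambda>x. ?H k x / P k i x * P k i x) \<longlongrightarrow> 0 * (if i = Suc k then 1 else 0)) F"
        using L cong[OF k] k i by (intro tendsto_mult P_tendsto) auto
      then have "((\<lambda>x. ?H k x / P k i x * P k i x) \<longlongrightarrow> 0) F" by simp
      moreover have "eventually (\<lambda>x. ?H k x / P k i x * P k i x = ?H k x) F"
        by (rule eventually_mono[OF eventually_signed_nonzero[OF P_signed[OF k i(2)]]]) simp
      ultimately have "(?H k \<longlongrightarrow> 0) F" by (rule Lim_transform_eventually)
      from tendsto_add[OF this lims[OF k]] show "(G k \<longlongrightarrow> a (Suc k)) F" by simp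
    qed
  next
    assume R: ?R
    have "(?H k \<longlongrightarrow> 0) F" if "k < i" for k
      using tendsto_diff[OF R[rule_format, OF that] lims[OF that]] by simp
    then show ?L using cong chain_small[OF H i(2)] by blast
  qed
qed

end

section \<open>Iterated improper integrals\<close>

context factorized_scale
begin

lemma impr_conv_iff_antiderivative:
  assumes s: "s \<in> S" and K: "\<And>t. t \<in> S \<Longrightarrow> s \<le> t \<Longrightarrow> (K has_integral B t) {s..t}"
  shows "impr_conv T x0 K s \<longleftrightarrow> (\<exists>l. (B \<longlongrightarrow> l) F)"
    and "(B \<longlongrightarrow> l) F \<Longrightarrow> impr_int x0 K s = l"
proof -
  have int: "integral {s..b} K = B b" if "b \<in> S" "s \<le> b" for b
    using K[OF that] by (rule integral_unique)
  have "eventually (\<lambda>b. integral {s..b} K = B b) F"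
    using eventually_lfilt_ge[OF T s] by (rule eventually_mono) (simp add: int)
  then have lim: "((\<lambda>b. integral {s..b} K) \<longlongrightarrow> l) F \<longleftrightarrow> (B \<longlongrightarrow> l) F" for l
    by (rule tendsto_cong)
  have "K integrable_on {s..b}" if "s \<le> b" "b \<in> S" for b
    using K[OF that(2,1)] by (auto simp: integrable_on_def)
  then show "impr_conv T x0 K s \<longleftrightarrow> (\<exists>l. (B \<longlongrightarrow> l) F)"
    unfolding impr_conv_def using lim by blast
  show "impr_int x0 K s = l" if "(B \<longlongrightarrow> l) F"
    unfolding impr_int_def by (rule tendsto_Lim[OF lfilt_neq_bot[OF T]]) (use lim that in blast)
qed

text \<open>Since \<open>P (k - 1) k = 1\<close>, each constant of integration at \<open>T\<close>
  is a multiple of that function, hence a new term of the subtracted combination. The pointwise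
  formula is claimed for \<open>1 \<le> m\<close> only, because \<open>K 0\<close> is known just
  through its integral.\<close>

lemma iterated_integral_antiderivative:
  assumes G: "derivative_chain S q (n - 1) G"
    and K0: "\<And>t. t \<in> S \<Longrightarrow> (K 0 has_integral G (n - 1) t - G (n - 1) T) {T..t}"
    and KSuc: "\<And>m t. K (Suc m) t = integral {T..t} (K m) / q (n - Suc m) t"
    and "m < n"
  shows "\<exists>c. (\<forall>t\<in>S. (K m has_integral G (n - Suc m) t - (\<Sum>l=n - m..n. c l * P (n - Suc m) l t)) {T..t}) \<and>
    (1 \<le> m \<longrightarrow> (\<forall>t\<in>S. K m t = (G (n - m) t - (\<Sum>l=Suc (n - m)..n. c l * P (n - m) l t)) / q (n - m) t))"
  using \<open>m < n\<close>
proof (induction m)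
  case 0
  have "P (n - 1) n t = 1" if "t \<in> S" for t using P_diag[of "n - 1" t] 0 that by simp
  then show ?case using K0 by (intro exI[of _ "\<lambda>_. G (n - 1) T"]) simp
next
  case (Suc m)
  define k where "k = n - Suc m"
  have k: "n - m = Suc k" "1 \<le> k" "k < n" "n - Suc (Suc m) = k - 1" "Suc (k - 1) = k" "k - 1 < n - 1"
    using Suc.prems by (auto simp: k_def)
  obtain c where c: "\<And>t. t \<in> S \<Longrightarrow> (K m has_integral G k t - (\<Sum>l=Suc k..n. c l * P k l t)) {T..t}"
    using Suc.IH Suc.prems k by (auto simp: k_def)
  define H where "H = (\<lambda>j t. G j t - (\<Sum>l=Suc k..n. c l * P j l t))"
  have H: "derivative_chain S q (n - 1) H"
    unfolding H_def using P_chain by (intro derivative_chain_diff_sum G) auto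
  have KH: "K (Suc m) t = H k t / q k t" if "t \<in> S" for t
    unfolding KSuc using integral_unique[OF c[OF that]] by (simp add: H_def k_def)
  \<comment> \<open>The new constant of integration is recorded as the coefficient of index
    \<open>k\<close>.\<close>
  define c' where "c' = c(k := H (k - 1) T)"
  have c'_sum: "(\<Sum>l=Suc k..n. c' l * P j l t) = (\<Sum>l=Suc k..n. c l * P j l t)" for j t
    by (intro sum.cong) (auto simp: c'_def)
  have "(K (Suc m) has_integral G (k - 1) t - (\<Sum>l=k..n. c' l * P (k - 1) l t)) {T..t}" if t: "t \<in> S" for t
  proof -
    have "T \<le> t" using t by (simp add: ival_def)
    have "((\<lambda>t. H k t / q k t) has_integral H (k - 1) t - H (k - 1) T) {T..t}"
      using derivative_chain_FTC[OF H k(6) order_refl \<open>T \<le> t\<close> t] k(5) by simp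
    moreover have "H (k - 1) t - H (k - 1) T = G (k - 1) t - (\<Sum>l=k..n. c' l * P (k - 1) l t)"
    proof -
      have "P (k - 1) k t = 1" using P_diag[of "k - 1" t] k t by simp
      moreover have "(\<Sum>l=k..n. c' l * P (k - 1) l t) = c' k * P (k - 1) k t + (\<Sum>l=Suc k..n. c' l * P (k - 1) l t)"
        using k(3) by (subst sum.atLeast_Suc_atMost) auto
      moreover have "c' k = H (k - 1) T" by (simp add: c'_def)
      ultimately show ?thesis by (simp add: c'_sum H_def)
    qed
    ultimately have "((\<lambda>t. H k t / q k t) has_integral G (k - 1) t - (\<Sum>l=k..n. c' l * P (k - 1) l t)) {T..t}"
      by simp
    moreover have "H k y / q k y = K (Suc m) y" if "y \<in> {T..t}" for y
      using KH[of y] ival_downward[OF t, of y] that by simp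
    ultimately show ?thesis by (rule has_integral_eq[rotated])
  qed
  moreover have "K (Suc m) t = (G k t - (\<Sum>l=Suc k..n. c' l * P k l t)) / q k t" if "t \<in> S" for t
    using KH[OF that] by (simp add: H_def c'_sum)
  ultimately show ?case
    unfolding k(4) k_def[symmetric] by blast
qed

text \<open>The combination subtracted from \<open>G (i - 1)\<close> has the finite limit
  \<open>c i\<close>, so it does not affect convergence.\<close>

lemma iterated_integral_converges_iff:
  assumes G: "derivative_chain S q (n - 1) G"
    and K0: "\<And>t. t \<in> S \<Longrightarrow> (K 0 has_integral G (n - 1) t - G (n - 1) T) {T..t}"
    and KSuc: "\<And>m t. K (Suc m) t = integral {T..t} (K m) / q (n - Suc m) t"
    and i: "1 \<le> i" "i \<le> n"
  shows "impr_conv T x0 (K (n - i)) T \<longleftrightarrow> (\<exists>l. (G (i - 1) \<longlongrightarrow> l) F)"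
proof -
  have ni: "n - i < n" "n - Suc (n - i) = i - 1" "n - (n - i) = i" using i by auto
  obtain c where c: "\<And>t. t \<in> S \<Longrightarrow> (K (n - i) has_integral G (i - 1) t - (\<Sum>l=i..n. c l * P (i - 1) l t)) {T..t}"
    using iterated_integral_antiderivative[OF G K0 KSuc ni(1)] unfolding ni by blast
  have Psum: "((\<lambda>t. \<Sum>l=i..n. c l * P (i - 1) l t) \<longlongrightarrow> c i) F"
    using P_sum_tendsto[of "i - 1" "{i..n}" c] i by simp
  have "(\<exists>l. ((\<lambda>t. G (i - 1) t - (\<Sum>l=i..n. c l * P (i - 1) l t)) \<longlongrightarrow> l) F) \<longleftrightarrow> (\<exists>l. (G (i - 1) \<longlongrightarrow> l) F)"
  proof
    assume "\<exists>l. ((\<lambda>t. G (i - 1) t - (\<Sum>l=i..n. c l * P (i - 1) l t)) \<longlongrightarrow> l) F"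
    then obtain l where "((\<lambda>t. G (i - 1) t - (\<Sum>l=i..n. c l * P (i - 1) l t)) \<longlongrightarrow> l) F" by blast
    from tendsto_add[OF this Psum] show "\<exists>l. (G (i - 1) \<longlongrightarrow> l) F" by auto
  next
    assume "\<exists>l. (G (i - 1) \<longlongrightarrow> l) F"
    then show "\<exists>l. ((\<lambda>t. G (i - 1) t - (\<Sum>l=i..n. c l * P (i - 1) l t)) \<longlongrightarrow> l) F"
      using tendsto_diff[OF _ Psum] by blast
  qed
  then show ?thesis
    using impr_conv_iff_antiderivative(1)[OF ival_start[OF T] c] by simp
qed

text \<open>The factor \<open>e\<close> will be a power of -1: integrating up to the endpoint gives
  limit minus value, which changes the sign at every level.\<close>

lemma improper_integral_of_chain:
  assumes B: "derivative_chain S q (n - 1) B" and k: "k < n - 1" and lim: "(B k \<longlongrightarrow> \<beta>) F"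
    and L: "\<And>t. t \<in> S \<Longrightarrow> L t = e * (B (Suc k) t / q (Suc k) t)" and s: "s \<in> S"
  shows "impr_conv T x0 L s" and "impr_int x0 L s = e * (\<beta> - B k s)"
proof -
  have "(L has_integral e * (B k t - B k s)) {s..t}" if t: "t \<in> S" "s \<le> t" for t
  proof -
    have "T \<le> s" using s by (simp add: ival_def)
    have "((\<lambda>t. e * (B (Suc k) t / q (Suc k) t)) has_integral e * (B k t - B k s)) {s..t}"
      by (intro has_integral_mult_right derivative_chain_FTC[OF B k \<open>T \<le> s\<close> t(2,1)])
    moreover have "e * (B (Suc k) y / q (Suc k) y) = L y" if "y \<in> {s..t}" for y
      using L[of y] ival_downward[OF t(1), of y] that \<open>T \<le> s\<close> by simp
    ultimately show ?thesis by (rule has_integral_eq[rotated])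
  qed
  note anti = impr_conv_iff_antiderivative[OF s this]
  have "((\<lambda>t. e * (B k t - B k s)) \<longlongrightarrow> e * (\<beta> - B k s)) F" by (intro tendsto_intros lim)
  then show "impr_conv T x0 L s" "impr_int x0 L s = e * (\<beta> - B k s)" using anti by blast+
qed

lemma iterated_improper_integral_converges:
  assumes A: "derivative_chain S q (n - 1) A" and i: "1 \<le> i" "i < n"
    and lim: "\<And>k. k < i \<Longrightarrow> (A k \<longlongrightarrow> \<alpha> k) F"
    and L0: "\<And>t. t \<in> S \<Longrightarrow> L 0 t = A i t / q i t"
    and LSuc: "\<And>d t. L (Suc d) t = impr_int x0 (L d) t / q (i - Suc d) t"
    and "d < i" "s \<in> S"
  shows "impr_conv T x0 (L d) s"
proof -
  \<comment> \<open>After \<open>d\<close> tail integrations the limits at levels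
    \<open>i - d\<close> to \<open>i - 1\<close> have been removed. The limit at level
    \<open>j - 1\<close> is the coefficient of index \<open>j\<close>, so \<open>B d\<close> is
    again a chain.\<close>
  define B where "B = (\<lambda>d k t. A k t - (\<Sum>j=Suc (i - d)..i. \<alpha> (j - 1) * P k j t))"
  have B: "derivative_chain S q (n - 1) (B d)" for d
    unfolding B_def using P_chain i by (intro derivative_chain_diff_sum A) auto
  \<comment> \<open>All subtracted indices exceed \<open>i - d\<close>, whereas only index
    \<open>i - d\<close> has a nonzero limit at level \<open>i - Suc d\<close>; the limit of
    \<open>A\<close> is therefore unchanged.\<close>
  have Blim: "(B d (i - Suc d) \<longlongrightarrow> \<alpha> (i - Suc d)) F" if "d < i" for d
  proof -
    have "((\<lambda>t. \<Sum>j=Suc (i - d)..i. \<alpha> (j - 1) * P (i - Suc d) j t) \<longlongrightarrow> 0) F"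
    proof -
      have "i - Suc d < n" "{Suc (i - d)..i} \<subseteq> {1..n}" "Suc (i - Suc d) \<notin> {Suc (i - d)..i}"
        using that i by auto
      then show ?thesis
        using P_sum_tendsto[of "i - Suc d" "{Suc (i - d)..i}" "\<lambda>j. \<alpha> (j - 1)"] by (simp only: if_False)
    qed
    from tendsto_diff[OF lim[of "i - Suc d"] this] show ?thesis using that by (simp add: B_def)
  qed
  have step: "i - d = Suc (i - Suc d)" if "d < i" for d using that by simp
  have L: "L d t = (-1) ^ d * (B d (i - d) t / q (i - d) t)" if "d < i" "t \<in> S" for d t
    using that
  proof (induction d arbitrary: t)
    case 0
    then show ?case by (simp add: L0 B_def)
  next
    case (Suc d)
    have k: "i - Suc d < n - 1" "i - d = Suc (i - Suc d)" "d < i" using Suc.prems i by auto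
    have "impr_int x0 (L d) t = (-1) ^ d * (\<alpha> (i - Suc d) - B d (i - Suc d) t)"
    proof (rule improper_integral_of_chain(2)[OF B k(1) Blim[OF k(3)] _ Suc.prems(2)])
      show "L d y = (-1) ^ d * (B d (Suc (i - Suc d)) y / q (Suc (i - Suc d)) y)" if "y \<in> S" for y
        using Suc.IH[OF k(3) that] k(2) by simp
    qed
    moreover have "B (Suc d) (i - Suc d) t = B d (i - Suc d) t - \<alpha> (i - Suc d)"
    proof -
      have "(\<Sum>j=Suc (i - Suc d)..i. \<alpha> (j - 1) * P (i - Suc d) j t) =
          \<alpha> (i - Suc d) * P (i - Suc d) (Suc (i - Suc d)) t + (\<Sum>j=Suc (i - d)..i. \<alpha> (j - 1) * P (i - Suc d) j t)"
        using k by (subst sum.atLeast_Suc_atMost) auto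
      then show ?thesis using P_diag[of "i - Suc d" t] i Suc.prems by (simp add: B_def)
    qed
    ultimately have "impr_int x0 (L d) t = (-1) ^ Suc d * B (Suc d) (i - Suc d) t"
      by (simp add: right_diff_distrib)
    then show ?case by (simp add: LSuc)
  qed
  show ?thesis
  proof (rule improper_integral_of_chain(1)[OF B _ Blim[OF \<open>d < i\<close>] _ \<open>s \<in> S\<close>])
    show "i - Suc d < n - 1" using i \<open>d < i\<close> by simp
    show "L d y = (-1) ^ d * (B d (Suc (i - Suc d)) y / q (Suc (i - Suc d)) y)" if "y \<in> S" for y
      using L[OF \<open>d < i\<close> that] step[OF \<open>d < i\<close>] by simp
  qed
qed

end

section \<open>The operators of the canonical factorization\<close>

text \<open>Gives uniqueness of derivatives within the interval, in particular of the one-sided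
  derivative at \<open>T\<close>.\<close>

lemma ival_within_neq_bot:
  assumes "x \<in> ival T x0"
  shows "at x within ival T x0 \<noteq> bot"
proof -
  obtain y where y: "y \<in> ival T x0" "x < y" using ival_no_max[OF assms] by blast
  have "{x..y} \<subseteq> ival T x0" using ival_Icc[OF y(1)] assms by (simp add: ival_def)
  then have "at x within {x..y} \<le> at x within ival T x0" by (rule at_le)
  moreover have "at x within {x..y} \<noteq> bot"
    using y(2) by (simp add: at_within_Icc_at_right trivial_limit_at_right_real)
  ultimately show ?thesis by (metis bot.extremum_uniqueI)
qed

lemma wronsk_closed:
  fixes P :: "(real \<Rightarrow> real) \<Rightarrow> bool"
  assumes "\<And>c. P (\<lambda>_. c)" "\<And>f g. P f \<Longrightarrow> P g \<Longrightarrow> P (\<lambda>y. f y + g y)"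
    "\<And>f g. P f \<Longrightarrow> P g \<Longrightarrow> P (\<lambda>y. f y * g y)"
    "\<And>g r. g \<in> set gs \<Longrightarrow> r < length gs \<Longrightarrow> P (hder S r g)"
  shows "P (wronsk S gs)"
  unfolding wronsk_det[abs_def] by (rule det_closed) (auto intro: assms)

lemma wronsk_singleton: "wronsk S [u] x = u x"
  using wronsk_snoc[of S \<phi> 0 u x] by (simp add: last_row_cofactor_def hder_def)

lemma Wi_0: "Wi S \<phi> 0 x = 1"
  by (simp add: Wi_det)

lemma Wi_1: "Wi S \<phi> 1 x = \<phi> 1 x"
  by (simp add: Wi_def wronsk_singleton)

text \<open>The weight \<open>W_{k+1}^2 / (W_k W_{k+2})\<close> is precisely the factor that turns
  the derivative of one Wronskian quotient into the next quotient.\<close>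

lemma Mop_wronsk:
  assumes d\<phi>: "\<And>j r x. j \<in> {1..n} \<Longrightarrow> r < n - 1 \<Longrightarrow> x \<in> ival T x0 \<Longrightarrow>
      (hder (ival T x0) r (\<phi> j) has_real_derivative hder (ival T x0) (Suc r) (\<phi> j) x) (at x within ival T x0)"
    and du: "\<And>r x. r < n - 1 \<Longrightarrow> x \<in> ival T x0 \<Longrightarrow>
      (hder (ival T x0) r u has_real_derivative hder (ival T x0) (Suc r) u x) (at x within ival T x0)"
    and W: "\<And>j x. j \<in> {1..n} \<Longrightarrow> x \<in> ival T x0 \<Longrightarrow> Wi (ival T x0) \<phi> j x > 0"
    and "k < n" "x \<in> ival T x0"
  shows "Mop (ival T x0) \<phi> n k u x = wronsk (ival T x0) (map \<phi> [1..<Suc k] @ [u]) x / Wi (ival T x0) \<phi> (Suc k) x"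
    and "k < n - 1 \<Longrightarrow> (Mop (ival T x0) \<phi> n k u has_real_derivative
      Mop (ival T x0) \<phi> n (Suc k) u x / qw (ival T x0) \<phi> n (Suc k) x) (at x within ival T x0)"
proof -
  let ?S = "ival T x0"
  let ?R = "\<lambda>k x. wronsk ?S (map \<phi> [1..<Suc k] @ [u]) x / Wi ?S \<phi> (Suc k) x"
  have W': "Wi ?S \<phi> j x > 0" if "j \<le> n" "x \<in> ?S" for j x
    using W[of j x] that by (cases "j = 0") (auto simp: Wi_0)
  have R: "(?R k has_real_derivative Wi ?S \<phi> k x * wronsk ?S (map \<phi> [1..<Suc (Suc k)] @ [u]) x / (Wi ?S \<phi> (Suc k) x)\<^sup>2) (at x within ?S)"
    if "k < n - 1" "x \<in> ?S" for k x
  proof (rule wronsk_quotient_derivative[OF that(2) ival_within_neq_bot[OF that(2)]])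
    show "Wi ?S \<phi> (Suc k) y \<noteq> 0" if "y \<in> ?S" for y
    proof -
      have "Suc k \<le> n" using \<open>k < n - 1\<close> by linarith
      from W'[OF this that] show ?thesis by simp
    qed
  qed (use d\<phi> du that in auto)
  \<comment> \<open>The formula at level \<open>k\<close> is assumed on the whole interval, since
    differentiating it at \<open>x\<close> uses nearby points. The step serves both the induction
    and the derivative claim.\<close>
  have M: "Mop ?S \<phi> n k u x = ?R k x \<and> (k < n - 1 \<longrightarrow> (Mop ?S \<phi> n k u has_real_derivative
      Mop ?S \<phi> n (Suc k) u x / qw ?S \<phi> n (Suc k) x) (at x within ?S)) \<and>
      (k < n - 1 \<longrightarrow> Mop ?S \<phi> n (Suc k) u x = ?R (Suc k) x)"
    if "k < n" "x \<in> ?S" and Meq: "\<And>x. x \<in> ?S \<Longrightarrow> Mop ?S \<phi> n k u x = ?R k x" for k x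
  proof -
    have "(Mop ?S \<phi> n k u has_real_derivative Mop ?S \<phi> n (Suc k) u x / qw ?S \<phi> n (Suc k) x) (at x within ?S)
      \<and> Mop ?S \<phi> n (Suc k) u x = ?R (Suc k) x" if k: "k < n - 1"
    proof -
      define D where "D = Wi ?S \<phi> k x * wronsk ?S (map \<phi> [1..<Suc (Suc k)] @ [u]) x / (Wi ?S \<phi> (Suc k) x)\<^sup>2"
      have D: "(Mop ?S \<phi> n k u has_vector_derivative D) (at x within ?S)"
        by (rule has_vector_derivative_transform[OF \<open>x \<in> ?S\<close> Meq])
          (use R[OF k \<open>x \<in> ?S\<close>] in \<open>simp_all add: D_def has_real_derivative_iff_has_vector_derivative del: upt_Suc\<close>)
      then have "dS ?S (Mop ?S \<phi> n k u) x = D"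
        unfolding dS_def by (rule vector_derivative_within[OF ival_within_neq_bot[OF \<open>x \<in> ?S\<close>]])
      then have MD: "Mop ?S \<phi> n (Suc k) u x = qw ?S \<phi> n (Suc k) x * D" by simp
      have Wp: "Wi ?S \<phi> k x > 0" "Wi ?S \<phi> (Suc k) x > 0" "Wi ?S \<phi> (Suc (Suc k)) x > 0"
        using W'[OF _ \<open>x \<in> ?S\<close>] k by auto
      have "Suc k < n" using k by linarith
      with Wp have q: "qw ?S \<phi> n (Suc k) x = (Wi ?S \<phi> (Suc k) x)\<^sup>2 / (Wi ?S \<phi> k x * Wi ?S \<phi> (Suc (Suc k)) x)"
        by (simp add: qw_def abs_mult)
      then have "qw ?S \<phi> n (Suc k) x \<noteq> 0" using Wp by simp
      then have "Mop ?S \<phi> n (Suc k) u x / qw ?S \<phi> n (Suc k) x = D" unfolding MD by simp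
      moreover have "Mop ?S \<phi> n (Suc k) u x = ?R (Suc k) x"
        unfolding MD q D_def using Wp by (simp del: upt_Suc)
      ultimately show ?thesis using D by (simp only: has_real_derivative_iff_has_vector_derivative simp_thms)
    qed
    then show ?thesis using Meq[OF \<open>x \<in> ?S\<close>] by blast
  qed
  have Meq: "Mop ?S \<phi> n k u x = ?R k x" if "k < n" "x \<in> ?S" for k x
    using that
  proof (induction k arbitrary: x)
    case 0
    then have "\<phi> 1 x > 0" using W[of 1 x] Wi_1 by simp
    then show ?case using Wi_1[of ?S \<phi> x] by (simp add: qw_def wronsk_singleton)
  next
    case (Suc k)
    then show ?case using M[of k x] Suc.IH by simp
  qed
  show "Mop ?S \<phi> n k u x = ?R k x" using Meq \<open>k < n\<close> \<open>x \<in> ?S\<close> by blast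
  show "(Mop ?S \<phi> n k u has_real_derivative Mop ?S \<phi> n (Suc k) u x / qw ?S \<phi> n (Suc k) x) (at x within ?S)"
    if "k < n - 1" using M[OF \<open>k < n\<close> \<open>x \<in> ?S\<close> Meq] that \<open>k < n\<close> by blast
qed

section \<open>The top level: derivatives almost everywhere\<close>

lemma ACk_derivative:
  "ACk S k g \<Longrightarrow> r < k \<Longrightarrow> x \<in> S \<Longrightarrow> (hder S r g has_real_derivative hder S (Suc r) g x) (at x within S)"
  by (simp add: ACk_def)

lemma ACk_abs_cont:
  assumes g: "ACk S k g" and "r \<le> k" and ab: "a \<le> b" "{a..b} \<subseteq> S"
  shows "abs_cont_on a b (hder S r g)"
proof -
  have top: "abs_cont_on a b (hder S k g)" using g ab by (simp add: ACk_def)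
  have der: "(hder S r g has_real_derivative hder S (Suc r) g x) (at x within {a..b})" if "r < k" "x \<in> {a..b}" for r x
    using ACk_derivative[OF g that(1)] ab(2) that(2) by (meson DERIV_subset subsetD)
  have cont: "continuous_on {a..b} (hder S r g)" if "r \<le> k" for r
  proof (cases "r = k")
    case True
    then show ?thesis using abs_cont_on_continuous[OF top] by simp
  next
    case False
    then show ?thesis using der[of r] that by (intro DERIV_continuous_on) auto
  qed
  show ?thesis
  proof (cases "r = k")
    case True
    then show ?thesis using top by simp
  next
    case False
    then show ?thesis using \<open>r \<le> k\<close> by (intro abs_cont_on_C1[OF der cont]) auto
  qed
qed

text \<open>\<open>hder\<close> rests on \<open>vector_derivative\<close>, which is the true
  derivative wherever one exists and unspecified elsewhere; almost everywhere existence is thus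
  enough to identify it.\<close>

lemma ACk_ae_derivative:
  assumes g: "ACk (ival T x0) k g" and t: "t \<in> ival T x0"
  obtains N where "negligible N" "\<And>x. x \<in> {T<..<t} - N \<Longrightarrow>
    (hder (ival T x0) k g has_real_derivative hder (ival T x0) (Suc k) g x) (at x within ival T x0)"
proof -
  let ?S = "ival T x0"
  have "T \<le> t" using t by (simp add: ival_def)
  then have "abs_cont_on T t (hder ?S k g)"
    using ACk_abs_cont[OF g order_refl] ival_Icc[OF t] by simp
  then obtain N where N: "negligible N" "\<And>x. x \<in> {T<..<t} - N \<Longrightarrow> \<exists>D. (hder ?S k g has_real_derivative D) (at x)"
    by (rule abs_cont_on_ae_differentiable) (rule that)
  have "(hder ?S k g has_real_derivative hder ?S (Suc k) g x) (at x within ?S)" if x: "x \<in> {T<..<t} - N" for x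
  proof -
    obtain D where "(hder ?S k g has_real_derivative D) (at x)" using N(2)[OF x] by blast
    then have D: "(hder ?S k g has_vector_derivative D) (at x within ?S)"
      by (simp add: has_real_derivative_iff_has_vector_derivative has_vector_derivative_at_within)
    have "x \<in> ?S" using ival_downward[OF t, of x] x by simp
    then have "hder ?S (Suc k) g x = D"
      using vector_derivative_within[OF ival_within_neq_bot D] by (simp add: hder_def dS_def)
    then show ?thesis using D by (simp add: has_real_derivative_iff_has_vector_derivative)
  qed
  with N(1) show ?thesis using that by blast
qed

text \<open>Off a null set, the derivative of \<open>M_{n-1} f\<close> is
  \<open>W_{n-1} W(\<phi>_1, ..., \<phi>_n, f) / W_n^2\<close>, which is \<open>L f / q_n\<close>
  because \<open>q_n = W_n / W_{n-1}\<close>. Absolute continuity of \<open>M_{n-1} f\<close> makes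
  this an integral identity.\<close>

lemma Kaux_0_has_integral:
  assumes "n \<ge> 1"
    and \<phi>AC: "\<And>j. j \<in> {1..n} \<Longrightarrow> ACk (ival T x0) (n - 1) (\<phi> j)" and fAC: "ACk (ival T x0) (n - 1) f"
    and W: "\<And>j x. j \<in> {1..n} \<Longrightarrow> x \<in> ival T x0 \<Longrightarrow> Wi (ival T x0) \<phi> j x > 0"
    and t: "t \<in> ival T x0"
  shows "(Kaux T (ival T x0) \<phi> n f 0 has_integral
    Mop (ival T x0) \<phi> n (n - 1) f t - Mop (ival T x0) \<phi> n (n - 1) f T) {T..t}"
proof -
  let ?S = "ival T x0"
  let ?R = "\<lambda>x. wronsk ?S (map \<phi> [1..<n] @ [f]) x / Wi ?S \<phi> n x"
  have "T \<le> t" and sub: "{T..t} \<subseteq> ?S" using t ival_Icc by (auto simp: ival_def)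
  then have TS: "T \<in> ?S" by auto
  have n: "Suc (n - 1) = n" using \<open>n \<ge> 1\<close> by simp
  have M: "Mop ?S \<phi> n (n - 1) f x = ?R x" if "x \<in> ?S" for x
    using Mop_wronsk(1)[of n T x0 \<phi> f "n - 1" x] ACk_derivative[OF \<phi>AC] ACk_derivative[OF fAC] W that \<open>n \<ge> 1\<close> n
    by simp
  \<comment> \<open>Wronskians of at most \<open>n\<close> of these functions contain derivatives up
    to order \<open>n - 1\<close> only, all of them absolutely continuous.\<close>
  have ac: "abs_cont_on T t (wronsk ?S gs)" if "set gs \<subseteq> insert f (\<phi> ` {1..n})" "length gs \<le> n" for gs
  proof (rule wronsk_closed[OF abs_cont_on_const abs_cont_on_add abs_cont_on_mult])
    fix g r assume "g \<in> set gs" "r < length gs"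
    then have "ACk ?S (n - 1) g" "r \<le> n - 1" using that \<phi>AC fAC by auto
    then show "abs_cont_on T t (hder ?S r g)" using ACk_abs_cont \<open>T \<le> t\<close> sub by blast
  qed
  have "abs_cont_on T t (\<lambda>x. wronsk ?S (map \<phi> [1..<n] @ [f]) x * inverse (Wi ?S \<phi> n x))"
  proof (intro abs_cont_on_mult abs_cont_on_inverse)
    show "abs_cont_on T t (wronsk ?S (map \<phi> [1..<n] @ [f]))" using \<open>n \<ge> 1\<close> by (intro ac) auto
    show "abs_cont_on T t (Wi ?S \<phi> n)" unfolding Wi_def by (intro ac) (auto simp del: upt_Suc)
    show "Wi ?S \<phi> n x > 0" if "x \<in> {T..t}" for x using W[of n x] sub that \<open>n \<ge> 1\<close> by auto
  qed
  then have R_ac: "abs_cont_on T t ?R" by (simp add: divide_inverse)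
  have "\<exists>N. negligible N \<and> (\<forall>x\<in>{T<..<t} - N. (hder ?S (n - 1) g has_real_derivative hder ?S n g x) (at x within ?S))"
    if "ACk ?S (n - 1) g" for g
    using ACk_ae_derivative[OF that t] n by metis
  then obtain N where N: "\<And>g. ACk ?S (n - 1) g \<Longrightarrow> negligible (N g)"
    "\<And>g x. ACk ?S (n - 1) g \<Longrightarrow> x \<in> {T<..<t} - N g \<Longrightarrow> (hder ?S (n - 1) g has_real_derivative hder ?S n g x) (at x within ?S)"
    by metis
  \<comment> \<open>A finite union: the Wronskian quotient is differentiable wherever the top
    derivatives of \<open>f\<close> and of all the \<open>\<phi>_j\<close> are.\<close>
  let ?N = "N f \<union> (\<Union>j\<in>{1..n}. N (\<phi> j))"
  have "(Kaux T ?S \<phi> n f 0 has_integral ?R t - ?R T) {T..t}"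
  proof (rule abs_cont_on_has_integral_derivative[OF R_ac \<open>T \<le> t\<close>])
    show "negligible ?N" using N(1) \<phi>AC fAC by (auto intro!: negligible_Union)
    fix x assume x: "x \<in> {T<..<t} - ?N"
    then have xS: "x \<in> ?S" using sub by auto
    have der: "(hder ?S r g has_real_derivative hder ?S (Suc r) g x) (at x within ?S)"
      if "ACk ?S (n - 1) g" "x \<notin> N g" "r \<le> n - 1" for g r
      using ACk_derivative[OF that(1) _ xS, of r] N(2)[OF that(1), of x] that x n by (cases "r = n - 1") auto
    have "((\<lambda>y. wronsk ?S (map \<phi> [1..<Suc (n - 1)] @ [f]) y / Wi ?S \<phi> (Suc (n - 1)) y) has_real_derivative
        Wi ?S \<phi> (n - 1) x * wronsk ?S (map \<phi> [1..<Suc (Suc (n - 1))] @ [f]) x / (Wi ?S \<phi> (Suc (n - 1)) x)\<^sup>2) (at x within ?S)"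
    proof (rule wronsk_quotient_derivative[OF xS ival_within_neq_bot[OF xS]])
      show "Wi ?S \<phi> (Suc (n - 1)) y \<noteq> 0" if "y \<in> ?S" for y using W[of n y] that \<open>n \<ge> 1\<close> by simp
    qed (use x n in \<open>auto intro!: der \<phi>AC fAC\<close>)
    moreover have "Wi ?S \<phi> (n - 1) x * wronsk ?S (map \<phi> [1..<Suc n] @ [f]) x / (Wi ?S \<phi> n x)\<^sup>2 = Kaux T ?S \<phi> n f 0 x"
    proof -
      have "Wi ?S \<phi> n x > 0" "Wi ?S \<phi> (n - 1) x > 0"
        using W[of n x] W[of "n - 1" x] xS \<open>n \<ge> 1\<close> by (cases "n = 1"; auto simp: Wi_0)+
      then show ?thesis using \<open>n \<ge> 1\<close> by (simp add: Lop_def qw_def power2_eq_square del: upt_Suc)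
    qed
    ultimately have "(?R has_real_derivative Kaux T ?S \<phi> n f 0 x) (at x within ?S)"
      unfolding n by simp
    moreover have "at x within ?S = at x"
    proof (rule at_within_interior)
      have "{T<..<t} \<subseteq> ?S" using sub by auto
      then show "x \<in> interior ?S" using x interior_maximal[OF _ open_greaterThanLessThan] by blast
    qed
    ultimately show "(?R has_real_derivative Kaux T ?S \<phi> n f 0 x) (at x)" by simp
  qed
  then show ?thesis by (simp only: M[OF t] M[OF TS])
qed

text \<open>The expansion at level 0 is stated for \<open>f\<close> itself instead of
  \<open>M_0 f\<close>, so this level has to be split off.\<close>

lemma all_less_iff_zero_and_rest:
  fixes i :: nat
  assumes "1 \<le> i"
  shows "(\<forall>k<i. R k) \<longleftrightarrow> R 0 \<and> (\<forall>k\<in>{1..i - 1}. R k)"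
proof -
  have "k < i \<longleftrightarrow> k = 0 \<or> k \<in> {1..i - 1}" for k using assms by auto
  then have "{..<i} = insert 0 {1..i - 1}" by blast
  then have "(\<forall>k\<in>{..<i}. R k) \<longleftrightarrow> R 0 \<and> (\<forall>k\<in>{1..i - 1}. R k)" by (simp only: ball_simps)
  then show ?thesis by (simp only: Ball_def lessThan_iff)
qed

theorem theorem5p2:
  fixes T :: real and x0 :: ereal and n :: nat
    and \<phi> :: "nat \<Rightarrow> real \<Rightarrow> real" and f :: "real \<Rightarrow> real"
  defines "S \<equiv> ival T x0" and "F \<equiv> lfilt x0"
  assumes Tx0: "ereal T < x0"
    and n2: "n \<ge> 2"
    and scale: "cheb_scale T x0 n \<phi>"
    and \<phi>AC: "\<forall>i\<in>{1..n}. ACk S (n - 1) (\<phi> i)"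
    and Wpos: "\<forall>i\<in>{1..n}. \<forall>x\<in>S. Wi S \<phi> i x > 0"
    and fAC: "ACk S (n - 1) f"
  shows
    "(\<forall>i\<in>{2..n - 1}.
        (\<forall>a :: nat \<Rightarrow> real.
           (((\<lambda>x. f x - (\<Sum>j=1..i. a j * \<phi> j x)) \<in> o[F](\<phi> i)) \<and>
            (\<forall>k\<in>{1..i - 1}.
               (\<lambda>x. Mop S \<phi> n k f x - (\<Sum>j=k+1..i. a j * Mop S \<phi> n k (\<phi> j) x))
                 \<in> o[F](Mop S \<phi> n k (\<phi> i))))
           \<longleftrightarrow> (\<forall>k<i. (Mop S \<phi> n k f \<longlongrightarrow> a (Suc k)) F)) \<and>
        ((\<exists>a :: nat \<Rightarrow> real. \<forall>k<i. (Mop S \<phi> n k f \<longlongrightarrow> a (Suc k)) F)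
           \<longleftrightarrow> (\<exists>l. (Mop S \<phi> n (i - 1) f \<longlongrightarrow> l) F)) \<and>
        ((\<exists>l. (Mop S \<phi> n (i - 1) f \<longlongrightarrow> l) F)
           \<longleftrightarrow> impr_conv T x0 (Kf T S \<phi> n f i) T) \<and>
        (impr_conv T x0 (Kf T S \<phi> n f i) T \<longrightarrow> iter_conv T x0 \<phi> n f i))
     \<and>
     ((\<exists>a1. (\<lambda>x. f x - a1 * \<phi> 1 x) \<in> o[F](\<phi> 1))
        \<longleftrightarrow> impr_conv T x0 (Kf T S \<phi> n f 1) T)"
proof -
  let ?M = "Mop S \<phi> n"
  let ?q = "qw S \<phi> n"
  have W: "Wi (ival T x0) \<phi> j x > 0" if "j \<in> {1..n}" "x \<in> ival T x0" for j x
    using Wpos that unfolding S_def by blast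
  have AC: "ACk (ival T x0) (n - 1) (\<phi> j)" if "j \<in> {1..n}" for j
    using \<phi>AC that unfolding S_def by blast
  have fAC': "ACk (ival T x0) (n - 1) f" using fAC unfolding S_def .
  have W': "Wi (ival T x0) \<phi> j x > 0" if "j \<le> n" "x \<in> ival T x0" for j x
    using W[of j x] that by (cases "j = 0") (auto simp: Wi_0)
  have Mop_formula: "?M k u x = wronsk S (map \<phi> [1..<Suc k] @ [u]) x / Wi S \<phi> (Suc k) x"
    if "ACk (ival T x0) (n - 1) u" "k < n" "x \<in> ival T x0" for u k x
    unfolding S_def using Mop_wronsk(1)[OF ACk_derivative[OF AC] ACk_derivative[OF that(1)] W that(2,3)] by blast
  have Mop_chain: "derivative_chain (ival T x0) ?q (n - 1) (\<lambda>k. ?M k u)" if "ACk (ival T x0) (n - 1) u" for u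
    unfolding derivative_chain_def S_def
    using Mop_wronsk(2)[OF ACk_derivative[OF AC] ACk_derivative[OF that] W] by auto
  have q0: "?q 0 x > 0" and \<phi>1: "\<phi> 1 x > 0" if "x \<in> ival T x0" for x
    using W[of 1 x] n2 that Wi_1[of S \<phi> x] by (auto simp: qw_def S_def)
  interpret factorized_scale T x0 n ?q "\<lambda>k j. ?M k (\<phi> j)"
  proof
    show "ereal T < x0" by (rule Tx0)
    show "?q k x > 0" if "1 \<le> k" "k < n" "x \<in> ival T x0" for k x
    proof -
      have "Wi S \<phi> (k - 1) x > 0" "Wi S \<phi> k x > 0" "Wi S \<phi> (k + 1) x > 0"
        unfolding S_def using that by (auto intro!: W')
      then show ?thesis using that by (simp add: qw_def abs_mult)
    qed
    show "derivative_chain (ival T x0) ?q (n - 1) (\<lambda>k. ?M k (\<phi> j))" if "1 \<le> j" "j \<le> n" for j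
      using that by (intro Mop_chain AC) simp
    show "?M k (\<phi> (Suc k)) x = 1" if "k < n" "x \<in> ival T x0" for k x
      using Mop_formula[OF AC that, of "Suc k"] that W'[of "Suc k" x]
      by (simp add: wronsk_snoc_next S_def del: upt_Suc One_nat_def)
    show "?M k (\<phi> j) x = 0" if "k < n" "1 \<le> j" "j \<le> k" "x \<in> ival T x0" for k j x
      using Mop_formula[OF AC that(1,4), of j] that wronsk_snoc_repeated[OF that(2,3)]
      by (simp del: upt_Suc One_nat_def)
    show "((\<lambda>x. ?M 0 (\<phi> (Suc j)) x / ?M 0 (\<phi> j) x) \<longlongrightarrow> 0) (lfilt x0)" if "1 \<le> j" "j < n" for j
    proof (subst tendsto_lfilt_cong[OF Tx0])
      show "?M 0 (\<phi> (Suc j)) x / ?M 0 (\<phi> j) x = \<phi> (Suc j) x / \<phi> j x" if "x \<in> ival T x0" for x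
        using q0[OF that] by simp
      show "((\<lambda>x. \<phi> (Suc j) x / \<phi> j x) \<longlongrightarrow> 0) (lfilt x0)"
        using scale that by (simp add: cheb_scale_def)
    qed
  qed
  note f_chain = Mop_chain[OF fAC']
  have K0: "(Kaux T S \<phi> n f 0 has_integral ?M (n - 1) f t - ?M (n - 1) f T) {T..t}" if "t \<in> ival T x0" for t
    unfolding S_def using Kaux_0_has_integral[OF _ AC fAC' W that] n2 by simp
  have KSuc: "Kaux T S \<phi> n f (Suc m) t = integral {T..t} (Kaux T S \<phi> n f m) / ?q (n - Suc m) t" for m t
    by simp
  have conv_iff: "impr_conv T x0 (Kf T S \<phi> n f i) T \<longleftrightarrow> (\<exists>l. (?M (i - 1) f \<longlongrightarrow> l) F)" if "1 \<le> i" "i \<le> n" for i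
    unfolding Kf_def F_def using iterated_integral_converges_iff[OF f_chain K0 KSuc that] by simp
  \<comment> \<open>\<open>M_0\<close> is multiplication by the nonvanishing \<open>q_0\<close>,
    which cancels in the quotient.\<close>
  have M0_quot: "((\<lambda>x. (f x - (\<Sum>j=1..i. a j * \<phi> j x)) / \<phi> i x) \<longlongrightarrow> 0) F \<longleftrightarrow>
      ((\<lambda>x. (?M 0 f x - (\<Sum>j=Suc 0..i. a j * ?M 0 (\<phi> j) x)) / ?M 0 (\<phi> i) x) \<longlongrightarrow> 0) F" for i a
    unfolding F_def
  proof (rule tendsto_lfilt_cong[OF Tx0])
    fix x assume "x \<in> ival T x0"
    then have q: "?q 0 x \<noteq> 0" using q0 by force
    have "(\<Sum>j=Suc 0..i. a j * ?M 0 (\<phi> j) x) = ?q 0 x * (\<Sum>j=1..i. a j * \<phi> j x)"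
      by (simp add: sum_distrib_left mult_ac)
    then show "(f x - (\<Sum>j=1..i. a j * \<phi> j x)) / \<phi> i x =
        (?M 0 f x - (\<Sum>j=Suc 0..i. a j * ?M 0 (\<phi> j) x)) / ?M 0 (\<phi> i) x"
      using q by (simp add: right_diff_distrib[symmetric])
  qed
  have smallo_iff: "g \<in> o[F](h) \<longleftrightarrow> ((\<lambda>x. g x / h x) \<longlongrightarrow> 0) F" if "eventually (\<lambda>x. h x \<noteq> 0) F" for g h :: "real \<Rightarrow> real"
    using smalloI_tendsto[OF _ that] smalloD_tendsto by blast
  have \<phi>_nz: "eventually (\<lambda>x. \<phi> i x \<noteq> 0) F" if "i \<in> {1..n}" for i
    using scale that by (simp add: cheb_scale_def F_def)
  have M_nz: "eventually (\<lambda>x. ?M k (\<phi> i) x \<noteq> 0) F" if "k < i" "i \<le> n" for k i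
    unfolding F_def by (rule eventually_signed_nonzero[OF P_signed[OF that]])
  have expansion: "(((\<lambda>x. f x - (\<Sum>j=1..i. a j * \<phi> j x)) \<in> o[F](\<phi> i)) \<and>
        (\<forall>k\<in>{1..i - 1}. (\<lambda>x. ?M k f x - (\<Sum>j=k+1..i. a j * ?M k (\<phi> j) x)) \<in> o[F](?M k (\<phi> i))))
      \<longleftrightarrow> (\<forall>k<i. (?M k f \<longlongrightarrow> a (Suc k)) F)" if i: "1 \<le> i" "i \<le> n" for i and a :: "nat \<Rightarrow> real"
  proof -
    let ?Q = "\<lambda>k. ((\<lambda>x. (?M k f x - (\<Sum>j=Suc k..i. a j * ?M k (\<phi> j) x)) / ?M k (\<phi> i) x) \<longlongrightarrow> 0) F"
    have Q0: "((\<lambda>x. f x - (\<Sum>j=1..i. a j * \<phi> j x)) \<in> o[F](\<phi> i)) \<longleftrightarrow> ?Q 0"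
      using smallo_iff[OF \<phi>_nz] M0_quot i by simp
    have Qk: "((\<lambda>x. ?M k f x - (\<Sum>j=k+1..i. a j * ?M k (\<phi> j) x)) \<in> o[F](?M k (\<phi> i))) \<longleftrightarrow> ?Q k" if "k \<in> {1..i - 1}" for k
    proof -
      have "k < i" using that i by auto
      from smallo_iff[OF M_nz[OF this i(2)]] show ?thesis by simp
    qed
    have "(((\<lambda>x. f x - (\<Sum>j=1..i. a j * \<phi> j x)) \<in> o[F](\<phi> i)) \<and>
        (\<forall>k\<in>{1..i - 1}. (\<lambda>x. ?M k f x - (\<Sum>j=k+1..i. a j * ?M k (\<phi> j) x)) \<in> o[F](?M k (\<phi> i))))
      \<longleftrightarrow> ?Q 0 \<and> (\<forall>k\<in>{1..i - 1}. ?Q k)"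
      by (intro arg_cong2[where f = "(\<and>)"] ball_cong Q0 Qk refl)
    also have "\<dots> \<longleftrightarrow> (\<forall>k<i. ?Q k)"
      by (rule all_less_iff_zero_and_rest[OF i(1), where R = ?Q, symmetric])
    also have "\<dots> \<longleftrightarrow> (\<forall>k<i. (?M k f \<longlongrightarrow> a (Suc k)) F)"
      unfolding F_def by (rule chain_limits_iff_expansion[OF f_chain i])
    finally show ?thesis .
  qed
  have limits_iff: "(\<exists>a :: nat \<Rightarrow> real. \<forall>k<i. (?M k f \<longlongrightarrow> a (Suc k)) F) \<longleftrightarrow> (\<exists>l. (?M (i - 1) f \<longlongrightarrow> l) F)"
    if i: "1 \<le> i" "i \<le> n" for i
  proof
    assume "\<exists>a :: nat \<Rightarrow> real. \<forall>k<i. (?M k f \<longlongrightarrow> a (Suc k)) F"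
    moreover have "i - 1 < i" using i by simp
    ultimately show "\<exists>l. (?M (i - 1) f \<longlongrightarrow> l) F" by blast
  next
    assume "\<exists>l. (?M (i - 1) f \<longlongrightarrow> l) F"
    then obtain l where "(?M (i - 1) f \<longlongrightarrow> l) F" by blast
    then have "\<exists>L. (?M k f \<longlongrightarrow> L) F" if "k < i" for k
      unfolding F_def using chain_limits_descend[OF f_chain, of "i - 1" k l] that i by simp
    then obtain L where "\<And>k. k < i \<Longrightarrow> (?M k f \<longlongrightarrow> L k) F" by metis
    then show "\<exists>a :: nat \<Rightarrow> real. \<forall>k<i. (?M k f \<longlongrightarrow> a (Suc k)) F"
      by (intro exI[of _ "\<lambda>j. L (j - 1)"]) simp
  qed
  have iterated: "iter_conv T x0 \<phi> n f i" if i: "1 \<le> i" "i < n" and conv: "impr_conv T x0 (Kf T S \<phi> n f i) T" for i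
  proof -
    have ni: "n - i < n" "n - (n - i) = i" "1 \<le> n - i" using i by auto
    \<comment> \<open>The pointwise formula requires \<open>n - i \<ge> 1\<close>, which is why
      \<open>i < n\<close> is assumed.\<close>
    obtain c where c: "\<And>t. t \<in> ival T x0 \<Longrightarrow>
        Kaux T S \<phi> n f (n - i) t = (?M i f t - (\<Sum>l=Suc i..n. c l * ?M i (\<phi> l) t)) / ?q i t"
      using iterated_integral_antiderivative[OF f_chain K0 KSuc ni(1)] ni by auto
    \<comment> \<open>\<open>f\<close> corrected by the terms that the integrations from
      \<open>T\<close> produce. Their indices exceed \<open>i\<close>, so they tend to 0 at all
      levels below \<open>i\<close>, where \<open>A\<close> and \<open>f\<close> have the same
      limits.\<close>
    define A where "A = (\<lambda>k t. ?M k f t - (\<Sum>l=Suc i..n. c l * ?M k (\<phi> l) t))"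
    have A: "derivative_chain (ival T x0) ?q (n - 1) A"
      unfolding A_def using P_chain by (intro derivative_chain_diff_sum f_chain) auto
    obtain a where a: "\<And>k. k < i \<Longrightarrow> (?M k f \<longlongrightarrow> a (Suc k)) F"
      using conv conv_iff[of i] limits_iff[of i] i by auto
    have lim: "(A k \<longlongrightarrow> a (Suc k)) (lfilt x0)" if "k < i" for k
    proof -
      have "((\<lambda>t. \<Sum>l=Suc i..n. c l * ?M k (\<phi> l) t) \<longlongrightarrow> 0) (lfilt x0)"
        using P_sum_tendsto[of k "{Suc i..n}" c] that i by simp
      from tendsto_diff[OF a[OF that, unfolded F_def] this] show ?thesis by (simp add: A_def)
    qed
    have conv_level: "impr_conv T x0 (Lev T x0 \<phi> n f i d) s" if "d < i" "s \<in> ival T x0" for d s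
    proof (rule iterated_improper_integral_converges[OF A i lim _ _ that])
      show "Lev T x0 \<phi> n f i 0 t = A i t / ?q i t" if "t \<in> ival T x0" for t
        using c[OF that] by (simp add: A_def Kf_def S_def)
      show "Lev T x0 \<phi> n f i (Suc d) t = impr_int x0 (Lev T x0 \<phi> n f i d) t / ?q (i - Suc d) t" for d t
        by (simp add: S_def)
    qed
    then show ?thesis
      unfolding iter_conv_def using i ival_start[OF Tx0] by auto
  qed
  have first: "(\<exists>a1. (\<lambda>x. f x - a1 * \<phi> 1 x) \<in> o[F](\<phi> 1)) \<longleftrightarrow> impr_conv T x0 (Kf T S \<phi> n f 1) T"
  proof -
    \<comment> \<open>For \<open>i = 1\<close> the only condition is at level 0 and the only
      coefficient is \<open>a 1\<close>, so a constant sequence serves.\<close>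
    have "((\<lambda>x. f x - a1 * \<phi> 1 x) \<in> o[F](\<phi> 1)) \<longleftrightarrow> (?M 0 f \<longlongrightarrow> a1) F" for a1
      using expansion[of 1 "\<lambda>_. a1"] n2 by simp
    then show ?thesis using conv_iff[of 1] n2 by simp
  qed
  show ?thesis
  proof (intro conjI ballI allI)
    fix i assume "i \<in> {2..n - 1}"
    then have i: "1 \<le> i" "i \<le> n" "i < n" by auto
    show "(((\<lambda>x. f x - (\<Sum>j=1..i. a j * \<phi> j x)) \<in> o[F](\<phi> i)) \<and>
        (\<forall>k\<in>{1..i - 1}. (\<lambda>x. ?M k f x - (\<Sum>j=k+1..i. a j * ?M k (\<phi> j) x)) \<in> o[F](?M k (\<phi> i))))
      \<longleftrightarrow> (\<forall>k<i. (?M k f \<longlongrightarrow> a (Suc k)) F)" for a :: "nat \<Rightarrow> real"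
      by (rule expansion[OF i(1,2)])
    show "(\<exists>a :: nat \<Rightarrow> real. \<forall>k<i. (?M k f \<longlongrightarrow> a (Suc k)) F) \<longleftrightarrow> (\<exists>l. (?M (i - 1) f \<longlongrightarrow> l) F)"
      by (rule limits_iff[OF i(1,2)])
    show "(\<exists>l. (?M (i - 1) f \<longlongrightarrow> l) F) \<longleftrightarrow> impr_conv T x0 (Kf T S \<phi> n f i) T"
      using conv_iff[OF i(1,2)] by simp
    show "impr_conv T x0 (Kf T S \<phi> n f i) T \<longrightarrow> iter_conv T x0 \<phi> n f i"
      using iterated[OF i(1,3)] by blast
  qed (rule first)
qed

end
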